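(* Let $G=SL(5)$ (Type $A_4$, $W=S_5$ with simple reflections $s_1,\dots,s_4$). The following property fails for the polynomials $P_w(t)$, $w\in\mathcal{J}$: "there exists an involution $w\leftrightarrow\tilde w$ of $\mathcal{J}$ such that $t^{\nu}P_w(1/t)=\pm P_{\tilde w}(t)$ and $\mathcal{L}_D(\tilde w)=S\setminus\mathcal{L}_D(w)$ for all $w\in\mathcal{J}$." Moreover, for $w=s_2s_3s_2$ or $w=s_1s_2s_3s_4s_3s_2s_1$ there exists no $\tilde w\in\mathcal{J}$ satisfying $t^\nu P_w(1/t)=\pm P_{\tilde w}(t)$ and $\mathcal{L}_D(\tilde w)=S\setminus\mathcal{L}_D(w)$.
   Context: $\nu=10$ is the number of positive roots. $S=\{s_1,\dots,s_4\}$ (standard order of the Dynkin diagram), $\mathcal{L}_D(w)=\{s\in S:\ell(sw)<\ell(w)\}$. $T$ is the maximal torus, $\mathbb{Z}[T]$ the group ring of $X^*(T)$ with basis $\exp(\lambda)$, $\Pi$ the simple roots, $\varpi_i$ fundamental weights, $w_0$ the longest element, $q$ a prime power. For $I\subseteq\Pi$, $\overline{I}=\Pi\setminus I$, $\varpi_I=\sum_{i\in I}\varpi_i$, $W_I=\langle s_i:i\in I\rangle$; $I(w)=\{i:\ell(ws_i)<\ell(w)\}$; $C'_w=\sum_{y\le w}P_{y,w}(1)y\in\mathbb{Z}[W]$ with $P_{y,w}$ the Kazhdan-Lusztig polynomials; $f_w=\frac1{|W_{I(w)}|}C_w'(\exp(\varpi_{\overline{I(w)}}))$, a basis of $\mathbb{Z}[T]$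 over $\mathbb{Z}[T]^W$. $\langle f,g\rangle=\frac1\delta\sum_{y}\mathrm{sgn}(y)y(fg)$, $\delta$ the Weyl denominator; $\{f^*_w\}$ is the dual basis, $\langle f_w,f_v^*\rangle=\delta_{w,v}$. $[q]^*\exp(\lambda)=\exp(q\lambda)$. Left cells are the classes of the preorder generated by: $x\le_Ly$ if $C_x'$ occurs in $C_s'C_y'$ for some $s\in S$. $\mathcal{J}$ is the set of $w$ with $w,w^{-1}$ in the same left cell (here: the involutions, including $1$). The Duflo involution of a left cell is its unique element minimizing $\ell(w)-2\deg P_{1,w}$. $M_w=\langle[q]^*f_{w_0d},f_{w_0w}^*\rangle\in\mathbb{Z}[T]^W$, $d$ the Duflo involution in the left cell of $w$. $P_w(t)\in\mathbb{Q}[t]$ is the polynomial with $\dim(M_w)=P_w(q)$, where $\dim$ is the virtual dimension (value at $1\in T$). *)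

theory Defs
  imports
    "HOL-Library.Poly_Mapping"
    "HOL-Library.Product_Plus"
    "HOL-Combinatorics.Permutations"
    "HOL-Computational_Algebra.Polynomial"
    "HOL-Number_Theory.Prime_Powers"
begin

section \<open>The Coxeter group of type \<open>A\<^sub>4\<close>\<close>

type_synonym perm = "nat \<Rightarrow> nat"

definition W :: "perm set" where
  "W = {w. w permutes {1..5}}"

definition s :: "nat \<Rightarrow> perm" where
  "s i = transpose i (Suc i)"

definition S :: "perm set" where
  "S = s ` {1..4}"

definition sprod :: "nat list \<Rightarrow> perm" where
  "sprod is = foldr (\<lambda>i w. s i \<circ> w) is id"

definition len :: "perm \<Rightarrow> nat" where
  "len w = (LEAST n. \<exists>is. set is \<subseteq> {1..4} \<and> sprod is = w \<and> length is = n)"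

definition reduced_word :: "nat list \<Rightarrow> perm \<Rightarrow> bool" where
  "reduced_word is w \<longleftrightarrow> set is \<subseteq> {1..4} \<and> sprod is = w \<and> length is = len w"

definition w0 :: perm where
  "w0 = (THE w. w \<in> W \<and> (\<forall>x\<in>W. len x \<le> len w))"

text \<open>The Bruhat order: the reflections of \<open>W\<close> are the transpositions.\<close>

definition bruhat :: "perm \<Rightarrow> perm \<Rightarrow> bool" where
  "bruhat y w \<longleftrightarrow> w \<in> W \<and>
     (y, w) \<in> {(x, x \<circ> transpose i j) |x i j. x \<in> W \<and> i \<in> {1..5} \<and> j \<in> {1..5} \<and>
                 len x < len (x \<circ> transpose i j)}\<^sup>*"

definition left_descents :: "perm \<Rightarrow> perm set" where
  "left_descents w = {r \<in> S. len (r \<circ> w) < len w}"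

definition right_descents :: "perm \<Rightarrow> nat set" where
  "right_descents w = {i \<in> {1..4}. len (w \<circ> s i) < len w}"

definition parabolic :: "nat set \<Rightarrow> perm set" where
  "parabolic I = {sprod is |is. set is \<subseteq> I}"


section \<open>Kazhdan--Lusztig polynomials\<close>

text \<open>Pushforward of a finitely supported function along a map of the index sets.\<close>

definition push :: "('a \<Rightarrow> 'b) \<Rightarrow> ('a \<Rightarrow>\<^sub>0 int) \<Rightarrow> ('b \<Rightarrow>\<^sub>0 int)" where
  "push g f = (\<Sum>x\<in>Poly_Mapping.keys f. Poly_Mapping.single (g x) (Poly_Mapping.lookup f x))"

text \<open>Laurent polynomials over the integers in \<open>v = q\<^bsup>1/2\<^esup>\<close>: the group ring of the integers,
  whose basis element at \<open>k\<close> is \<open>v\<^bsup>k\<^esup>\<close>.\<close>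

type_synonym laurent = "int \<Rightarrow>\<^sub>0 int"

definition vpow :: "int \<Rightarrow> laurent" where
  "vpow k = Poly_Mapping.single k 1"

definition lbar :: "laurent \<Rightarrow> laurent" where
  "lbar = push uminus"

definition laurent_of_poly :: "int poly \<Rightarrow> laurent" where
  "laurent_of_poly p = (\<Sum>i\<le>degree p. of_int (coeff p i) * vpow (2 * int i))"

text \<open>An element \<open>h\<close> of the Hecke algebra is the sum of the \<open>h y \<cdot> T\<^sub>y\<close> over \<open>y\<close> in \<open>W\<close>.\<close>

type_synonym hecke = "perm \<Rightarrow> laurent"

definition T :: "perm \<Rightarrow> hecke" where
  "T y = (\<lambda>x. if x = y then 1 else 0)"

definition T_simple_T :: "nat \<Rightarrow> perm \<Rightarrow> hecke" where
  "T_simple_T i y =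
     (if len (s i \<circ> y) > len y then T (s i \<circ> y)
      else (\<lambda>x. vpow 2 * T (s i \<circ> y) x + (vpow 2 - 1) * T y x))"

definition T_simple_mult :: "nat \<Rightarrow> hecke \<Rightarrow> hecke" where
  "T_simple_mult i h = (\<lambda>x. \<Sum>y\<in>W. h y * T_simple_T i y x)"

text \<open>From \<open>T\<^sub>s\<^sup>2 = (q - 1) T\<^sub>s + q\<close> one gets \<open>T\<^sub>s\<^bsup>-1\<^esup> = q\<^bsup>-1\<^esup> T\<^sub>s + (q\<^bsup>-1\<^esup> - 1)\<close>.\<close>

definition T_simple_inv_mult :: "nat \<Rightarrow> hecke \<Rightarrow> hecke" where
  "T_simple_inv_mult i h = (\<lambda>x. vpow (-2) * T_simple_mult i h x + (vpow (-2) - 1) * h x)"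

text \<open>The bar involution is semilinear and sends \<open>T\<^sub>w\<close> to the inverse of \<open>T\<close> at \<open>w\<^bsup>-1\<^esup>\<close>; for a
  reduced word \<open>i\<^sub>1 \<dots> i\<^sub>k\<close> of \<open>w\<close> this inverse is the product of the inverses of the
  \<open>T\<close> at \<open>s i\<^sub>1, \<dots>, s i\<^sub>k\<close>, in this order.\<close>

definition bar_T :: "perm \<Rightarrow> hecke" where
  "bar_T w = foldr T_simple_inv_mult (SOME is. reduced_word is w) (T id)"

definition hecke_bar :: "hecke \<Rightarrow> hecke" where
  "hecke_bar h = (\<lambda>x. \<Sum>w\<in>W. lbar (h w) * bar_T w x)"

definition hecke_C :: "perm \<Rightarrow> (perm \<Rightarrow> int poly) \<Rightarrow> hecke" where
  "hecke_C w P = (\<lambda>y. if bruhat y w then vpow (- int (len w)) * laurent_of_poly (P y) else 0)"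

text \<open>\<open>KL y w\<close> is the Kazhdan--Lusztig polynomial indexed by \<open>y\<close> and \<open>w\<close>.\<close>

definition KL :: "perm \<Rightarrow> perm \<Rightarrow> int poly" where
  "KL y w = (THE P.
      hecke_bar (hecke_C w P) = hecke_C w P \<and>
      P w = 1 \<and>
      (\<forall>x. bruhat x w \<and> x \<noteq> w \<longrightarrow> 2 * degree (P x) + 1 \<le> len w - len x) \<and>
      (\<forall>x. \<not> bruhat x w \<longrightarrow> P x = 0)) y"


section \<open>The basis \<open>C'\<close> of the integral group ring of \<open>W\<close>, and left cells\<close>

text \<open>An element of the group ring is a function \<open>a\<close> on \<open>perm\<close> vanishing off \<open>W\<close>;
  \<open>a y\<close> is the coefficient of \<open>y\<close>.\<close>

definition C' :: "perm \<Rightarrow> perm \<Rightarrow> int" where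
  "C' w = (\<lambda>y. if bruhat y w then poly (KL y w) 1 else 0)"

definition gmult :: "(perm \<Rightarrow> int) \<Rightarrow> (perm \<Rightarrow> int) \<Rightarrow> perm \<Rightarrow> int" where
  "gmult a b = (\<lambda>x. \<Sum>y\<in>W. a y * b (inv y \<circ> x))"

definition occurs_in :: "perm \<Rightarrow> (perm \<Rightarrow> int) \<Rightarrow> bool" where
  "occurs_in x a \<longleftrightarrow> x \<in> W \<and> (\<exists>c :: perm \<Rightarrow> int. a = (\<lambda>z. \<Sum>u\<in>W. c u * C' u z) \<and> c x \<noteq> 0)"

definition left_le :: "perm \<Rightarrow> perm \<Rightarrow> bool" where
  "left_le x y \<longleftrightarrow>
     (x, y) \<in> {(x, y). x \<in> W \<and> y \<in> W \<and> (\<exists>r\<in>S. occurs_in x (gmult (C' r) (C' y)))}\<^sup>*"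

definition left_cell :: "perm \<Rightarrow> perm set" where
  "left_cell w = {x \<in> W. left_le x w \<and> left_le w x}"

definition J :: "perm set" where
  "J = {w \<in> W. inv w \<in> left_cell w}"

definition duflo_fn :: "perm \<Rightarrow> int" where
  "duflo_fn w = int (len w) - 2 * int (degree (KL id w))"

definition duflo :: "perm \<Rightarrow> perm" where
  "duflo w = (THE d. d \<in> left_cell w \<and> (\<forall>x\<in>left_cell w. duflo_fn d \<le> duflo_fn x))"


section \<open>The group ring of the character lattice of the maximal torus of \<open>SL(5)\<close>\<close>

text \<open>A weight is given by its coordinates with respect to the fundamental weights. The
  characters of the diagonal torus of \<open>SL(5)\<close> are also the classes of integer vectors
  \<open>(e\<^sub>1, \<dots>, e\<^sub>5)\<close> modulo \<open>(1, \<dots>, 1)\<close>: \<open>wt e\<close> is the class of \<open>e\<close>, and \<open>eps \<mu>\<close> is the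
  representative of \<open>\<mu>\<close> with \<open>e\<^sub>5 = 0\<close>.\<close>

type_synonym weight = "int \<times> int \<times> int \<times> int"

definition wt :: "(nat \<Rightarrow> int) \<Rightarrow> weight" where
  "wt e = (e 1 - e 2, e 2 - e 3, e 3 - e 4, e 4 - e 5)"

fun eps :: "weight \<Rightarrow> nat \<Rightarrow> int" where
  "eps (a, b, c, d) j =
     (if j = 1 then a + b + c + d else if j = 2 then b + c + d
      else if j = 3 then c + d else if j = 4 then d else 0)"

definition act_wt :: "perm \<Rightarrow> weight \<Rightarrow> weight" where
  "act_wt w \<mu> = wt (eps \<mu> \<circ> inv w)"

fun scale_wt :: "int \<Rightarrow> weight \<Rightarrow> weight" where
  "scale_wt m (a, b, c, d) = (m * a, m * b, m * c, m * d)"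

definition fund :: "nat \<Rightarrow> weight" where
  "fund i = (of_bool (i = 1), of_bool (i = 2), of_bool (i = 3), of_bool (i = 4))"

definition fund_sum :: "nat set \<Rightarrow> weight" where
  "fund_sum I = (\<Sum>i\<in>I. fund i)"

definition pos_roots :: "weight set" where
  "pos_roots = {wt (\<lambda>k. of_bool (k = i) - of_bool (k = j)) |i j. 1 \<le> i \<and> i < j \<and> j \<le> 5}"

definition nu :: nat where
  "nu = card pos_roots"

type_synonym ZT = "weight \<Rightarrow>\<^sub>0 int"

definition ex :: "weight \<Rightarrow> ZT" where
  "ex \<mu> = Poly_Mapping.single \<mu> 1"

definition act :: "perm \<Rightarrow> ZT \<Rightarrow> ZT" where
  "act w = push (act_wt w)"

definition gact :: "(perm \<Rightarrow> int) \<Rightarrow> ZT \<Rightarrow> ZT" where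
  "gact a f = (\<Sum>y\<in>W. of_int (a y) * act y f)"

definition frob :: "nat \<Rightarrow> ZT \<Rightarrow> ZT" where
  "frob q = push (scale_wt (int q))"

text \<open>The value at the identity element of the torus.\<close>

definition vdim :: "ZT \<Rightarrow> int" where
  "vdim f = (\<Sum>\<mu>\<in>Poly_Mapping.keys f. Poly_Mapping.lookup f \<mu>)"

text \<open>The quotient is unique for \<open>g \<noteq> 0\<close>, since this group ring is an integral domain.\<close>

definition exact_quot :: "ZT \<Rightarrow> ZT \<Rightarrow> ZT" where
  "exact_quot f g = (THE h. g * h = f)"

definition weyl_denom :: ZT where
  "weyl_denom = ex (fund_sum {1..4}) * (\<Prod>\<alpha>\<in>pos_roots. 1 - ex (- \<alpha>))"

definition pairing :: "ZT \<Rightarrow> ZT \<Rightarrow> ZT" where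
  "pairing f g = exact_quot (\<Sum>y\<in>W. of_int (sign y) * act y (f * g)) weyl_denom"

definition f_basis :: "perm \<Rightarrow> ZT" where
  "f_basis w = exact_quot (gact (C' w) (ex (fund_sum ({1..4} - right_descents w))))
                 (of_nat (card (parabolic (right_descents w))))"

definition f_dual :: "perm \<Rightarrow> ZT" where
  "f_dual v = (THE g. \<forall>w\<in>W. pairing (f_basis w) g = (if w = v then 1 else 0))"


section \<open>The polynomials \<open>P\<^sub>w\<close>\<close>

definition M :: "nat \<Rightarrow> perm \<Rightarrow> ZT" where
  "M q w = pairing (frob q (f_basis (w0 \<circ> duflo w))) (f_dual (w0 \<circ> w))"

definition P :: "perm \<Rightarrow> rat poly" where
  "P w = (THE p. \<forall>q::nat. primepow q \<longrightarrow> poly p (of_nat q) = of_int (vdim (M q w)))"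

definition reversed_pair :: "perm \<Rightarrow> perm \<Rightarrow> bool" where
  "reversed_pair w w' \<longleftrightarrow>
     (\<forall>t::rat. t \<noteq> 0 \<longrightarrow> t ^ nu * poly (P w) (1 / t) = poly (P w') t) \<or>
     (\<forall>t::rat. t \<noteq> 0 \<longrightarrow> t ^ nu * poly (P w) (1 / t) = - poly (P w') t)"

end

theory Submission
  imports Defs "HOL-Library.Product_Lexorder" "Jordan_Normal_Form.Determinant"
begin

text \<open>Let \<open>h = [q]\<^sup>* f\<close> with \<open>f\<close> the basis element attached to \<open>w0 \<circ> d\<close>. It is invariant under the simple
  reflections in the left descent set \<open>L\<close> of \<open>w0 \<circ> d\<close>, hence an invariant combination of the \<open>f\<close> of the elements
  whose left descents contain \<open>L\<close>, and the coefficients are the \<open>M\<close>. Pairing \<open>h\<close> with the Steinberg weights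
  \<open>v (\<varpi>\<^sub>I)\<close>, \<open>I\<close> the right descents of \<open>v\<close>, gives a unitriangular system for them. Its
  virtual dimension is computed by Weyl's dimension formula, and only very few terms survive for the four
  involutions with descent sets \<open>{2, 3}\<close> and \<open>{1, 4}\<close>. Their polynomials are
  \<open>(t^3 + 19 t^5 + 16 t^7) / 36\<close> and \<open>(7 t^4 + 25 t^6 + 4 t^8) / 36\<close> for \<open>{2, 3}\<close>, and
  \<open>(4 t^2 + 25 t^4 + 7 t^6) / 36\<close> and \<open>(17 t^3 + 17 t^5 + 2 t^7) / 36\<close> for \<open>{1, 4}\<close>.
  The only possible partners of \<open>s\<^sub>2 s\<^sub>3 s\<^sub>2\<close> and \<open>s\<^sub>1 s\<^sub>2 s\<^sub>3 s\<^sub>4 s\<^sub>3 s\<^sub>2 s\<^sub>1\<close> are the two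
  involutions with the complementary descent set, and none of them reverses the polynomial.\<close>

text \<open>Kazhdan-Lusztig polynomials, exact quotients, the dual basis and \<open>P\<close> are
  definite descriptions, so each needs existence and uniqueness first. The dual basis is never
  computed: duality only identifies \<open>vdim (M q w)\<close> with coefficients of an expansion,
  which pairings with the Steinberg weights \<open>e_desc v\<close> then determine. Restricting to
  elements with left descents containing \<open>L\<close> keeps these expansions short. It is
  legitimate because such elements are as many as the cosets of the parabolic subgroup of
  \<open>L\<close>: the linear system is square and a determinant argument applies. Sparseness comes
  from heights. A pairing is nonzero only if some weight of the product is regular, hence conjugate
  to \<open>rho\<close> or to a weight at least 4 higher; the class modulo the root lattice
  separates the remaining ties. The value at the identity of the torus cannot be found by division,
  because the Weyl denominator vanishes there. The degree 10 polynomial function \<open>Dt\<close>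
  takes its place, and 288 = 1! 2! 3! 4! is its value at \<open>rho\<close>.\<close>

unbundle no m_inv_syntax

text \<open>The index 1 is to stay a numeral like 2, 3, 4, 5 instead of becoming
  \<open>Suc 0\<close>.\<close>

declare One_nat_def [simp del]

section \<open>Lengths and descents in the symmetric group\<close>

lemma W_I: "w permutes {1..5} \<Longrightarrow> w \<in> W" and W_D: "w \<in> W \<Longrightarrow> w permutes {1..5}"
  by (auto simp: W_def)

lemma finite_W [simp]: "finite W"
  by (simp add: W_def finite_permutations)

lemma id_W [simp]: "id \<in> W"
  by (simp add: W_def permutes_id)

lemma s_W [simp]: "i \<in> {1..4} \<Longrightarrow> s i \<in> W"
  by (auto simp: W_def s_def intro: permutes_swap_id)

lemma comp_W [intro, simp]: "x \<in> W \<Longrightarrow> y \<in> W \<Longrightarrow> x \<circ> y \<in> W"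
  by (simp add: W_def permutes_compose)

lemma inv_W [intro, simp]: "x \<in> W \<Longrightarrow> inv x \<in> W"
  by (simp add: W_def permutes_inv)

lemma inj_W: "x \<in> W \<Longrightarrow> inj x"
  by (auto simp: W_def dest: permutes_inj)

lemma bij_W: "x \<in> W \<Longrightarrow> bij x"
  by (auto simp: W_def dest: permutes_bij)

lemma inv_o_W [simp]: "x \<in> W \<Longrightarrow> inv x \<circ> x = id" "x \<in> W \<Longrightarrow> x \<circ> inv x = id"
  by (auto simp: W_def permutes_inv_o)

lemma inv_W_apply [simp]: "x \<in> W \<Longrightarrow> inv x (x i) = i" "x \<in> W \<Longrightarrow> x (inv x i) = i"
  by (auto simp: W_def permutes_inverses)

lemma inv_inv_W [simp]: "x \<in> W \<Longrightarrow> inv (inv x) = x"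
  by (simp add: bij_W inv_inv_eq)

lemma inv_comp_W: "x \<in> W \<Longrightarrow> y \<in> W \<Longrightarrow> inv (x \<circ> y) = inv y \<circ> inv x"
  by (simp add: bij_W o_inv_distrib)

lemma ss [simp]: "s i \<circ> s i = id" "s i \<circ> (s i \<circ> x) = x" "(x \<circ> s i) \<circ> s i = x"
  by (simp_all add: s_def fun_eq_iff)

lemma inv_s [simp]: "inv (s i) = s i"
  by (rule inv_unique_comp) simp_all

lemma s_apply: "s i j = (if j = i then Suc i else if j = Suc i then i else j)"
  by (simp add: s_def transpose_def)

lemma s_s_apply [simp]: "s i (s i j) = j"
  by (simp add: s_apply)

lemma W_eq_on: "x \<in> W \<Longrightarrow> y \<in> W \<Longrightarrow> (\<And>i. i \<in> {1..5} \<Longrightarrow> x i = y i) \<Longrightarrow> x = y"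
  by (rule ext) (metis W_D permutes_not_in)

lemma W_range: "x \<in> W \<Longrightarrow> i \<in> {1..5} \<Longrightarrow> x i \<in> {1..5}"
  by (metis W_D permutes_in_image)

lemma W_inj_eq: "x \<in> W \<Longrightarrow> x i = x j \<longleftrightarrow> i = j"
  by (metis inj_W injD)

lemma s_W_iff [simp]:
  assumes "i \<in> {1..4}"
  shows "s i \<circ> x \<in> W \<longleftrightarrow> x \<in> W" "x \<circ> s i \<in> W \<longleftrightarrow> x \<in> W"
  by (metis comp_W s_W[OF assms] ss(2)) (metis comp_W s_W[OF assms] ss(3))

lemma transpose_W: "i \<in> {1..5} \<Longrightarrow> j \<in> {1..5} \<Longrightarrow> transpose i j \<in> W"
  by (auto simp: W_def intro: permutes_swap_id)

section \<open>Inversion number and length\<close>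

definition ninv :: "perm \<Rightarrow> nat" where
  "ninv w = (\<Sum>j\<in>{1..5}. \<Sum>i\<in>{1..<j}. of_bool (w j < w i))"

lemma atLeastAtMost_1_5: "{1..5::nat} = {1, 2, 3, 4, 5}"
  by auto

lemma atLeastAtMost_1_4: "{1..4::nat} = {1, 2, 3, 4}"
  by auto

lemma ninv_expand: "ninv w = of_bool (w 2 < w 1) + of_bool (w 3 < w 1) + of_bool (w 3 < w 2)
   + of_bool (w 4 < w 1) + of_bool (w 4 < w 2) + of_bool (w 4 < w 3)
   + of_bool (w 5 < w 1) + of_bool (w 5 < w 2) + of_bool (w 5 < w 3) + of_bool (w 5 < w 4)"
proof -
  have "{1..<2::nat} = {1}" "{1..<3::nat} = {1, 2}" "{1..<4::nat} = {1, 2, 3}" "{1..<5::nat} = {1, 2, 3, 4}"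
    by auto
  then show ?thesis
    by (simp add: ninv_def atLeastAtMost_1_5 add.assoc del: sum_of_bool_eq of_bool_less_iff)
qed

lemma ninv_s_up:
  assumes "k \<in> {1..4}" "w k < w (Suc k)"
  shows "ninv (w \<circ> s k) = Suc (ninv w)"
proof -
  \<comment> \<open>The comparisons become opaque, so each of the four cases is a rearrangement of
    ten summands; only the two comparisons of \<open>k\<close> with \<open>Suc k\<close> are
    evaluated.\<close>
  define b where "b x y = (of_bool (w x < w y) :: nat)" for x y
  have n: "ninv (w \<circ> f) = b (f 2) (f 1) + b (f 3) (f 1) + b (f 3) (f 2) + b (f 4) (f 1) + b (f 4) (f 2)
      + b (f 4) (f 3) + b (f 5) (f 1) + b (f 5) (f 2) + b (f 5) (f 3) + b (f 5) (f 4)" for f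
    by (simp only: ninv_expand b_def o_def)
  have e: "b (Suc k) k = 0" "b k (Suc k) = 1"
    using assms by (simp_all add: b_def)
  have "k \<in> {1, 2, 3, 4}"
    using assms by auto
  then have "ninv (w \<circ> s k) = Suc (ninv (w \<circ> id))"
    using e unfolding n by (elim insertE emptyE; simp add: s_apply)
  then show ?thesis by simp
qed

lemma ninv_s_down:
  assumes "k \<in> {1..4}" "w (Suc k) < w k"
  shows "ninv w = Suc (ninv (w \<circ> s k))"
proof -
  have "ninv ((w \<circ> s k) \<circ> s k) = Suc (ninv (w \<circ> s k))"
    using assms by (intro ninv_s_up) (simp_all add: s_apply)
  then show ?thesis by simp
qed

lemma ninv_s:
  assumes "k \<in> {1..4}" "w \<in> W"
  shows "ninv (w \<circ> s k) = (if w k < w (Suc k) then Suc (ninv w) else ninv w - 1)"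
proof (cases "w k < w (Suc k)")
  case True
  then show ?thesis
    using ninv_s_up[OF assms(1)] by simp
next
  case False
  then have "w (Suc k) < w k"
    using W_inj_eq[OF assms(2), of k "Suc k"] by simp
  then show ?thesis
    using ninv_s_down[OF assms(1), of w] False by simp
qed

text \<open>Conjugating by \<open>s j\<close> reduces \<open>transpose i (Suc j)\<close> to
  \<open>transpose i j\<close>. The two outer swaps lose nothing on balance: the first loses an
  inversion only if \<open>w (Suc j) < w j\<close>, and then \<open>w i < w j\<close> makes the last
  one regain it.\<close>

lemma ninv_transpose:
  assumes "1 \<le> i" "i < j" "j \<le> 5" "w i < w j" "w \<in> W"
  shows "ninv w < ninv (w \<circ> transpose i j)"
  using assms(2-5)
proof (induction j arbitrary: w)
  case (Suc j)
  show ?case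
  proof (cases "i = j")
    case True
    then have "ninv (w \<circ> s j) = Suc (ninv w)"
      using Suc.prems assms(1) by (intro ninv_s_up) auto
    then show ?thesis
      unfolding True by (simp only: s_def lessI)
  next
    case False
    then have ij: "i < j" "j \<in> {1..4}" "j \<le> 5"
      using Suc.prems assms(1) by auto
    have t: "w \<circ> transpose i (Suc j) = w \<circ> s j \<circ> transpose i j \<circ> s j"
      using ij by (auto simp: fun_eq_iff transpose_def s_apply)
    define u where "u = w \<circ> s j"
    define v where "v = u \<circ> transpose i j"
    have W: "u \<in> W" "v \<in> W"
      using Suc.prems ij assms(1) unfolding u_def v_def by (auto intro!: comp_W transpose_W)
    have "u i < u j"
      using ij Suc.prems by (simp add: u_def s_apply)
    then have uv: "ninv u < ninv v"
      using Suc.IH[of u] ij W by (simp only: v_def)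
    have e: "v j = w i" "v (Suc j) = w j"
      using ij by (simp_all add: u_def v_def s_apply transpose_def)
    have "w j \<noteq> w (Suc j)" "w j \<noteq> w i"
      using Suc.prems(4) ij by (simp_all add: W_inj_eq)
    then have "ninv w < ninv (v \<circ> s j)"
      using uv ninv_s[OF ij(2) Suc.prems(4), folded u_def] ninv_s[OF ij(2) W(2)] e Suc.prems(3)
      by (auto split: if_splits)
    then show ?thesis
      unfolding t u_def v_def .
  qed
qed simp

lemma no_descent_id:
  assumes "w \<in> W" "\<And>k. k \<in> {1..4} \<Longrightarrow> w k < w (Suc k)"
  shows "w = id"
proof (rule W_eq_on[OF assms(1) id_W])
  fix i :: nat assume i: "i \<in> {1..5}"
  have "w 1 < w 2" "w 2 < w 3" "w 3 < w 4" "w 4 < w 5"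
    using assms(2)[of 1] assms(2)[of 2] assms(2)[of 3] assms(2)[of 4] by simp_all
  moreover have "w 1 \<ge> 1" "w 5 \<le> 5"
    using W_range[OF assms(1), of 1] W_range[OF assms(1), of 5] by auto
  ultimately have "w 1 = 1" "w 2 = 2" "w 3 = 3" "w 4 = 4" "w 5 = 5"
    by linarith+
  then show "w i = id i"
    using i by (auto simp: atLeastAtMost_1_5)
qed

lemma sprod_Cons [simp]: "sprod (i # is) = s i \<circ> sprod is"
  by (simp add: sprod_def)

lemma sprod_Nil [simp]: "sprod [] = id"
  by (simp add: sprod_def)

lemma sprod_append [simp]: "sprod (is @ js) = sprod is \<circ> sprod js"
  by (induction "is") (auto simp: o_assoc)

lemma sprod_W: "set is \<subseteq> {1..4} \<Longrightarrow> sprod is \<in> W"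
  by (induction "is") auto

lemma inv_sprod: "set is \<subseteq> {1..4} \<Longrightarrow> inv (sprod is) = sprod (rev is)"
proof (induction "is")
  case (Cons i "is")
  then show ?case
    using inv_comp_W[of "s i" "sprod is"] sprod_W[of "is"] by (simp add: o_def)
qed simp

lemma ninv_sprod_le: "set is \<subseteq> {1..4} \<Longrightarrow> ninv (sprod is) \<le> length is"
proof (induction "is" rule: rev_induct)
  case Nil
  then show ?case by (simp add: ninv_expand)
next
  case (snoc i "is")
  then show ?case
    using ninv_s[of i "sprod is"] sprod_W[of "is"] by (auto simp: o_def split: if_splits)
qed

lemma ninv_word: "w \<in> W \<Longrightarrow> \<exists>is. set is \<subseteq> {1..4} \<and> sprod is = w \<and> length is = ninv w"
proof (induction "ninv w" arbitrary: w rule: less_induct)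
  case less
  show ?case
  proof (cases "\<exists>k\<in>{1..4}. w (Suc k) < w k")
    case True
    then obtain k where k: "k \<in> {1..4}" "w (Suc k) < w k" by blast
    then have n: "ninv (w \<circ> s k) = ninv w - 1" "ninv w > 0"
      using ninv_s_down[OF k] by simp_all
    then obtain "is" where "set is \<subseteq> {1..4}" "sprod is = w \<circ> s k" "length is = ninv (w \<circ> s k)"
      using less.hyps[of "w \<circ> s k"] less.prems k by auto
    then have "set (is @ [k]) \<subseteq> {1..4} \<and> sprod (is @ [k]) = w \<and> length (is @ [k]) = ninv w"
      using n k by (auto simp: o_assoc)
    then show ?thesis by blast
  next
    case False
    then have "w = id"
      using less.prems by (intro no_descent_id) (metis W_inj_eq linorder_neqE_nat n_not_Suc_n)+
    then show ?thesis
      by (intro exI[of _ "[]"]) (simp add: ninv_expand)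
  qed
qed

lemma len_eq_ninv:
  assumes "w \<in> W"
  shows "len w = ninv w"
  unfolding len_def
proof (rule Least_equality)
  show "\<exists>is. set is \<subseteq> {1..4} \<and> sprod is = w \<and> length is = ninv w"
    using ninv_word[OF assms] .
qed (use ninv_sprod_le in blast)

lemma reduced_word_exists: "w \<in> W \<Longrightarrow> \<exists>is. reduced_word is w"
  using ninv_word len_eq_ninv unfolding reduced_word_def by metis

lemma len_sprod_le: "set is \<subseteq> {1..4} \<Longrightarrow> len (sprod is) \<le> length is"
  by (simp add: len_eq_ninv ninv_sprod_le sprod_W)

lemma reduced_word_rev:
  assumes "reduced_word is w"
  shows "reduced_word (rev is) (inv w)" "len (inv w) = len w"
proof -
  have r: "set is \<subseteq> {1..4}" "sprod is = w" "length is = len w" and w: "w \<in> W"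
    using assms sprod_W by (auto simp: reduced_word_def)
  have i: "sprod (rev is) = inv w"
    using inv_sprod[OF r(1)] r(2) by simp
  have "len (inv w) \<le> len w"
    using len_sprod_le[of "rev is"] r i by simp
  moreover have "len w \<le> len (inv w)"
  proof -
    obtain js where js: "reduced_word js (inv w)"
      using reduced_word_exists w by blast
    then have j: "set js \<subseteq> {1..4}" "sprod js = inv w" "length js = len (inv w)"
      by (simp_all add: reduced_word_def)
    then have "sprod (rev js) = w"
      using inv_sprod[OF j(1)] w by simp
    then show ?thesis
      using len_sprod_le[of "rev js"] j by simp
  qed
  ultimately show l: "len (inv w) = len w" by simp
  show "reduced_word (rev is) (inv w)"
    using r i l by (simp add: reduced_word_def)
qed

lemma len_inv [simp]: "w \<in> W \<Longrightarrow> len (inv w) = len w"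
  using reduced_word_exists reduced_word_rev by blast

lemma len_id [simp]: "len id = 0"
  by (simp add: len_eq_ninv ninv_expand)

lemma len_0_iff: "w \<in> W \<Longrightarrow> len w = 0 \<longleftrightarrow> w = id"
  using reduced_word_exists[of w] by (auto simp: reduced_word_def)

section \<open>Right and left descents read off the one-line notation\<close>

definition rd :: "perm \<Rightarrow> nat \<Rightarrow> bool" where "rd w k \<longleftrightarrow> w (Suc k) < w k"

definition ld :: "perm \<Rightarrow> nat \<Rightarrow> bool" where "ld w k \<longleftrightarrow> rd (inv w) k"

lemma len_s_right:
  assumes "w \<in> W" "k \<in> {1..4}"
  shows "rd w k \<Longrightarrow> len w = Suc (len (w \<circ> s k))" "\<not> rd w k \<Longrightarrow> len (w \<circ> s k) = Suc (len w)"
proof -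
  assume "rd w k"
  then show "len w = Suc (len (w \<circ> s k))"
    using ninv_s_down[OF assms(2)] assms by (simp add: len_eq_ninv rd_def)
next
  assume "\<not> rd w k"
  then show "len (w \<circ> s k) = Suc (len w)"
    using ninv_s_up[OF assms(2)] assms W_inj_eq[OF assms(1), of k "Suc k"]
    by (simp add: len_eq_ninv rd_def)
qed

lemma rd_s [simp]: "w \<in> W \<Longrightarrow> rd (w \<circ> s k) k \<longleftrightarrow> \<not> rd w k"
  using W_inj_eq[of w k "Suc k"] by (auto simp: rd_def s_apply)

lemma inv_s_left: "w \<in> W \<Longrightarrow> k \<in> {1..4} \<Longrightarrow> inv (s k \<circ> w) = inv w \<circ> s k"
  by (simp add: inv_comp_W)

lemma inv_s_right: "w \<in> W \<Longrightarrow> k \<in> {1..4} \<Longrightarrow> inv (w \<circ> s k) = s k \<circ> inv w"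
  by (simp add: inv_comp_W)

lemma len_s_left:
  assumes "w \<in> W" "k \<in> {1..4}"
  shows "ld w k \<Longrightarrow> len w = Suc (len (s k \<circ> w))" "\<not> ld w k \<Longrightarrow> len (s k \<circ> w) = Suc (len w)"
proof -
  have "len (s k \<circ> w) = len (inv w \<circ> s k)"
    using assms len_inv[of "s k \<circ> w"] inv_s_left[OF assms] by simp
  then show "ld w k \<Longrightarrow> len w = Suc (len (s k \<circ> w))" "\<not> ld w k \<Longrightarrow> len (s k \<circ> w) = Suc (len w)"
    using len_s_right[of "inv w" k] assms by (auto simp: ld_def)
qed

lemma ld_s [simp]: "w \<in> W \<Longrightarrow> k \<in> {1..4} \<Longrightarrow> ld (s k \<circ> w) k \<longleftrightarrow> \<not> ld w k"
  by (simp add: ld_def inv_s_left)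

lemma ld_iff: "w \<in> W \<Longrightarrow> k \<in> {1..4} \<Longrightarrow> len (s k \<circ> w) < len w \<longleftrightarrow> ld w k"
  by (metis len_s_left lessI not_less_iff_gr_or_eq)

lemma rd_iff: "w \<in> W \<Longrightarrow> k \<in> {1..4} \<Longrightarrow> len (w \<circ> s k) < len w \<longleftrightarrow> rd w k"
  by (metis len_s_right lessI not_less_iff_gr_or_eq)

lemma rd_inv: "w \<in> W \<Longrightarrow> rd (inv w) k \<longleftrightarrow> ld w k" and ld_inv: "w \<in> W \<Longrightarrow> ld (inv w) k \<longleftrightarrow> rd w k"
  by (simp_all add: ld_def)

lemma right_descents_eq: "w \<in> W \<Longrightarrow> right_descents w = {k \<in> {1..4}. rd w k}"
  by (auto simp: right_descents_def rd_iff)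

text \<open>A left and a right multiplication either both change the length of \<open>w\<close> independently, or
  coincide on \<open>w\<close>.\<close>

lemma s_changes_order:
  assumes "(s j r < s j p) \<noteq> (r < p)"
  shows "p = j \<and> r = Suc j \<or> p = Suc j \<and> r = j"
proof (rule ccontr)
  assume *: "\<not> ?thesis"
  consider "p = j" | "p = Suc j" | "p \<noteq> j" "p \<noteq> Suc j" by blast
  then show False
    by cases (use * assms in \<open>auto simp: s_apply split: if_splits\<close>)
qed

lemma ld_right_change:
  assumes w: "w \<in> W" and i: "i \<in> {1..4}" and j: "j \<in> {1..4}" and d: "ld (w \<circ> s j) i \<noteq> ld w i"
  shows "s i \<circ> w = w \<circ> s j"
proof -
  have I: "inv (w \<circ> s j) = s j \<circ> inv w"
    using w j by (rule inv_s_right)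
  have "(s j (inv w (Suc i)) < s j (inv w i)) \<noteq> (inv w (Suc i) < inv w i)"
    using d unfolding ld_def rd_def I o_apply .
  then have "inv w i = j \<and> inv w (Suc i) = Suc j \<or> inv w i = Suc j \<and> inv w (Suc i) = j"
    by (rule s_changes_order)
  then have e: "w j = i \<and> w (Suc j) = Suc i \<or> w j = Suc i \<and> w (Suc j) = i"
    using inv_W_apply(2)[OF w] by metis
  show ?thesis
  proof
    fix k
    consider "k = j" | "k = Suc j" | "w k \<noteq> w j" "w k \<noteq> w (Suc j)"
      using W_inj_eq[OF w] by metis
    then show "(s i \<circ> w) k = (w \<circ> s j) k"
      unfolding o_apply by cases (use e in \<open>auto simp: s_apply\<close>)
  qed
qed

section \<open>The Bruhat order\<close>

abbreviation bstep :: "(perm \<times> perm) set" where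
  "bstep \<equiv> {(x, x \<circ> transpose i j) |x i j. x \<in> W \<and> i \<in> {1..5} \<and> j \<in> {1..5} \<and>
                 len x < len (x \<circ> transpose i j)}"

lemma len_transpose:
  assumes "x \<in> W" "1 \<le> i" "i < j" "j \<le> 5"
  shows "len x < len (x \<circ> transpose i j) \<longleftrightarrow> x i < x j"
proof -
  have W: "x \<circ> transpose i j \<in> W"
    using assms by (intro comp_W transpose_W) auto
  have "x i \<noteq> x j"
    using assms W_inj_eq by auto
  moreover have "ninv x < ninv (x \<circ> transpose i j)" if "x i < x j"
    using ninv_transpose that assms by blast
  moreover have "ninv (x \<circ> transpose i j) < ninv x" if "x j < x i"
    using ninv_transpose[of i j "x \<circ> transpose i j"] that assms W by (simp add: o_assoc[symmetric])
  ultimately show ?thesis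
    using assms W by (auto simp: len_eq_ninv linorder_neq_iff)
qed

lemma bstepE:
  assumes "(x, y) \<in> bstep"
  obtains i j where "x \<in> W" "y \<in> W" "1 \<le> i" "i < j" "j \<le> 5" "x i < x j" "y = x \<circ> transpose i j" "len x < len y"
proof -
  obtain i j where ij: "x \<in> W" "i \<in> {1..5}" "j \<in> {1..5}" "y = x \<circ> transpose i j" "len x < len y"
    using assms by blast
  have ne: "i \<noteq> j"
    using ij by (intro notI) simp
  have W: "y \<in> W"
    unfolding ij(4) using ij(1-3) by (intro comp_W transpose_W)
  show ?thesis
  proof (cases "i < j")
    case True
    then show ?thesis
      using ij that[of i j] W len_transpose[of x i j] by auto
  next
    case False
    then show ?thesis
      using ij ne that[of j i] W len_transpose[of x j i] by (auto simp: transpose_commute)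
  qed
qed

lemma bstepI: "x \<in> W \<Longrightarrow> 1 \<le> i \<Longrightarrow> i < j \<Longrightarrow> j \<le> 5 \<Longrightarrow> x i < x j \<Longrightarrow> (x, x \<circ> transpose i j) \<in> bstep"
  using len_transpose[of x i j] by fastforce

lemma bruhat_refl [simp]: "bruhat w w \<longleftrightarrow> w \<in> W"
  by (simp add: bruhat_def)

lemma bruhat_iff: "bruhat y w \<longleftrightarrow> w \<in> W \<and> (y, w) \<in> bstep\<^sup>*"
  by (simp add: bruhat_def)

lemma bruhat_W: "bruhat y w \<Longrightarrow> w \<in> W" "bruhat y w \<Longrightarrow> y \<in> W"
proof -
  assume b: "bruhat y w"
  then show w: "w \<in> W"
    by (simp add: bruhat_def)
  have "(y, w) \<in> bstep\<^sup>*"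
    using b by (simp add: bruhat_iff)
  then show "y \<in> W"
    by (cases rule: converse_rtranclE) (use w in simp, erule bstepE, simp)
qed

lemma bruhat_trans: "bruhat x y \<Longrightarrow> bruhat y z \<Longrightarrow> bruhat x z"
  unfolding bruhat_iff by (auto intro: rtrancl_trans)

lemma bruhat_step:
  assumes "(x, y) \<in> bstep"
  shows "bruhat x y"
proof -
  have "y \<in> W"
    using assms by (rule bstepE)
  then show ?thesis
    unfolding bruhat_iff using assms by (intro conjI r_into_rtrancl)
qed

lemma bruhat_induct [consumes 1, case_names refl step]:
  assumes "bruhat y w"
    and "\<And>w. w \<in> W \<Longrightarrow> Q w w"
    and "\<And>y y' w. (y, y') \<in> bstep \<Longrightarrow> bruhat y' w \<Longrightarrow> Q y' w \<Longrightarrow> Q y w"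
  shows "Q y w"
proof -
  have w: "w \<in> W" and r: "(y, w) \<in> bstep\<^sup>*"
    using assms(1) by (auto simp: bruhat_iff)
  from r show ?thesis
  proof (induction rule: converse_rtrancl_induct)
    case base
    then show ?case using assms(2) w by blast
  next
    case (step y z)
    then show ?case
      using assms(3)[of y z w] w by (simp add: bruhat_iff)
  qed
qed

lemma bruhat_len: "bruhat y w \<Longrightarrow> y = w \<or> len y < len w"
  by (induction rule: bruhat_induct) (auto elim: bstepE)

lemma bruhat_len_le: "bruhat y w \<Longrightarrow> len y \<le> len w"
  using bruhat_len by fastforce

lemma bruhat_antisym: "bruhat y w \<Longrightarrow> len w \<le> len y \<Longrightarrow> y = w"
  using bruhat_len by fastforce

text \<open>Inversion turns the transposition of the positions \<open>i\<close>, \<open>j\<close>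
  into the transposition of the values \<open>x i\<close>, \<open>x j\<close>, which are in the same
  order.\<close>

lemma bstep_inv:
  assumes "(x, y) \<in> bstep"
  shows "(inv x, inv y) \<in> bstep"
proof -
  obtain i j where ij: "x \<in> W" "y \<in> W" "1 \<le> i" "i < j" "j \<le> 5" "x i < x j" "y = x \<circ> transpose i j" "len x < len y"
    using assms by (rule bstepE)
  have t: "transpose i j \<in> W"
    using ij by (intro transpose_W) auto
  have "inv y = transpose i j \<circ> inv x"
    using ij t by (simp add: inv_comp_W)
  also have "\<dots> = inv x \<circ> transpose (x i) (x j)"
    using ij by (auto simp: fun_eq_iff transpose_def)
  finally show ?thesis
    using bstepI[of "inv x" "x i" "x j"] ij W_range[of x i] W_range[of x j] by simp
qed

lemma bruhat_inv: "bruhat y w \<Longrightarrow> bruhat (inv y) (inv w)"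
proof (induction rule: bruhat_induct)
  case (step y y' w)
  then show ?case
    using bruhat_trans[OF bruhat_step[OF bstep_inv]] by blast
qed simp

lemma bruhat_inv_iff: "y \<in> W \<Longrightarrow> w \<in> W \<Longrightarrow> bruhat (inv y) (inv w) \<longleftrightarrow> bruhat y w"
  using bruhat_inv[of y w] bruhat_inv[of "inv y" "inv w"] by auto

lemma bruhat_s_right:
  assumes "w \<in> W" "k \<in> {1..4}" "\<not> rd w k"
  shows "bruhat w (w \<circ> s k)"
  using bstepI[of w k "Suc k"] assms W_inj_eq[of w k "Suc k"]
  by (intro bruhat_step) (auto simp: s_def rd_def)

lemma bruhat_s_left:
  assumes "w \<in> W" "k \<in> {1..4}" "\<not> ld w k"
  shows "bruhat w (s k \<circ> w)"
  using bruhat_inv[OF bruhat_s_right[of "inv w" k]] assms inv_s_left[of w k] inv_s_right[of "inv w" k]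
  by (simp add: ld_def)

text \<open>Left multiplication by \<open>s k\<close> keeps the order of the values
  \<open>x i < x j\<close> unless they are \<open>k\<close> and \<open>Suc k\<close>; in that case
  it performs the very exchange of this Bruhat edge.\<close>

lemma bstep_lift:
  assumes "(x, y) \<in> bstep" "k \<in> {1..4}"
  shows "bruhat (s k \<circ> x) (s k \<circ> y) \<or> s k \<circ> x = y"
proof -
  obtain i j where ij: "x \<in> W" "y \<in> W" "1 \<le> i" "i < j" "j \<le> 5" "x i < x j" "y = x \<circ> transpose i j" "len x < len y"
    using assms(1) by (rule bstepE)
  show ?thesis
  proof (cases "s k (x i) < s k (x j)")
    case True
    then have "(s k \<circ> x, s k \<circ> x \<circ> transpose i j) \<in> bstep"
      using ij assms by (intro bstepI) auto
    then show ?thesis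
      using ij bruhat_step by (auto simp: o_assoc)
  next
    case False
    then have "x i = k" "x j = Suc k"
      using ij(6) by (auto simp: s_apply split: if_splits)
    then have "(s k \<circ> x) a = (x \<circ> transpose i j) a" for a
      using ij(4) W_inj_eq[OF ij(1), of a i] W_inj_eq[OF ij(1), of a j]
      by (auto simp: s_apply transpose_def)
    then show ?thesis
      unfolding ij(7) by blast
  qed
qed

text \<open>The lifting property, obtained edge by edge. When an edge degenerates to
  \<open>s k \<circ> y = y'\<close>, the chain \<open>y' \<le> w \<le> s k \<circ> w\<close> in the
  Bruhat order takes over.\<close>

lemma bruhat_lift:
  assumes "bruhat y w" "k \<in> {1..4}" "\<not> ld w k"
  shows "bruhat (s k \<circ> y) (s k \<circ> w)"
  using assms(1,3)
proof (induction rule: bruhat_induct)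
  case (refl w)
  then show ?case
    using assms(2) comp_W[OF s_W, of k w] by (simp add: o_def)
next
  case (step y y' w)
  have IH: "bruhat (s k \<circ> y') (s k \<circ> w)"
    using step by blast
  have "bruhat w (s k \<circ> w)"
    using step(2,4) assms(2) bruhat_W(1) by (intro bruhat_s_left)
  then have "bruhat y' (s k \<circ> w)"
    using step(2) by (rule bruhat_trans[rotated])
  then show ?case
    using bstep_lift[OF step(1) assms(2)] IH bruhat_trans[of "s k \<circ> y" "s k \<circ> y'" "s k \<circ> w"] by (auto simp: o_def)
qed

lemma bruhat_below_s: "bruhat y w \<Longrightarrow> k \<in> {1..4} \<Longrightarrow> \<not> ld w k \<Longrightarrow> bruhat y (s k \<circ> w)"
  by (rule bruhat_trans[OF _ bruhat_s_left]) (use bruhat_W in auto)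

text \<open>The lower Bruhat interval of \<open>w\<close> is stable under the left descents of \<open>w\<close>.\<close>

lemma bruhat_s_stable:
  assumes "bruhat y w" "k \<in> {1..4}" "ld w k"
  shows "bruhat (s k \<circ> y) w"
  using assms(1,3)
proof (induction rule: bruhat_induct)
  case (refl w)
  have "\<not> ld (s k \<circ> w) k"
    using refl assms(2) by (subst ld_s) auto
  then have "bruhat (s k \<circ> w) (s k \<circ> (s k \<circ> w))"
    using refl assms(2) by (intro bruhat_s_left) auto
  then show ?case
    by (simp add: o_def)
next
  case (step y y' w)
  have "bruhat (s k \<circ> y') w"
    using step by blast
  then show ?case
    using bstep_lift[OF step(1) assms(2)] step(2) bruhat_trans[of "s k \<circ> y" "s k \<circ> y'" w] by (auto simp: o_def)
qed

section \<open>Laurent polynomials\<close>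

lemma vpow_add: "vpow a * vpow b = vpow (a + b)"
  by (simp add: vpow_def mult_single)

lemma vpow_0 [simp]: "vpow 0 = 1"
  by (simp add: vpow_def)

lemma vpow_2_inverse [simp]: "vpow 2 * vpow (-2) = 1" "vpow (-2) * vpow 2 = 1"
  by (simp_all add: vpow_add)

lemma vpow_mult_cancel [simp]: "vpow a * (vpow (- a) * x) = x" "vpow (- a) * (vpow a * x) = x"
  by (simp_all flip: mult.assoc add: vpow_add)

lemma push_superset:
  assumes "finite A" "Poly_Mapping.keys f \<subseteq> A"
  shows "push g f = (\<Sum>x\<in>A. Poly_Mapping.single (g x) (Poly_Mapping.lookup f x))"
  unfolding push_def
  by (rule sum.mono_neutral_left) (use assms in \<open>auto simp: not_in_keys_iff_lookup_eq_zero\<close>)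

lemma push_0 [simp]: "push g 0 = 0"
  by (simp add: push_def)

lemma push_single [simp]: "push g (Poly_Mapping.single x c) = Poly_Mapping.single (g x) c"
  by (cases "c = 0") (simp_all add: push_def)

lemma push_add: "push g (f + h) = push g f + push g h"
proof -
  let ?A = "Poly_Mapping.keys f \<union> Poly_Mapping.keys h"
  have "Poly_Mapping.keys (f + h) \<subseteq> ?A"
    by (rule keys_add)
  then show ?thesis
    by (simp add: push_superset[of ?A] lookup_add single_add sum.distrib)
qed

lemma poly_mapping_sum_singles:
  "f = (\<Sum>x\<in>Poly_Mapping.keys f. Poly_Mapping.single x (Poly_Mapping.lookup f x))"
  by (rule poly_mapping_eqI) (auto simp: lookup_sum lookup_single when_def not_in_keys_iff_lookup_eq_zero)

lemma poly_mapping_induct [case_names zero single add]: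
  fixes f :: "'a \<Rightarrow>\<^sub>0 'b::comm_monoid_add"
  assumes "Q 0" "\<And>x c. Q (Poly_Mapping.single x c)" "\<And>f g. Q f \<Longrightarrow> Q g \<Longrightarrow> Q (f + g)"
  shows "Q f"
proof -
  have "Q (\<Sum>x\<in>A. Poly_Mapping.single x (Poly_Mapping.lookup f x))" if "finite A" for A
    using that by induction (use assms in auto)
  from this[OF finite_keys] show ?thesis
    by (subst poly_mapping_sum_singles)
qed

lemma lookup_vpow_mult: "Poly_Mapping.lookup (vpow a * f) k = Poly_Mapping.lookup f (k - a)"
  by (induction f rule: poly_mapping_induct)
    (auto simp: vpow_def mult_single lookup_single when_def distrib_left lookup_add)

lemma push_mult:
  fixes f h :: "'a::monoid_add \<Rightarrow>\<^sub>0 int"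
  assumes "\<And>x y. g (x + y) = (g x + g y :: 'b::monoid_add)"
  shows "push g (f * h) = push g f * push g h"
proof (induction f rule: poly_mapping_induct)
  case (single x c)
  show ?case
    by (induction h rule: poly_mapping_induct) (simp_all add: mult_single assms distrib_left push_add)
qed (simp_all add: distrib_right push_add)

lemma push_uminus: "push g (- f) = - push g f"
  using push_add[of g f "- f"] by (simp add: eq_neg_iff_add_eq_0 add.commute)

lemma push_diff: "push g (f - h) = push g f - push g h"
  using push_add[of g f "- h"] by (simp add: push_uminus)

lemma push_sum: "push g (\<Sum>i\<in>A. f i) = (\<Sum>i\<in>A. push g (f i))"
  by (induction A rule: infinite_finite_induct) (simp_all add: push_add)

lemma push_push: "push g (push h f) = push (g \<circ> h) f"
  by (induction f rule: poly_mapping_induct) (simp_all add: push_add)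

lemma push_id: "push (\<lambda>x. x) f = f"
  by (induction f rule: poly_mapping_induct) (simp_all add: push_add)

lemma lbar_simps [simp]:
  "lbar 0 = 0" "lbar 1 = 1" "lbar (vpow k) = vpow (- k)"
  "lbar (f + g) = lbar f + lbar g" "lbar (f - g) = lbar f - lbar g" "lbar (- f) = - lbar f"
  "lbar (f * g) = lbar f * lbar g" "lbar (\<Sum>i\<in>A. h i) = (\<Sum>i\<in>A. lbar (h i))" "lbar (lbar f) = f"
  by (simp_all add: lbar_def push_add push_diff push_uminus push_mult push_sum vpow_def push_push o_def push_id
      flip: single_one)

lemma lbar_of_int [simp]: "lbar (of_int n) = of_int n"
  by (cases n) (simp_all add: lbar_def flip: single_of_int single_of_nat)

lemma lookup_lbar: "Poly_Mapping.lookup (lbar f) k = Poly_Mapping.lookup f (- k)"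
  unfolding lbar_def
  by (induction f rule: poly_mapping_induct) (auto simp: push_add lookup_add lookup_single when_def)

lemma lookup_of_int_mult: "Poly_Mapping.lookup (of_int c * f) k = c * Poly_Mapping.lookup (f :: laurent) k"
  by (induction f rule: poly_mapping_induct)
    (auto simp: mult_single lookup_single when_def distrib_left lookup_add simp flip: single_of_int)

lemma lookup_laurent_of_poly:
  "Poly_Mapping.lookup (laurent_of_poly p) k = (if k \<ge> 0 \<and> even k then coeff p (nat (k div 2)) else 0)"
proof -
  have "Poly_Mapping.lookup (laurent_of_poly p) k = (\<Sum>i\<le>degree p. if 2 * int i = k then coeff p i else 0)"
    unfolding laurent_of_poly_def lookup_sum
    by (intro sum.cong refl) (auto simp: lookup_of_int_mult vpow_def lookup_single when_def)
  also have "\<dots> = (if k \<ge> 0 \<and> even k then coeff p (nat (k div 2)) else 0)"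
  proof (cases "k \<ge> 0 \<and> even k")
    case True
    then obtain n where k: "k = 2 * int n"
      by (metis evenE nonneg_int_cases zero_le_mult_iff zero_less_numeral not_less)
    have "(\<Sum>i\<le>degree p. if 2 * int i = k then coeff p i else 0) = (\<Sum>i\<le>degree p. if i = n then coeff p i else 0)"
      by (intro sum.cong refl) (simp add: k)
    then show ?thesis
      by (simp add: k coeff_eq_0)
  qed (auto intro!: sum.neutral)
  finally show ?thesis .
qed

lemma laurent_of_poly_simps [simp]:
  "laurent_of_poly 0 = 0" "laurent_of_poly 1 = 1"
  "laurent_of_poly (p + r) = laurent_of_poly p + laurent_of_poly r"
  "laurent_of_poly (p - r) = laurent_of_poly p - laurent_of_poly r"
  "laurent_of_poly (Polynomial.smult c p) = of_int c * laurent_of_poly p"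
  by (rule poly_mapping_eqI;
      auto simp: lookup_laurent_of_poly lookup_add lookup_minus lookup_of_int_mult lookup_one when_def coeff_1)+

lemma laurent_of_poly_sum: "laurent_of_poly (\<Sum>i\<in>A. f i) = (\<Sum>i\<in>A. laurent_of_poly (f i))"
  by (induction A rule: infinite_finite_induct) simp_all

lemma laurent_of_poly_monom_mult: "laurent_of_poly (monom 1 n * p) = vpow (2 * int n) * laurent_of_poly p"
proof (rule poly_mapping_eqI)
  fix k
  have "nat ((k - 2 * int n) div 2) = nat (k div 2) - n" if "even k"
    using that by (auto elim!: evenE)
  moreover have "n \<le> nat (k div 2) \<longleftrightarrow> 0 \<le> k - 2 * int n" if "even k" "0 \<le> k"
    using that by (auto elim!: evenE)
  ultimately show "Poly_Mapping.lookup (laurent_of_poly (monom 1 n * p)) k = Poly_Mapping.lookup (vpow (2 * int n) * laurent_of_poly p) k"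
    by (auto simp: lookup_laurent_of_poly lookup_vpow_mult coeff_monom_mult)
qed

section \<open>The Hecke algebra and its bar involution\<close>

text \<open>The type \<open>hecke\<close> contains functions on all of \<open>perm\<close>; those
  vanishing off \<open>W\<close> are the honest elements of the Hecke algebra, for which comparing
  coefficients on \<open>W\<close> suffices.\<close>

definition supp_W :: "hecke \<Rightarrow> bool" where "supp_W h \<longleftrightarrow> (\<forall>x. x \<notin> W \<longrightarrow> h x = 0)"

lemma supp_W_T [simp]: "w \<in> W \<Longrightarrow> supp_W (T w)"
  by (auto simp: supp_W_def T_def)

lemma hecke_eqI: "supp_W f \<Longrightarrow> supp_W g \<Longrightarrow> (\<And>x. x \<in> W \<Longrightarrow> f x = g x) \<Longrightarrow> f = g"
  unfolding supp_W_def fun_eq_iff by metis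

lemma s_neq [simp]: "i \<in> {1..4} \<Longrightarrow> x \<in> W \<Longrightarrow> s i \<circ> x \<noteq> x"
  by (metis ld_s)

text \<open>The definition describes left multiplication by its column at \<open>y\<close>.
  Coefficients of a product need the row at \<open>x\<close>, which has entries only at
  \<open>x\<close> and \<open>s i \<circ> x\<close>.\<close>

lemma T_simple_T_apply:
  assumes "i \<in> {1..4}" "x \<in> W" "y \<in> W"
  shows "T_simple_T i y x = (if ld x i then (if y = s i \<circ> x then 1 else 0) + (if y = x then vpow 2 - 1 else 0)
      else (if y = s i \<circ> x then vpow 2 else 0))"
proof -
  have len: "len (s i \<circ> y) > len y \<longleftrightarrow> \<not> ld y i"
    using len_s_left[OF assms(3,1)] by (metis lessI less_Suc_eq not_less_eq)
  have sx: "s i \<circ> y = x \<longleftrightarrow> y = s i \<circ> x"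
    by (metis ss(2))
  have ne: "s i \<circ> x \<noteq> x" and d: "ld (s i \<circ> x) i \<longleftrightarrow> \<not> ld x i"
    using assms by (simp, simp only: ld_s)
  consider "y = x" | "y = s i \<circ> x" | "y \<noteq> x" "y \<noteq> s i \<circ> x" by blast
  then show ?thesis
  proof cases
    case 1
    then show ?thesis
      using ne unfolding T_simple_T_def T_def len by (auto simp del: s_neq)
  next
    case 2
    then have "s i \<circ> y = x" by (simp only: ss)
    then show ?thesis
      using ne d unfolding T_simple_T_def T_def len unfolding 2 by (auto simp del: s_neq)
  next
    case 3
    then show ?thesis
      using sx unfolding T_simple_T_def T_def len by auto
  qed
qed

lemma T_simple_mult_apply:
  assumes i: "i \<in> {1..4}" and x: "x \<in> W"
  shows "T_simple_mult i h x = (if ld x i then h (s i \<circ> x) + (vpow 2 - 1) * h x else vpow 2 * h (s i \<circ> x))"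
proof -
  have sW: "s i \<circ> x \<in> W"
    using assms by simp
  have "T_simple_mult i h x = (\<Sum>y\<in>{x, s i \<circ> x}. h y * T_simple_T i y x)"
    unfolding T_simple_mult_def
  proof (rule sum.mono_neutral_right)
    show "{x, s i \<circ> x} \<subseteq> W"
      using x sW by blast
    show "\<forall>y\<in>W - {x, s i \<circ> x}. h y * T_simple_T i y x = 0"
      using T_simple_T_apply[OF i x] by simp
  qed simp
  also have "\<dots> = h x * T_simple_T i x x + h (s i \<circ> x) * T_simple_T i (s i \<circ> x) x"
    using s_neq[OF i x] by simp
  also have "\<dots> = (if ld x i then h (s i \<circ> x) + (vpow 2 - 1) * h x else vpow 2 * h (s i \<circ> x))"
    using s_neq[OF i x] T_simple_T_apply[OF i x x] T_simple_T_apply[OF i x sW] by (simp add: ac_simps)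
  finally show ?thesis .
qed

lemma T_simple_mult_off: "i \<in> {1..4} \<Longrightarrow> supp_W (T_simple_mult i h)"
proof -
  assume i: "i \<in> {1..4}"
  have "T_simple_T i y x = 0" if "y \<in> W" "x \<notin> W" for x y
    using that i s_W_iff(1)[OF i, of y] by (auto simp: T_simple_T_def T_def)
  then show ?thesis
    by (simp add: supp_W_def T_simple_mult_def)
qed

lemma T_simple_inv_mult_apply:
  assumes "i \<in> {1..4}" "x \<in> W"
  shows "T_simple_inv_mult i h x
    = (if ld x i then vpow (-2) * h (s i \<circ> x) else h (s i \<circ> x) + (vpow (-2) - 1) * h x)"
proof -
  have "vpow (-2) * vpow 2 = 1"
    by (simp add: vpow_add)
  then have *: "vpow (-2) * (vpow 2 * a) = a" for a
    by (simp flip: mult.assoc)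
  show ?thesis
    unfolding T_simple_inv_mult_def T_simple_mult_apply[OF assms]
    by (simp add: algebra_simps *)
qed

lemma T_simple_inv_mult_off: "i \<in> {1..4} \<Longrightarrow> supp_W h \<Longrightarrow> supp_W (T_simple_inv_mult i h)"
  using T_simple_mult_off[of i h] by (simp add: supp_W_def T_simple_inv_mult_def)

lemma T_simple_inverse:
  assumes i: "i \<in> {1..4}" and h: "supp_W h"
  shows "T_simple_mult i (T_simple_inv_mult i h) = h" "T_simple_inv_mult i (T_simple_mult i h) = h"
proof -
  have v: "vpow (-2) * vpow 2 = 1"
    by (simp add: vpow_add)
  then have *: "vpow (-2) * (vpow 2 * a) = a" "vpow 2 * (vpow (-2) * a) = a" for a
    by (simp_all flip: mult.assoc add: vpow_add)
  have "T_simple_mult i (T_simple_inv_mult i h) x = h x" if x: "x \<in> W" for x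
  proof -
    have sx: "s i \<circ> x \<in> W" "ld (s i \<circ> x) i \<longleftrightarrow> \<not> ld x i" "s i \<circ> (s i \<circ> x) = x"
      using i x ld_s by (simp, blast, simp only: ss)
    show ?thesis
      unfolding T_simple_mult_apply[OF i x] T_simple_inv_mult_apply[OF i x] T_simple_inv_mult_apply[OF i sx(1)] sx
      by (simp add: algebra_simps * v vpow_add)
  qed
  then show "T_simple_mult i (T_simple_inv_mult i h) = h"
    by (intro hecke_eqI T_simple_mult_off i h)
  have "T_simple_inv_mult i (T_simple_mult i h) x = h x" if x: "x \<in> W" for x
  proof -
    have sx: "s i \<circ> x \<in> W" "ld (s i \<circ> x) i \<longleftrightarrow> \<not> ld x i" "s i \<circ> (s i \<circ> x) = x"
      using i x ld_s by (simp, blast, simp only: ss)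
    show ?thesis
      unfolding T_simple_inv_mult_apply[OF i x] T_simple_mult_apply[OF i x] T_simple_mult_apply[OF i sx(1)] sx
      by (simp add: algebra_simps * v vpow_add)
  qed
  then show "T_simple_inv_mult i (T_simple_mult i h) = h"
    by (intro hecke_eqI T_simple_inv_mult_off T_simple_mult_off i h)
qed

text \<open>The quadratic relation of the inverse generator, with \<open>vpow (-2)\<close> in place
  of \<open>vpow 2\<close>.\<close>

lemma T_simple_inv_mult_twice:
  assumes "i \<in> {1..4}" "x \<in> W"
  shows "T_simple_inv_mult i (T_simple_inv_mult i h) x = vpow (-2) * h x + (vpow (-2) - 1) * T_simple_inv_mult i h x"
proof -
  have sx: "s i \<circ> x \<in> W" "ld (s i \<circ> x) i \<longleftrightarrow> \<not> ld x i" "s i \<circ> (s i \<circ> x) = x"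
    using assms ld_s by (simp, blast, simp only: ss)
  show ?thesis
    unfolding T_simple_inv_mult_apply[OF assms] T_simple_inv_mult_apply[OF assms(1) sx(1)] sx
    by (simp add: algebra_simps)
qed

lemma T_simple_mult_T:
  assumes "i \<in> {1..4}" "y \<in> W" "\<not> ld y i"
  shows "T_simple_mult i (T y) = T (s i \<circ> y)"
proof (rule hecke_eqI)
  fix x assume x: "x \<in> W"
  have "s i \<circ> x = y \<longleftrightarrow> x = s i \<circ> y"
    by (metis ss(2))
  moreover have "ld (s i \<circ> y) i"
    using assms by (subst ld_s) auto
  ultimately show "T_simple_mult i (T y) x = T (s i \<circ> y) x"
    unfolding T_simple_mult_apply[OF assms(1) x] T_def using assms by auto
qed (use assms T_simple_mult_off in auto)

text \<open>The linear anti-automorphism sending \<open>T w\<close> to \<open>T (inv w)\<close>.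
  Conjugating a left multiplication by it gives the right multiplication, as in
  \<open>Rinv\<close>.\<close>

definition flip_inv :: "hecke \<Rightarrow> hecke" where
  "flip_inv h = (\<lambda>x. if x \<in> W then h (inv x) else 0)"

lemma supp_flip_inv [simp]: "supp_W (flip_inv h)"
  by (simp add: supp_W_def flip_inv_def)

lemma flip_flip: "supp_W h \<Longrightarrow> flip_inv (flip_inv h) = h"
  by (rule hecke_eqI) (simp, simp, simp add: flip_inv_def)

lemma flip_T_id [simp]: "flip_inv (T id) = T id"
proof (rule hecke_eqI)
  fix x assume "x \<in> W"
  then have "inv x = id \<longleftrightarrow> x = id"
    by (metis inv_id inv_inv_W)
  then show "flip_inv (T id) x = T id x"
    using \<open>x \<in> W\<close> by (simp add: flip_inv_def T_def)
qed simp_all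

definition Rinv :: "nat \<Rightarrow> hecke \<Rightarrow> hecke" where
  "Rinv j h = flip_inv (T_simple_inv_mult j (flip_inv h))"

lemma Rinv_apply:
  assumes "j \<in> {1..4}" "x \<in> W"
  shows "Rinv j h x = (if rd x j then vpow (-2) * h (x \<circ> s j) else h (x \<circ> s j) + (vpow (-2) - 1) * h x)"
proof -
  have W: "inv x \<in> W" "s j \<circ> inv x \<in> W" "x \<circ> s j \<in> W"
    using assms by simp_all
  have "inv (s j \<circ> inv x) = x \<circ> s j"
    using inv_s_left[OF W(1) assms(1)] assms(2) by (simp only: inv_inv_W)
  then show ?thesis
    unfolding Rinv_def using assms W
    by (simp add: flip_inv_def T_simple_inv_mult_apply[OF assms(1) W(1)] ld_inv del: s_W_iff)
qed

lemma supp_Rinv [simp]: "supp_W (Rinv j h)"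
  by (simp add: Rinv_def)

text \<open>This is associativity, checked on coefficients. By \<open>ld_right_change\<close>,
  either the left and the right reflection move \<open>x\<close> to the same element, or neither of
  them affects the descent seen by the other.\<close>

lemma T_simple_mult_Rinv:
  assumes i: "i \<in> {1..4}" and j: "j \<in> {1..4}"
  shows "T_simple_mult i (Rinv j h) = Rinv j (T_simple_mult i h)"
proof (rule hecke_eqI)
  fix x assume x: "x \<in> W"
  have W: "s i \<circ> x \<in> W" "x \<circ> s j \<in> W" "s i \<circ> (x \<circ> s j) \<in> W"
    using x i j by simp_all
  have a: "(s i \<circ> x) \<circ> s j = s i \<circ> (x \<circ> s j)"
    by (simp add: o_assoc)
  note e = T_simple_mult_apply[OF i x] Rinv_apply[OF j x] T_simple_mult_apply[OF i W(2)] Rinv_apply[OF j W(1)] a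
  show "T_simple_mult i (Rinv j h) x = Rinv j (T_simple_mult i h) x"
  proof (cases "s i \<circ> x = x \<circ> s j")
    case True
    have "ld x i \<longleftrightarrow> rd x j"
      using len_s_left[OF x i] len_s_right[OF x j] True by (metis n_not_Suc_n not_less_eq lessI less_Suc_eq)
    moreover have "ld (x \<circ> s j) i \<longleftrightarrow> \<not> ld x i"
      unfolding True[symmetric] using x i by (rule ld_s)
    moreover have "rd (s i \<circ> x) j \<longleftrightarrow> \<not> rd x j"
      unfolding True using x by (rule rd_s)
    moreover have "s i \<circ> (x \<circ> s j) = x"
      unfolding True[symmetric] by (simp only: ss)
    ultimately show ?thesis
      unfolding e by (simp add: algebra_simps True)
  next
    case False
    have "ld (x \<circ> s j) i \<longleftrightarrow> ld x i"
      using ld_right_change[OF x i j] False by blast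
    moreover have "rd (s i \<circ> x) j \<longleftrightarrow> rd x j"
    proof (rule ccontr)
      assume "\<not> ?thesis"
      then have "ld (inv x \<circ> s i) j \<noteq> ld (inv x) j"
        using x W(1) i ld_inv[of x j] ld_inv[OF W(1), of j] inv_s_left[OF x i] by metis
      then have "s j \<circ> inv x = inv x \<circ> s i"
        using ld_right_change[of "inv x" j i] x i j by simp
      then have "inv (s j \<circ> inv x) = inv (inv x \<circ> s i)" by simp
      then show False
        using False x inv_s_left[of "inv x" j] inv_s_right[of "inv x" i] i j by simp
    qed
    ultimately show ?thesis
      unfolding e by (simp add: algebra_simps)
  qed
qed (use i T_simple_mult_off in auto)

abbreviation T_word :: "nat list \<Rightarrow> hecke \<Rightarrow> hecke" where
  "T_word is h \<equiv> foldr T_simple_mult is h"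

abbreviation Tinv_word :: "nat list \<Rightarrow> hecke" where
  "Tinv_word is \<equiv> foldr T_simple_inv_mult is (T id)"

lemma supp_T_word: "set is \<subseteq> {1..4} \<Longrightarrow> supp_W h \<Longrightarrow> supp_W (T_word is h)"
  by (induction "is") (auto simp: T_simple_mult_off)

lemma supp_Tinv_word: "set is \<subseteq> {1..4} \<Longrightarrow> supp_W (Tinv_word is)"
  by (induction "is") (auto simp: T_simple_inv_mult_off)

lemma T_word_Rinv:
  "set is \<subseteq> {1..4} \<Longrightarrow> j \<in> {1..4} \<Longrightarrow> T_word is (Rinv j h) = Rinv j (T_word is h)"
  by (induction "is") (auto simp: T_simple_mult_Rinv)

lemma reduced_word_Cons:
  assumes "reduced_word (i # is) w"
  shows "reduced_word is (sprod is)" "i \<in> {1..4}" "sprod is \<in> W" "\<not> ld (sprod is) i" "w = s i \<circ> sprod is"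
proof -
  have a: "set (i # is) \<subseteq> {1..4}" "sprod (i # is) = w" "length (i # is) = len w"
    using assms by (auto simp: reduced_word_def)
  then show i: "i \<in> {1..4}" and w: "w = s i \<circ> sprod is" and W: "sprod is \<in> W"
    by (auto intro: sprod_W)
  have l: "len (sprod is) \<le> length is"
    using a len_sprod_le[of "is"] by simp
  show "\<not> ld (sprod is) i"
    using len_s_left(1)[OF W i] l a(3) w by (metis Suc_n_not_le_n length_Cons nat_le_linear le_SucI le_trans)
  then have "len w = Suc (len (sprod is))"
    using len_s_left(2)[OF W i] w by simp
  then show "reduced_word is (sprod is)"
    using a by (simp add: reduced_word_def)
qed

lemma T_word_reduced: "reduced_word is w \<Longrightarrow> T_word is (T id) = T w"
proof (induction "is" arbitrary: w)
  case Nil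
  then show ?case by (simp add: reduced_word_def)
next
  case (Cons i "is")
  note r = reduced_word_Cons[OF Cons.prems]
  show ?case
    using Cons.IH[OF r(1)] T_simple_mult_T[OF r(2-4)] r(5) by (simp add: o_def id_def)
qed

lemma Tinv_T_id:
  assumes "j \<in> {1..4}"
  shows "T_simple_inv_mult j (T id) = Rinv j (T id)"
proof (rule hecke_eqI)
  fix x assume x: "x \<in> W"
  have eq: "s j \<circ> x = id \<longleftrightarrow> x = s j" "x \<circ> s j = id \<longleftrightarrow> x = s j"
    by (metis comp_id ss(2), metis id_comp ss(3) ss(1))
  have "\<not> ld id j" "\<not> rd id j" "ld (s j) j" "rd (s j) j"
    by (simp_all add: ld_def rd_def s_apply)
  then show "T_simple_inv_mult j (T id) x = Rinv j (T id) x"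
    unfolding T_simple_inv_mult_apply[OF assms x] Rinv_apply[OF assms x] T_def eq by auto
qed (use assms in \<open>auto intro!: T_simple_inv_mult_off\<close>)

lemma Tinv_word_Rinv: "set js \<subseteq> {1..4} \<Longrightarrow> j \<in> {1..4} \<Longrightarrow> foldr T_simple_inv_mult js (Rinv j h) = Rinv j (foldr T_simple_inv_mult js h)"
proof (induction js)
  case (Cons i js)
  have c: "T_simple_inv_mult i (Rinv j h) = Rinv j (T_simple_inv_mult i h)" if i: "i \<in> {1..4}" for h
  proof (rule hecke_eqI)
    fix x assume x: "x \<in> W"
    show "T_simple_inv_mult i (Rinv j h) x = Rinv j (T_simple_inv_mult i h) x"
      unfolding T_simple_inv_mult_def T_simple_mult_Rinv[OF i Cons.prems(2)] Rinv_apply[OF Cons.prems(2) x]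
      by (simp add: algebra_simps)
  qed (use i T_simple_inv_mult_off in auto)
  then show ?case
    using Cons by simp
qed simp

text \<open>Left and right multiplications agree on the unit element and commute, so the word is read
  backwards by right multiplications.\<close>

lemma Tinv_word_rev:
  assumes "set is \<subseteq> {1..4}"
  shows "Tinv_word is = foldr Rinv (rev is) (T id)"
  using assms
proof (induction "is" rule: rev_induct)
  case (snoc j js)
  have "Tinv_word (js @ [j]) = foldr T_simple_inv_mult js (Rinv j (T id))"
    using snoc.prems Tinv_T_id[of j] by simp
  also have "\<dots> = Rinv j (Tinv_word js)"
    using snoc.prems by (intro Tinv_word_Rinv) auto
  also have "\<dots> = foldr Rinv (rev (js @ [j])) (T id)"
    using snoc by (simp add: id_def)
  finally show ?case
    by (simp add: id_def)
qed simp

lemma T_word_foldr_Rinv: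
  "set is \<subseteq> {1..4} \<Longrightarrow> set js \<subseteq> {1..4} \<Longrightarrow> T_word is (foldr Rinv js h) = foldr Rinv js (T_word is h)"
  by (induction js) (auto simp: T_word_Rinv)

lemma T_word_Tinv_word: "set is \<subseteq> {1..4} \<Longrightarrow> T_word (rev is) (Tinv_word is) = T id"
proof (induction "is")
  case (Cons i "is")
  then show ?case
    using T_simple_inverse(1)[of i "Tinv_word is"] supp_Tinv_word[of "is"] by (simp add: id_def)
qed simp

lemma T_simple_mult_inj:
  "i \<in> {1..4} \<Longrightarrow> supp_W f \<Longrightarrow> supp_W g \<Longrightarrow> T_simple_mult i f = T_simple_mult i g \<Longrightarrow> f = g"
  by (metis T_simple_inverse(2))

lemma T_word_inj:
  "set is \<subseteq> {1..4} \<Longrightarrow> supp_W f \<Longrightarrow> supp_W g \<Longrightarrow> T_word is f = T_word is g \<Longrightarrow> f = g"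
proof (induction "is")
  case (Cons i "is")
  then have "T_word is f = T_word is g"
    using T_simple_mult_inj[of i "T_word is f" "T_word is g"] supp_T_word[of "is"] by simp
  then show ?case
    using Cons by simp
qed simp

text \<open>Braid relations are avoided. Applied to the unit, \<open>T_word (rev is)\<close> gives
  \<open>T (inv w)\<close> for every reduced word of \<open>w\<close>; the inverse word, read as
  right multiplications, commutes past it. Hence both inverse words have the same image under the
  injective operator \<open>T_word (rev is)\<close>.\<close>

lemma Tinv_word_unique:
  assumes "reduced_word is w" "reduced_word js w"
  shows "Tinv_word is = Tinv_word js"
proof -
  have s: "set is \<subseteq> {1..4}" "set js \<subseteq> {1..4}"
    using assms by (auto simp: reduced_word_def)
  have r: "T_word (rev is) (T id) = T (inv w)" "T_word (rev js) (T id) = T (inv w)"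
    using assms reduced_word_rev(1) T_word_reduced by blast+
  have "T_word (rev is) (Tinv_word js) = foldr Rinv (rev js) (T_word (rev is) (T id))"
    using s by (simp add: Tinv_word_rev[of js] T_word_foldr_Rinv)
  also have "\<dots> = foldr Rinv (rev js) (T_word (rev js) (T id))"
    by (simp only: r)
  also have "\<dots> = T_word (rev js) (Tinv_word js)"
    using s by (simp add: Tinv_word_rev[of js] T_word_foldr_Rinv)
  also have "\<dots> = T_word (rev is) (Tinv_word is)"
    using s by (simp only: T_word_Tinv_word)
  finally show ?thesis
    using T_word_inj[of "rev is" "Tinv_word js" "Tinv_word is"] s supp_Tinv_word by simp
qed

lemma bar_T_eq: "reduced_word is w \<Longrightarrow> bar_T w = Tinv_word is"
  unfolding bar_T_def by (rule Tinv_word_unique[OF someI])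

lemma bar_T_id [simp]: "bar_T id = T id"
  by (subst bar_T_eq[of "[]"]) (simp_all add: reduced_word_def)

lemma supp_bar_T [simp]: "w \<in> W \<Longrightarrow> supp_W (bar_T w)"
  using reduced_word_exists[of w] bar_T_eq supp_Tinv_word by (metis reduced_word_def)

lemma bar_T_s:
  assumes "w \<in> W" "i \<in> {1..4}" "\<not> ld w i"
  shows "bar_T (s i \<circ> w) = T_simple_inv_mult i (bar_T w)"
proof -
  obtain "is" where r: "reduced_word is w"
    using assms(1) reduced_word_exists by blast
  then have "reduced_word (i # is) (s i \<circ> w)"
    using len_s_left(2)[OF assms] assms(2) by (auto simp: reduced_word_def)
  then show ?thesis
    using bar_T_eq r by simp
qed

lemma flip_Tinv_word:
  assumes "set is \<subseteq> {1..4}"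
  shows "flip_inv (Tinv_word is) = Tinv_word (rev is)"
proof -
  have "flip_inv (Tinv_word is) = foldr Rinv is (T id)"
    using assms
  proof (induction "is")
    case (Cons i "is")
    then show ?case
      using flip_flip[of "Tinv_word is"] supp_Tinv_word[of "is"] by (simp add: Rinv_def id_def flip: Cons.IH)
  qed (simp add: id_def flip_T_id[unfolded id_def])
  then show ?thesis
    using Tinv_word_rev[of "rev is"] assms by simp
qed

lemma flip_bar_T: "w \<in> W \<Longrightarrow> flip_inv (bar_T w) = bar_T (inv w)"
  using reduced_word_exists[of w] flip_Tinv_word bar_T_eq reduced_word_rev(1) unfolding reduced_word_def
  by metis

text \<open>Every element other than the identity has a left descent; this is the induction over \<open>W\<close>
  by left multiplication.\<close>

lemma W_induct [consumes 1, case_names id step]: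
  assumes "w \<in> W" "Q id"
    and "\<And>w i. w \<in> W \<Longrightarrow> i \<in> {1..4} \<Longrightarrow> \<not> ld w i \<Longrightarrow> (\<And>u. u \<in> W \<Longrightarrow> len u \<le> len w \<Longrightarrow> Q u) \<Longrightarrow> Q (s i \<circ> w)"
  shows "Q w"
  using assms(1)
proof (induction "len w" arbitrary: w rule: less_induct)
  case less
  obtain "is" where r: "reduced_word is w"
    using less.prems reduced_word_exists by blast
  show ?case
  proof (cases "is")
    case Nil
    then show ?thesis
      using r assms(2) by (simp add: reduced_word_def)
  next
    case (Cons i js)
    note rr = reduced_word_Cons[OF r[unfolded Cons]]
    have l: "len w = Suc (len (sprod js))"
      using len_s_left(2)[OF rr(3) rr(2) rr(4)] rr(5) by simp
    have "Q (s i \<circ> sprod js)"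
      using rr l less.hyps by (intro assms(3)) auto
    then show ?thesis
      using rr(5) by simp
  qed
qed

text \<open>The coefficient of the new element at \<open>x\<close> involves the old ones at
  \<open>x\<close> and \<open>s i \<circ> x\<close>; the lifting property puts \<open>x\<close>
  below \<open>s i \<circ> w\<close> in both cases.\<close>

lemma bar_T_triangular:
  assumes "w \<in> W"
  shows "(\<forall>x. bar_T w x \<noteq> 0 \<longrightarrow> bruhat x w) \<and> bar_T w w = vpow (- 2 * int (len w))"
  using assms
proof (induction rule: W_induct)
  case id
  show ?case
    unfolding bar_T_id using bruhat_refl[of id] by (auto simp: T_def)
next
  case (step w i)
  have IH: "\<And>x. bar_T w x \<noteq> 0 \<Longrightarrow> bruhat x w" "bar_T w w = vpow (- 2 * int (len w))"
    using step by auto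
  have sw: "s i \<circ> w \<in> W" "ld (s i \<circ> w) i" "s i \<circ> (s i \<circ> w) = w" "len (s i \<circ> w) = Suc (len w)"
    using step len_s_left(2)[of w i] ld_s[of w i] by (simp, blast, simp only: ss, blast)
  note b = bar_T_s[OF step(1-3)]
  have "bruhat x (s i \<circ> w)" if "bar_T (s i \<circ> w) x \<noteq> 0" for x
  proof -
    have x: "x \<in> W"
      using that supp_bar_T[OF sw(1)] by (auto simp: supp_W_def)
    have "bar_T w (s i \<circ> x) \<noteq> 0 \<or> bar_T w x \<noteq> 0"
      using that unfolding b T_simple_inv_mult_apply[OF step(2) x] by (auto split: if_splits)
    then have "bruhat (s i \<circ> x) w \<or> bruhat x w"
      using IH by blast
    then show ?thesis
      using bruhat_lift[of "s i \<circ> x" w i] bruhat_below_s[of x w i] step(2,3) by (auto simp only: ss)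
  qed
  moreover have "bar_T (s i \<circ> w) (s i \<circ> w) = vpow (- 2 * int (len (s i \<circ> w)))"
    unfolding b T_simple_inv_mult_apply[OF step(2) sw(1)] using sw IH(2) by (simp add: vpow_add)
  ultimately show ?case by (auto simp: o_def)
qed

lemma bar_T_bruhat: "w \<in> W \<Longrightarrow> bar_T w x \<noteq> 0 \<Longrightarrow> bruhat x w"
  using bar_T_triangular by blast

lemma supp_hecke_bar: "supp_W (hecke_bar h)"
  using supp_bar_T unfolding supp_W_def hecke_bar_def by (simp add: sum.neutral)

lemma hecke_bar_add: "hecke_bar (\<lambda>x. f x + g x) = (\<lambda>x. hecke_bar f x + hecke_bar g x)"
  by (simp add: hecke_bar_def distrib_right sum.distrib)

lemma hecke_bar_diff: "hecke_bar (\<lambda>x. f x - g x) = (\<lambda>x. hecke_bar f x - hecke_bar g x)"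
  by (simp add: hecke_bar_def left_diff_distrib sum_subtractf)

lemma hecke_bar_scale: "hecke_bar (\<lambda>x. c * f x) = (\<lambda>x. lbar c * hecke_bar f x)"
  by (simp add: hecke_bar_def sum_distrib_left mult.assoc)

lemma hecke_bar_sum: "hecke_bar (\<lambda>x. \<Sum>i\<in>A. f i x) = (\<lambda>x. \<Sum>i\<in>A. hecke_bar (f i) x)"
proof (induction A rule: infinite_finite_induct)
  case (insert a A)
  then show ?case
    by (simp add: hecke_bar_add)
qed (simp_all add: hecke_bar_def)

lemma sum_W_pairs:
  fixes g :: "perm \<Rightarrow> 'a::comm_monoid_add"
  assumes "i \<in> {1..4}"
  shows "(\<Sum>w\<in>W. g w) = (\<Sum>w\<in>{w\<in>W. \<not> ld w i}. g w + g (s i \<circ> w))"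
proof -
  have "(\<Sum>w\<in>{w\<in>W. \<not> ld w i}. g (s i \<circ> w)) = (\<Sum>w\<in>{w\<in>W. ld w i}. g w)"
    by (rule sum.reindex_bij_witness[of _ "\<lambda>w. s i \<circ> w" "\<lambda>w. s i \<circ> w"])
      (use assms ld_s in \<open>auto simp only: ss mem_Collect_eq s_W_iff\<close>)
  moreover have "(\<Sum>w\<in>W. g w) = (\<Sum>w\<in>{w\<in>W. \<not> ld w i}. g w) + (\<Sum>w\<in>{w\<in>W. ld w i}. g w)"
    by (subst sum.union_disjoint[symmetric]) (auto intro!: sum.cong)
  ultimately show ?thesis
    by (simp add: sum.distrib)
qed

lemma T_simple_inv_mult_sum:
  "T_simple_inv_mult i (\<lambda>x. \<Sum>w\<in>A. c w * f w x) x = (\<Sum>w\<in>A. c w * T_simple_inv_mult i (f w) x)"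
  if "i \<in> {1..4}" "x \<in> W"
  unfolding T_simple_inv_mult_apply[OF that]
  by (simp add: sum_distrib_left sum.distrib[symmetric] algebra_simps sum_subtractf[symmetric])

text \<open>The one instance of multiplicativity of the bar involution that the recursion requires.
  The sum over \<open>W\<close> is grouped into pairs \<open>w\<close>,
  \<open>s i \<circ> w\<close>, on which the identity is the quadratic relation.\<close>

lemma hecke_bar_T_simple_mult:
  assumes i: "i \<in> {1..4}" and x: "x \<in> W"
  shows "hecke_bar (T_simple_mult i h) x = T_simple_inv_mult i (hecke_bar h) x"
proof -
  let ?U = "{w \<in> W. \<not> ld w i}"
  have R: "T_simple_inv_mult i (hecke_bar h) x = (\<Sum>w\<in>W. lbar (h w) * T_simple_inv_mult i (bar_T w) x)"
    unfolding hecke_bar_def by (rule T_simple_inv_mult_sum[OF i x])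
  have "lbar (T_simple_mult i h w) * bar_T w x + lbar (T_simple_mult i h (s i \<circ> w)) * bar_T (s i \<circ> w) x
     = lbar (h w) * T_simple_inv_mult i (bar_T w) x + lbar (h (s i \<circ> w)) * T_simple_inv_mult i (bar_T (s i \<circ> w)) x"
    if "w \<in> ?U" for w
  proof -
    have w: "w \<in> W" "\<not> ld w i" "s i \<circ> w \<in> W" "ld (s i \<circ> w) i" "s i \<circ> (s i \<circ> w) = w"
      using that i ld_s[of w i] by (simp, simp, simp, simp, simp only: ss)
    show ?thesis
      unfolding T_simple_mult_apply[OF i w(1)] T_simple_mult_apply[OF i w(3)] bar_T_s[OF w(1) i w(2)]
        T_simple_inv_mult_twice[OF i x] w(5)
      using w by (simp add: algebra_simps)
  qed
  then show ?thesis
    unfolding R unfolding hecke_bar_def sum_W_pairs[OF i] by (intro sum.cong refl) blast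
qed


section \<open>Kazhdan--Lusztig polynomials\<close>

definition is_KL :: "perm \<Rightarrow> (perm \<Rightarrow> int poly) \<Rightarrow> bool" where
  "is_KL w f \<longleftrightarrow> hecke_bar (hecke_C w f) = hecke_C w f \<and> f w = 1 \<and>
      (\<forall>x. bruhat x w \<and> x \<noteq> w \<longrightarrow> 2 * degree (f x) + 1 \<le> len w - len x) \<and>
      (\<forall>x. \<not> bruhat x w \<longrightarrow> f x = 0)"

lemma is_KL_D:
  assumes "is_KL w f"
  shows "hecke_bar (hecke_C w f) = hecke_C w f" "f w = 1"
    "\<And>x. bruhat x w \<Longrightarrow> x \<noteq> w \<Longrightarrow> 2 * degree (f x) + 1 \<le> len w - len x"
    "\<And>x. \<not> bruhat x w \<Longrightarrow> f x = 0"
    "\<And>x. hecke_C w f x = vpow (- int (len w)) * laurent_of_poly (f x)"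
  using assms unfolding is_KL_def by (blast, blast, blast, blast, auto simp: hecke_C_def)

text \<open>At a longest \<open>x\<close> where two solutions differ, triangularity makes the
  coefficient of their difference symmetric about the exponent \<open>- len x\<close>. The degree
  bound puts all its exponents strictly below \<open>- len x\<close>.\<close>

lemma is_KL_unique:
  assumes f: "is_KL w f" and f': "is_KL w f'" and w: "w \<in> W"
  shows "f = f'"
proof (rule ccontr)
  assume "f \<noteq> f'"
  define X where "X = {x \<in> W. f x \<noteq> f' x}"
  have XW: "x \<in> X" if "f x \<noteq> f' x" for x
    unfolding X_def using that is_KL_D(4)[OF f, of x] is_KL_D(4)[OF f', of x] bruhat_W(2)[of x w]
    by (metis (mono_tags, lifting) mem_Collect_eq)
  then have "X \<noteq> {}"
    using \<open>f \<noteq> f'\<close> by auto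
  moreover have "finite X"
    by (simp add: X_def)
  ultimately obtain x where x: "x \<in> X" "\<And>u. u \<in> X \<Longrightarrow> len u \<le> len x"
    using Max_in[of "len ` X"] Max_ge[of "len ` X"] by fastforce
  have fx: "f x \<noteq> f' x" and xW: "x \<in> W"
    using x by (simp_all add: X_def)
  have b: "bruhat x w"
    using fx is_KL_D(4)[OF f, of x] is_KL_D(4)[OF f', of x] by metis
  have ne: "x \<noteq> w"
    using fx is_KL_D(2)[OF f] is_KL_D(2)[OF f'] by metis
  define D where "D = (\<lambda>x. hecke_C w f x - hecke_C w f' x)"
  define R where "R = f x - f' x"
  have R0: "R \<noteq> 0"
    using x by (simp add: R_def X_def)
  have D: "D u = vpow (- int (len w)) * laurent_of_poly (f u - f' u)" for u
    by (simp add: D_def is_KL_D(5)[OF f] is_KL_D(5)[OF f'] right_diff_distrib)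
  have deg: "2 * degree R + 1 \<le> len w - len x"
  proof -
    have "degree R \<le> max (degree (f x)) (degree (f' x))"
      unfolding R_def by (rule degree_diff_le_max)
    then show ?thesis
      using is_KL_D(3)[OF f b ne] is_KL_D(3)[OF f' b ne] by linarith
  qed
  have "hecke_bar D = D"
    unfolding D_def hecke_bar_diff is_KL_D(1)[OF f] is_KL_D(1)[OF f'] ..
  then have "D x = (\<Sum>u\<in>W. lbar (D u) * bar_T u x)"
    unfolding hecke_bar_def by metis
  also have "\<dots> = (\<Sum>u\<in>{x}. lbar (D u) * bar_T u x)"
  proof (rule sum.mono_neutral_right)
    show "\<forall>u\<in>W - {x}. lbar (D u) * bar_T u x = 0"
    proof
      fix u assume u: "u \<in> W - {x}"
      show "lbar (D u) * bar_T u x = 0"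
      proof (cases "bar_T u x = 0")
        case False
        then have "len x < len u"
          using u bar_T_bruhat[of u x] bruhat_len[of x u] by auto
        then have "u \<notin> X"
          using x(2)[of u] by auto
        then have "f u = f' u"
          using XW by blast
        then show ?thesis
          by (simp add: D)
      qed simp
    qed
  qed (use xW in auto)
  finally have Dx: "D x = vpow (- 2 * int (len x)) * lbar (D x)"
    using bar_T_triangular[OF xW] by (simp add: mult.commute)
  \<comment> \<open>The top exponent of \<open>D x\<close>; the reflected exponent \<open>m\<close>
    in the shifted polynomial lies beyond twice the degree of \<open>R\<close>.\<close>
  define k where "k = 2 * int (degree R) - int (len w)"
  have "Poly_Mapping.lookup (D x) k = coeff R (degree R)"
    by (simp add: D lookup_vpow_mult k_def lookup_laurent_of_poly flip: R_def)
  then have "Poly_Mapping.lookup (D x) k \<noteq> 0"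
    using R0 by simp
  moreover have "Poly_Mapping.lookup (vpow (- 2 * int (len x)) * lbar (D x)) k = 0"
  proof -
    define m where "m = - (k + 2 * int (len x)) + int (len w)"
    have "m > 2 * int (degree R)"
      using deg unfolding m_def k_def by linarith
    then have "degree R < nat (m div 2)" if "even m"
      using that by (auto elim!: evenE)
    moreover have "Poly_Mapping.lookup (vpow (- 2 * int (len x)) * lbar (D x)) k
        = Poly_Mapping.lookup (laurent_of_poly R) m"
      unfolding lookup_vpow_mult lookup_lbar D R_def[symmetric] m_def by (simp add: algebra_simps)
    ultimately show ?thesis
      by (simp add: lookup_laurent_of_poly coeff_eq_0)
  qed
  ultimately show False
    using Dx by simp
qed

lemma KL_eqI: "is_KL w f \<Longrightarrow> w \<in> W \<Longrightarrow> KL y w = f y"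
  unfolding KL_def is_KL_def[symmetric] by (subst the_equality) (auto dest: is_KL_unique)

text \<open>The Kazhdan-Lusztig mu function: the coefficient in the largest degree that the degree
  bound permits.\<close>

definition mu :: "perm \<Rightarrow> perm \<Rightarrow> int" where
  "mu z v = (if len z < len v \<and> odd (len v - len z) then coeff (KL z v) ((len v - len z - 1) div 2) else 0)"

text \<open>The coefficient polynomial of \<open>C's C'v - (sum of mu(z,v) C'z)\<close> at
  \<open>y\<close>, with \<open>s = s i\<close> and \<open>z\<close> running over the elements
  having \<open>i\<close> as a left descent. The monomials compensate the different normalizing
  powers of \<open>v\<close>.\<close>

definition KL_rec :: "nat \<Rightarrow> perm \<Rightarrow> perm \<Rightarrow> int poly" where
  "KL_rec i v y =
    (if ld y i then KL (s i \<circ> y) v + monom 1 1 * KL y v else monom 1 1 * KL (s i \<circ> y) v + KL y v)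
    - (\<Sum>z\<in>{z\<in>W. ld z i}. Polynomial.smult (mu z v) (monom 1 ((Suc (len v) - len z) div 2) * KL y z))"

lemma T_simple_mult_C:
  assumes i: "i \<in> {1..4}" and y: "y \<in> W" and h: "\<And>x. h x = vpow (- int n) * laurent_of_poly (f x)"
  shows "vpow (-1) * (T_simple_mult i h y + h y) = vpow (- int (Suc n)) *
     laurent_of_poly (if ld y i then f (s i \<circ> y) + monom 1 1 * f y else monom 1 1 * f (s i \<circ> y) + f y)"
proof -
  have v: "vpow (- int (Suc n)) = vpow (-1) * vpow (- int n)"
    by (simp add: vpow_add)
  show ?thesis
    unfolding T_simple_mult_apply[OF i y] h v laurent_of_poly_simps laurent_of_poly_monom_mult if_distrib[of laurent_of_poly]
    by (simp add: algebra_simps)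
qed

lemma hecke_bar_C_mult:
  assumes i: "i \<in> {1..4}" and x: "x \<in> W" and h: "hecke_bar h = h"
  shows "hecke_bar (\<lambda>x. vpow (-1) * (T_simple_mult i h x + h x)) x = vpow (-1) * (T_simple_mult i h x + h x)"
proof -
  have v: "vpow 1 * vpow (-2) = vpow (-1)" "vpow 1 * (vpow (-2) * a) = vpow (-1) * a" for a
    by (simp_all add: vpow_add flip: mult.assoc)
  have v': "vpow 1 * (a * vpow (-2)) = a * vpow (-1)" for a
    by (simp add: mult.left_commute vpow_add)
  show ?thesis
    unfolding hecke_bar_scale hecke_bar_add hecke_bar_T_simple_mult[OF i x] h T_simple_inv_mult_def
    by (simp add: algebra_simps v v')
qed

text \<open>Bar invariance is inherited from the product and from the subtracted terms. The actual
  point is the degree bound: the terms with mu cancel exactly the monomials that violate it.\<close>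

lemma is_KL_rec:
  assumes v: "v \<in> W" and i: "i \<in> {1..4}" and nd: "\<not> ld v i"
    and K: "is_KL v (\<lambda>y. KL y v)" "\<And>z. z \<in> W \<Longrightarrow> len z < len v \<Longrightarrow> is_KL z (\<lambda>y. KL y z)"
  shows "is_KL (s i \<circ> v) (KL_rec i v)"
proof -
  define w where "w = s i \<circ> v"
  have w: "w \<in> W" "len w = Suc (len v)" "ld w i" "s i \<circ> w = v" "w \<noteq> v"
    using assms len_s_left(2)[OF v i nd] ld_s[OF v i] s_neq[OF i v] unfolding w_def by (simp, blast, blast, simp only: ss, blast)
  define Z where "Z = {z \<in> W. ld z i \<and> mu z v \<noteq> 0}"
  define A where "A y = (if ld y i then KL (s i \<circ> y) v + monom 1 1 * KL y v else monom 1 1 * KL (s i \<circ> y) v + KL y v)" for y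
  define e where "e z = (len w - len z) div 2" for z
  have Z: "finite Z" "\<And>z. z \<in> Z \<Longrightarrow> z \<in> W" "\<And>z. z \<in> Z \<Longrightarrow> len z < len v" "\<And>z. z \<in> Z \<Longrightarrow> odd (len v - len z)"
     "\<And>z. z \<in> Z \<Longrightarrow> ld z i" "\<And>z. z \<in> Z \<Longrightarrow> bruhat z v"
  proof -
    show "z \<in> Z \<Longrightarrow> bruhat z v" for z
      using is_KL_D(4)[OF K(1), of z] by (cases "bruhat z v") (auto simp: Z_def mu_def split: if_splits)
  qed (auto simp: Z_def mu_def split: if_splits)
  have e: "2 * e z = len w - len z" "e z \<ge> 1" if "z \<in> Z" for z
    using Z(3,4)[OF that] unfolding e_def w(2) by (auto elim!: oddE)
  have rec: "KL_rec i v y = A y - (\<Sum>z\<in>Z. Polynomial.smult (mu z v) (monom 1 (e z) * KL y z))" for y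
  proof -
    have "(\<Sum>z\<in>{z\<in>W. ld z i}. Polynomial.smult (mu z v) (monom 1 ((Suc (len v) - len z) div 2) * KL y z))
      = (\<Sum>z\<in>Z. Polynomial.smult (mu z v) (monom 1 (e z) * KL y z))"
      unfolding e_def w(2) by (rule sum.mono_neutral_right) (auto simp: Z_def)
    then show ?thesis
      unfolding KL_rec_def A_def by simp
  qed
  have KZ: "is_KL z (\<lambda>y. KL y z)" if "z \<in> Z" for z
    using K(2) Z that by blast
  have K0: "KL y v = 0" if "\<not> bruhat y v" for y
    using is_KL_D(4)[OF K(1)] that by blast
  have KZ0: "KL y z = 0" if "z \<in> Z" "\<not> bruhat y z" for y z
    using is_KL_D(4)[OF KZ[OF that(1)]] that by blast
  have vw: "bruhat v w"
    using bruhat_s_left[OF v i nd] by (simp add: w_def)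
  have zero: "KL_rec i v y = 0" if "\<not> bruhat y w" for y
  proof -
    have "\<not> bruhat y v" "\<not> bruhat (s i \<circ> y) v"
      using that bruhat_below_s[of y v i] bruhat_lift[of "s i \<circ> y" v i] i nd unfolding w_def by (auto simp only: ss)
    moreover have "\<not> bruhat y z" if "z \<in> Z" for z
      using \<open>\<not> bruhat y v\<close> Z(6)[OF that] bruhat_trans by blast
    ultimately show ?thesis
      unfolding rec A_def using K0 KZ0 by (simp add: sum.neutral)
  qed
  have hC: "hecke_C w (KL_rec i v) y = vpow (- int (len w)) * laurent_of_poly (KL_rec i v y)" for y
    using zero by (simp add: hecke_C_def)
  let ?h = "hecke_C v (\<lambda>y. KL y v)"
  let ?c = "\<lambda>z. hecke_C z (\<lambda>y. KL y z)"
  have expand: "hecke_C w (KL_rec i v) = (\<lambda>y. vpow (-1) * (T_simple_mult i ?h y + ?h y) - (\<Sum>z\<in>Z. of_int (mu z v) * ?c z y))"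
  proof (rule hecke_eqI)
    have off: "?c z x = 0" if "x \<notin> W" for z x
      using that bruhat_W(2)[of x z] by (auto simp: hecke_C_def)
    have off': "?h x = 0" if "x \<notin> W" for x
      using that bruhat_W(2)[of x v] by (auto simp: hecke_C_def)
    show "supp_W (hecke_C w (KL_rec i v))"
      using bruhat_W(2)[of _ w] by (auto simp: supp_W_def hecke_C_def)
    show "supp_W (\<lambda>y. vpow (-1) * (T_simple_mult i ?h y + ?h y) - (\<Sum>z\<in>Z. of_int (mu z v) * ?c z y))"
      using T_simple_mult_off[OF i, of ?h] off off' by (simp add: supp_W_def sum.neutral)
    fix y assume y: "y \<in> W"
    have c: "vpow (- int (len w)) * laurent_of_poly (monom 1 (e z) * KL y z) = ?c z y" if "z \<in> Z" for z
    proof -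
      have "vpow (- int (len w)) * vpow (2 * int (e z)) = vpow (- int (len z))"
      proof -
        have "2 * e z + len z = len w"
          using e(1)[OF that] Z(3)[OF that] w(2) by simp
        then have "- int (len w) + 2 * int (e z) = - int (len z)"
          by linarith
        then show ?thesis
          by (simp add: vpow_add)
      qed
      then show ?thesis
        unfolding laurent_of_poly_monom_mult is_KL_D(5)[OF KZ[OF that]] mult.assoc[symmetric] by simp
    qed
    have "vpow (- int (len w)) * laurent_of_poly (KL_rec i v y) = vpow (- int (len w)) * laurent_of_poly (A y)
        - (\<Sum>z\<in>Z. of_int (mu z v) * (vpow (- int (len w)) * laurent_of_poly (monom 1 (e z) * KL y z)))"
      unfolding rec laurent_of_poly_simps laurent_of_poly_sum
      by (simp add: right_diff_distrib sum_distrib_left mult.left_commute)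
    also have "vpow (- int (len w)) * laurent_of_poly (A y) = vpow (-1) * (T_simple_mult i ?h y + ?h y)"
      unfolding A_def w(2) by (rule T_simple_mult_C[OF i y is_KL_D(5)[OF K(1)], symmetric])
    finally show "hecke_C w (KL_rec i v) y = vpow (-1) * (T_simple_mult i ?h y + ?h y) - (\<Sum>z\<in>Z. of_int (mu z v) * ?c z y)"
      unfolding hC using c by simp
  qed
  have "hecke_bar (\<lambda>y. \<Sum>z\<in>Z. of_int (mu z v) * ?c z y) = (\<lambda>y. \<Sum>z\<in>Z. of_int (mu z v) * ?c z y)"
    unfolding hecke_bar_sum hecke_bar_scale using is_KL_D(1)[OF KZ] by simp
  then have "hecke_bar (hecke_C w (KL_rec i v)) x = hecke_C w (KL_rec i v) x" if x: "x \<in> W" for x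
    unfolding expand hecke_bar_diff hecke_bar_C_mult[OF i x is_KL_D(1)[OF K(1)]] by simp
  then have bar: "hecke_bar (hecke_C w (KL_rec i v)) = hecke_C w (KL_rec i v)"
    by (intro hecke_eqI supp_hecke_bar) (use bruhat_W(2)[of _ w] in \<open>auto simp: supp_W_def hecke_C_def\<close>)
  have dv: "2 * degree (KL y v) + 1 \<le> len v - len y" if "bruhat y v" "y \<noteq> v" for y
    using is_KL_D(3)[OF K(1)] that by blast
  have degM: "degree (monom 1 k * p) \<le> k + degree p" for k and p :: "int poly"
    by (rule order_trans[OF degree_mult_le]) (simp add: degree_monom_eq)
  have degZ: "degree (Polynomial.smult (mu z v) (monom 1 (e z) * KL y z)) \<le> e z + degree (KL y z)" for z y
    by (rule order_trans[OF degree_smult_le degM])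
  have deg: "2 * degree (KL_rec i v y) + 1 \<le> len w - len y" if y: "bruhat y w" "y \<noteq> w" for y
  proof -
    have yW: "y \<in> W" and ly: "len y < len w"
      using y bruhat_W bruhat_len by blast+
    \<comment> \<open>The largest degree allowed for the pair \<open>y\<close>,
      \<open>w\<close>.\<close>
    define d where "d = (len w - len y - 1) div 2"
    have d: "n \<le> d \<longleftrightarrow> 2 * n + 1 \<le> len w - len y" for n
      unfolding d_def using ly by linarith
    have z_small: "degree (Polynomial.smult (mu z v) (monom 1 (e z) * KL y z)) \<le> d" if z: "z \<in> Z" "z \<noteq> y" for z
    proof (cases "bruhat y z")
      case True
      then have "2 * degree (KL y z) + 1 \<le> len z - len y"
        using is_KL_D(3)[OF KZ] z by blast
      moreover have "len y < len z"
        using bruhat_len[OF True] z by auto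
      ultimately have "2 * (e z + degree (KL y z)) + 1 \<le> len w - len y"
        using e(1)[OF z(1)] Z(3)[OF z(1)] w(2) by arith
      then show ?thesis
        using degZ[of z y] d by (meson le_trans)
    qed (use KZ0 z in simp)
    show ?thesis
    proof (cases "ld y i")
      case False
      have yZ: "y \<notin> Z"
        using False Z(5) by blast
      have a: "degree (KL y v) \<le> d"
      proof (cases "y = v")
        case True
        then show ?thesis using is_KL_D(2)[OF K(1)] by simp
      next
        case ne: False
        then show ?thesis
          using dv[of y] K0[of y] w(2) ly unfolding d by (cases "bruhat y v") auto
      qed
      have b: "degree (monom 1 1 * KL (s i \<circ> y) v) \<le> d"
      proof (cases "bruhat (s i \<circ> y) v")
        case True
        have "s i \<circ> y \<noteq> v"
          using False nd ld_s[OF yW i] w(4) y(2) unfolding w_def by (metis ss(2))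
        moreover have "len (s i \<circ> y) = Suc (len y)"
          using len_s_left(2)[OF yW i False] .
        ultimately have "2 * degree (KL (s i \<circ> y) v) + 1 \<le> len v - Suc (len y)"
          using dv[OF True] by simp
        then have "2 * (1 + degree (KL (s i \<circ> y) v)) + 1 \<le> len w - len y"
          using w(2) by arith
        then show ?thesis
          using degM[of 1 "KL (s i \<circ> y) v"] d by (meson le_trans)
      qed (use K0 in simp)
      have "degree (\<Sum>z\<in>Z. Polynomial.smult (mu z v) (monom 1 (e z) * KL y z)) \<le> d"
      proof (rule degree_sum_le[OF Z(1)])
        fix z assume "z \<in> Z"
        then show "degree (Polynomial.smult (mu z v) (monom 1 (e z) * KL y z)) \<le> d"
          using yZ by (intro z_small) blast+
      qed
      then have "degree (KL_rec i v y) \<le> d"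
        unfolding rec A_def using False a b by (simp add: degree_diff_le degree_add_le)
      then show ?thesis
        using d by blast
    next
      case True
      have sy: "len y = Suc (len (s i \<circ> y))" "s i \<circ> y \<noteq> v"
        using len_s_left(1)[OF yW i True] y(2) unfolding w_def by (blast, metis ss(2))
      have yv: "y \<noteq> v"
        using True nd by blast
      \<comment> \<open>The only part that can exceed degree \<open>d\<close>. Its possible
        coefficient in degree \<open>(len w - len y) div 2\<close> is \<open>mu y v\<close>, and the
        summand \<open>z = y\<close> removes it because \<open>KL y y = 1\<close>.\<close>
      define B where "B = monom 1 1 * KL y v - (if y \<in> Z then Polynomial.smult (mu y v) (monom 1 (e y)) else 0)"
      have Kyy: "KL y y = 1" if "y \<in> Z"
        using is_KL_D(2)[OF KZ[OF that]] .
      have split: "KL_rec i v y = KL (s i \<circ> y) v + B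
          - (\<Sum>z\<in>Z - {y}. Polynomial.smult (mu z v) (monom 1 (e z) * KL y z))"
      proof -
        have "(\<Sum>z\<in>Z. Polynomial.smult (mu z v) (monom 1 (e z) * KL y z))
          = (if y \<in> Z then Polynomial.smult (mu y v) (monom 1 (e y)) else 0)
            + (\<Sum>z\<in>Z - {y}. Polynomial.smult (mu z v) (monom 1 (e z) * KL y z))"
          using Kyy by (auto simp: sum.remove[OF Z(1)])
        then show ?thesis
          unfolding rec A_def B_def using True by simp
      qed
      have a: "degree (KL (s i \<circ> y) v) \<le> d"
        using dv[of "s i \<circ> y"] K0[of "s i \<circ> y"] sy w(2) ly unfolding d by (cases "bruhat (s i \<circ> y) v") auto
      have "degree B \<le> d"
      proof (cases "bruhat y v")
        case False
        then show ?thesis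
          using K0 Z(6) unfolding B_def by auto
      next
        case b: True
        have lv: "len y < len v"
          using bruhat_len[OF b] yv by blast
        have dB: "coeff B n = 0" if n: "n > d" for n
        proof -
          have n': "2 * n \<ge> len w - len y"
            using n d[of n] by linarith
          then have n1: "n \<ge> 1"
            using ly by linarith
          show ?thesis
          proof (cases "2 * n = len w - len y")
            case True
            then have o: "odd (len v - len y)" "(len v - len y - 1) div 2 = n - 1" "(len w - len y) div 2 = n"
            proof -
              have "len v - len y = 2 * n - 1"
                using True w(2) lv by arith
              then show "odd (len v - len y)" "(len v - len y - 1) div 2 = n - 1"
                using n1 by (simp, arith)
              show "(len w - len y) div 2 = n"
                using True by simp
            qed
            then have m: "mu y v = coeff (KL y v) (n - 1)"
              using lv by (simp add: mu_def)
            have "coeff (monom 1 1 * KL y v) n = mu y v"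
              using n1 m by (simp add: coeff_monom_mult)
            moreover have "y \<in> Z \<longleftrightarrow> mu y v \<noteq> 0"
              using yW \<open>ld y i\<close> by (simp add: Z_def)
            ultimately show ?thesis
              unfolding B_def using o(3) by (simp add: e_def)
          next
            case False
            then have "2 * n > len w - len y"
              using n' by simp
            then have "degree (KL y v) < n - 1" "y \<in> Z \<Longrightarrow> e y \<noteq> n"
              using dv[OF b yv] w(2) lv e(1)[of y] by (linarith, linarith)
            then show ?thesis
              unfolding B_def by (simp add: coeff_monom_mult coeff_eq_0)
          qed
        qed
        then show ?thesis
          by (intro degree_le) auto
      qed
      moreover have "degree (\<Sum>z\<in>Z - {y}. Polynomial.smult (mu z v) (monom 1 (e z) * KL y z)) \<le> d"
      proof (rule degree_sum_le)
        fix z assume "z \<in> Z - {y}"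
        then show "degree (Polynomial.smult (mu z v) (monom 1 (e z) * KL y z)) \<le> d"
          by (intro z_small) blast+
      qed (use Z(1) in simp)
      ultimately have "degree (KL_rec i v y) \<le> d"
        unfolding split using a by (simp add: degree_diff_le degree_add_le)
      then show ?thesis
        using d by blast
    qed
  qed
  have one: "KL_rec i v w = 1"
  proof -
    have "KL w z = 0" if "z \<in> Z" for z
      using KZ0[OF that] bruhat_len_le[of w z] Z(3)[OF that] w(2) by auto
    moreover have "KL w v = 0"
      using K0 bruhat_len_le[of w v] w(2) by auto
    ultimately show ?thesis
      unfolding rec A_def w(4) using w(3) is_KL_D(2)[OF K(1)] by (simp add: sum.neutral)
  qed
  show ?thesis
    unfolding is_KL_def w_def[symmetric] using bar one deg zero by blast
qed

lemma is_KL_id: "is_KL id (\<lambda>y. if y = id then 1 else 0)"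
proof -
  have b: "bruhat x id \<longleftrightarrow> x = id" for x
    using bruhat_len[of x id] by auto
  have h: "hecke_C id (\<lambda>y. if y = id then 1 else 0) = T id"
    unfolding hecke_C_def T_def by (rule ext) (simp add: b)
  have "hecke_bar (T id) = T id"
  proof
    fix x
    have "hecke_bar (T id) x = (\<Sum>w\<in>{id}. lbar (T id w) * bar_T w x)"
      unfolding hecke_bar_def by (rule sum.mono_neutral_right) (auto simp: T_def)
    then show "hecke_bar (T id) x = T id x"
      by (simp add: T_def)
  qed
  then show ?thesis
    unfolding is_KL_def h using b by auto
qed

lemma is_KL: "w \<in> W \<Longrightarrow> is_KL w (\<lambda>y. KL y w)"
proof (induction rule: W_induct)
  case id
  have "(\<lambda>y. KL y id) = (\<lambda>y. if y = id then 1 else 0)"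
    using KL_eqI[OF is_KL_id] by auto
  then show ?case
    using is_KL_id by (simp add: id_def)
next
  case (step v i)
  have "is_KL (s i \<circ> v) (KL_rec i v)"
    using step by (intro is_KL_rec) auto
  moreover have "KL y (s i \<circ> v) = KL_rec i v y" for y
    using KL_eqI[OF calculation] step by simp
  ultimately have "is_KL (s i \<circ> v) (\<lambda>y. KL y (s i \<circ> v))"
    by presburger
  then show ?case
    by (simp add: o_def)
qed

lemma KL_rec: "v \<in> W \<Longrightarrow> i \<in> {1..4} \<Longrightarrow> \<not> ld v i \<Longrightarrow> KL y (s i \<circ> v) = KL_rec i v y"
  using KL_eqI[OF is_KL_rec[OF _ _ _ is_KL is_KL]] by simp

lemma KL_self [simp]: "w \<in> W \<Longrightarrow> KL w w = 1"
  using is_KL_D(2)[OF is_KL] .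

lemma KL_degree: "w \<in> W \<Longrightarrow> bruhat x w \<Longrightarrow> x \<noteq> w \<Longrightarrow> 2 * degree (KL x w) + 1 \<le> len w - len x"
  using is_KL_D(3)[OF is_KL] .

lemma KL_not_bruhat: "w \<in> W \<Longrightarrow> \<not> bruhat x w \<Longrightarrow> KL x w = 0"
  using is_KL_D(4)[OF is_KL] .

lemma KL_eq_0_len: "w \<in> W \<Longrightarrow> len w \<le> len x \<Longrightarrow> x \<noteq> w \<Longrightarrow> KL x w = 0"
  using KL_not_bruhat bruhat_len[of x w] by fastforce

lemma KL_id: "KL y id = (if y = id then 1 else 0)"
  using KL_eqI[OF is_KL_id] by simp

text \<open>The main part of the recursion for \<open>w = s i \<circ> v\<close> is symmetric under
  exchanging \<open>y\<close> and \<open>s i \<circ> y\<close>; the subtracted terms are so by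
  induction, since every \<open>z\<close> occurring there is shorter and has the descent
  \<open>i\<close>.\<close>

lemma KL_left_invariant:
  assumes "w \<in> W" "i \<in> {1..4}" "ld w i" "y \<in> W"
  shows "KL (s i \<circ> y) w = KL y w"
  using assms
proof (induction "len w" arbitrary: w y rule: less_induct)
  case less
  note IH = less.hyps and w = less.prems
  define v where "v = s i \<circ> w"
  have v: "v \<in> W" "\<not> ld v i" "w = s i \<circ> v" "len v < len w"
    using w ld_s[of w i] len_s_left(1)[of w i] unfolding v_def by (simp, blast, simp only: ss, simp)
  have y: "s i \<circ> (s i \<circ> y) = y" "ld (s i \<circ> y) i \<longleftrightarrow> \<not> ld y i"
    using w ld_s by (simp only: ss, blast)
  have z: "KL (s i \<circ> y) z = KL y z" if "mu z v \<noteq> 0" "z \<in> W" "ld z i" for z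
    using that IH[of z y] v(4) w by (auto simp: mu_def split: if_splits)
  have "(\<Sum>z\<in>{z\<in>W. ld z i}. Polynomial.smult (mu z v) (monom 1 ((Suc (len v) - len z) div 2) * KL (s i \<circ> y) z))
    = (\<Sum>z\<in>{z\<in>W. ld z i}. Polynomial.smult (mu z v) (monom 1 ((Suc (len v) - len z) div 2) * KL y z))"
  proof (rule sum.cong[OF refl])
    fix z assume "z \<in> {z\<in>W. ld z i}"
    then show "Polynomial.smult (mu z v) (monom 1 ((Suc (len v) - len z) div 2) * KL (s i \<circ> y) z)
        = Polynomial.smult (mu z v) (monom 1 ((Suc (len v) - len z) div 2) * KL y z)"
      using z[of z] by (cases "mu z v = 0") simp_all
  qed
  then have "KL_rec i v (s i \<circ> y) = KL_rec i v y"
    unfolding KL_rec_def y by simp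
  then have "KL (s i \<circ> y) w = KL y w"
    unfolding v(3) KL_rec[OF v(1) w(2) v(2)] .
  then show ?case
    by (simp add: o_def)
qed

lemma hecke_bar_flip: "supp_W h \<Longrightarrow> hecke_bar (flip_inv h) = flip_inv (hecke_bar h)"
proof (rule hecke_eqI)
  fix x assume x: "x \<in> W"
  have "hecke_bar (flip_inv h) x = (\<Sum>w\<in>W. lbar (h (inv w)) * bar_T w x)"
    unfolding hecke_bar_def by (intro sum.cong) (simp_all add: flip_inv_def)
  also have "\<dots> = (\<Sum>w\<in>W. lbar (h w) * bar_T (inv w) x)"
    by (rule sum.reindex_bij_witness[of _ inv inv]) simp_all
  also have "\<dots> = (\<Sum>w\<in>W. lbar (h w) * bar_T w (inv x))"
    using x by (intro sum.cong refl) (simp add: flip_inv_def flip: flip_bar_T)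
  finally show "hecke_bar (flip_inv h) x = flip_inv (hecke_bar h) x"
    using x by (simp add: flip_inv_def hecke_bar_def)
qed (simp_all add: supp_hecke_bar)

text \<open>The bar involution commutes with \<open>flip_inv\<close>, so the family transported
  along inversion satisfies the defining conditions; uniqueness does the rest.\<close>

lemma KL_inv:
  assumes "w \<in> W" "y \<in> W"
  shows "KL (inv y) (inv w) = KL y w"
proof -
  define f where "f = (\<lambda>x. if x \<in> W then KL (inv x) w else 0)"
  have K: "is_KL w (\<lambda>y. KL y w)"
    using is_KL assms by blast
  have b: "bruhat x (inv w) \<longleftrightarrow> bruhat (inv x) w" if "x \<in> W" for x
    using bruhat_inv_iff[of "inv x" w] that assms by simp
  have z: "f x = 0" if "\<not> bruhat x (inv w)" for x
    using that is_KL_D(4)[OF K, of "inv x"] b[of x] by (auto simp: f_def)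
  have sup: "supp_W (hecke_C w (\<lambda>y. KL y w))"
    using bruhat_W(2)[of _ w] by (auto simp: supp_W_def hecke_C_def)
  have h: "hecke_C (inv w) f = flip_inv (hecke_C w (\<lambda>y. KL y w))"
  proof
    fix x
    show "hecke_C (inv w) f x = flip_inv (hecke_C w (\<lambda>y. KL y w)) x"
      using b[of x] bruhat_W(2)[of x "inv w"] assms by (auto simp: hecke_C_def flip_inv_def f_def)
  qed
  have "is_KL (inv w) f"
    unfolding is_KL_def
  proof (intro conjI allI impI)
    show "hecke_bar (hecke_C (inv w) f) = hecke_C (inv w) f"
      unfolding h hecke_bar_flip[OF sup] is_KL_D(1)[OF K] ..
    show "f (inv w) = 1"
      using assms by (simp add: f_def)
  next
    fix x assume x: "bruhat x (inv w) \<and> x \<noteq> inv w"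
    then have xW: "x \<in> W" using bruhat_W by blast
    then have "inv x \<noteq> w"
      using x by auto
    then show "2 * degree (f x) + 1 \<le> len (inv w) - len x"
      using KL_degree[OF assms(1), of "inv x"] b[OF xW] x xW assms by (simp add: f_def)
  qed (use z in blast)
  then show ?thesis
    using KL_eqI[of "inv w" f "inv y"] assms by (simp add: f_def)
qed

lemma KL_right_invariant:
  assumes "w \<in> W" "i \<in> {1..4}" "rd w i" "y \<in> W"
  shows "KL (y \<circ> s i) w = KL y w"
proof -
  have "KL (s i \<circ> inv y) (inv w) = KL (inv y) (inv w)"
    using assms by (intro KL_left_invariant) (auto simp: ld_inv)
  moreover have "KL (s i \<circ> inv y) (inv w) = KL (y \<circ> s i) w"
    using KL_inv[of w "y \<circ> s i"] inv_s_right[of y i] assms by simp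
  ultimately show ?thesis
    using KL_inv assms by simp
qed

section \<open>The basis \<open>C'\<close> and left cells\<close>

lemma C'_eq: "w \<in> W \<Longrightarrow> C' w y = poly (KL y w) 1"
  using KL_not_bruhat[of w y] by (auto simp: C'_def)

lemma C'_off: "y \<notin> W \<Longrightarrow> C' w y = 0"
  using bruhat_W(2) by (auto simp: C'_def)

lemma C'_self [simp]: "w \<in> W \<Longrightarrow> C' w w = 1"
  by (simp add: C'_eq)

lemma C'_0: "w \<in> W \<Longrightarrow> len w \<le> len x \<Longrightarrow> x \<noteq> w \<Longrightarrow> C' w x = 0"
  by (simp add: C'_eq KL_eq_0_len)

lemma C'_left_invariant: "w \<in> W \<Longrightarrow> i \<in> {1..4} \<Longrightarrow> ld w i \<Longrightarrow> y \<in> W \<Longrightarrow> C' w (s i \<circ> y) = C' w y"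
  by (simp add: C'_eq KL_left_invariant)

lemma C'_right_invariant: "w \<in> W \<Longrightarrow> i \<in> {1..4} \<Longrightarrow> rd w i \<Longrightarrow> y \<in> W \<Longrightarrow> C' w (y \<circ> s i) = C' w y"
  by (simp add: C'_eq KL_right_invariant)

text \<open>Here \<open>Z\<close> may be any upper bound for the support of \<open>mu\<close> in its
  second argument \<open>v\<close>, such as the lists of candidates computed below from descents and
  lengths.\<close>

lemma KL_rec_superset:
  assumes v: "v \<in> W" and i: "i \<in> {1..4}" and nd: "\<not> ld v i"
    and Z: "finite Z" "\<And>z. z \<in> W \<Longrightarrow> ld z i \<Longrightarrow> mu z v \<noteq> 0 \<Longrightarrow> z \<in> Z" "\<And>z. z \<in> Z \<Longrightarrow> z \<in> W \<and> ld z i"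
  shows "KL y (s i \<circ> v) =
    (if ld y i then KL (s i \<circ> y) v + monom 1 1 * KL y v else monom 1 1 * KL (s i \<circ> y) v + KL y v)
    - (\<Sum>z\<in>Z. Polynomial.smult (mu z v) (monom 1 ((Suc (len v) - len z) div 2) * KL y z))"
proof -
  have "(\<Sum>z\<in>{z\<in>W. ld z i}. Polynomial.smult (mu z v) (monom 1 ((Suc (len v) - len z) div 2) * KL y z))
      = (\<Sum>z\<in>Z. Polynomial.smult (mu z v) (monom 1 ((Suc (len v) - len z) div 2) * KL y z))"
    by (rule sum.mono_neutral_right) (use Z in auto)
  then show ?thesis
    using KL_rec[OF v i nd, of y] by (simp add: KL_rec_def)
qed

lemma C'_rec:
  assumes v: "v \<in> W" and i: "i \<in> {1..4}" and nd: "\<not> ld v i"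
    and Z: "finite Z" "\<And>z. z \<in> W \<Longrightarrow> ld z i \<Longrightarrow> mu z v \<noteq> 0 \<Longrightarrow> z \<in> Z" "\<And>z. z \<in> Z \<Longrightarrow> z \<in> W \<and> ld z i"
  shows "C' (s i \<circ> v) y = C' v y + C' v (s i \<circ> y) - (\<Sum>z\<in>Z. mu z v * C' z y)"
proof -
  have "s i \<circ> v \<in> W"
    using v i by simp
  then show ?thesis
    using Z(3) v by (simp add: C'_eq KL_rec_superset[OF assms] poly_sum poly_monom)
qed

text \<open>Invariance replaces \<open>z\<close> by \<open>s t \<circ> z\<close>, which is one
  longer. If it differs from \<open>y\<close>, its degree bound excludes the degree whose
  coefficient is \<open>mu z y\<close>.\<close>

lemma mu_left:
  assumes W: "z \<in> W" "y \<in> W" and m: "mu z y \<noteq> 0" and t: "t \<in> {1..4}" "ld y t" "\<not> ld z t"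
  shows "y = s t \<circ> z"
proof (rule ccontr)
  assume ne: "y \<noteq> s t \<circ> z"
  have o: "odd (len y - len z)" and c: "coeff (KL z y) ((len y - len z - 1) div 2) \<noteq> 0"
    using m by (auto simp: mu_def split: if_splits)
  have e: "KL (s t \<circ> z) y = KL z y"
    using KL_left_invariant[OF W(2) t(1,2) W(1)] .
  have "bruhat (s t \<circ> z) y"
    using c e KL_not_bruhat[OF W(2), of "s t \<circ> z"] by (metis coeff_0)
  then have "2 * degree (KL z y) + 1 \<le> len y - len (s t \<circ> z)"
    using KL_degree[OF W(2)] ne e by metis
  moreover obtain b where b: "len y - len z = 2 * b + 1"
    using o by (rule oddE)
  moreover have "len (s t \<circ> z) = Suc (len z)"
    using len_s_left(2)[OF W(1) t(1,3)] .
  ultimately have "degree (KL z y) < (len y - len z - 1) div 2"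
    by simp
  then show False
    using c by (simp add: coeff_eq_0)
qed

lemma mu_right:
  assumes W: "z \<in> W" "y \<in> W" and m: "mu z y \<noteq> 0" and t: "t \<in> {1..4}" "rd y t" "\<not> rd z t"
  shows "y = z \<circ> s t"
proof -
  have "mu (inv z) (inv y) \<noteq> 0"
    using m W unfolding mu_def by (simp only: KL_inv len_inv simp_thms)
  then have "inv y = s t \<circ> inv z"
    using mu_left[of "inv z" "inv y" t] W t by (simp add: ld_inv)
  then have "inv (inv y) = inv (s t \<circ> inv z)"
    by simp
  then show ?thesis
    using inv_s_left[of "inv z" t] W t by simp
qed

lemma mu_s_left:
  assumes "z \<in> W" "t \<in> {1..4}" "\<not> ld z t"
  shows "mu z (s t \<circ> z) = 1"
proof -
  have "KL (s t \<circ> z) (s t \<circ> z) = KL z (s t \<circ> z)"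
    using assms ld_s[of z t] by (intro KL_left_invariant) auto
  then have "KL z (s t \<circ> z) = 1"
    using assms by simp
  then show ?thesis
    using len_s_left(2)[OF assms] by (simp add: mu_def)
qed

lemma rd_left_change:
  assumes w: "w \<in> W" and i: "i \<in> {1..4}" and j: "j \<in> {1..4}" and d: "rd (s i \<circ> w) j \<noteq> rd w j"
  shows "s i \<circ> w = w \<circ> s j"
proof -
  have "ld (inv w \<circ> s i) j \<noteq> ld (inv w) j"
    using d w i ld_inv[of w j] ld_inv[of "s i \<circ> w" j] inv_s_left[OF w i] by simp
  then have "inv (s j \<circ> inv w) = inv (inv w \<circ> s i)"
    using ld_right_change[of "inv w" j i] w i j by simp
  then show ?thesis
    using w inv_s_left[of "inv w" j] inv_s_right[of "inv w" i] i j by simp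
qed

lemma C'_id: "C' id = (\<lambda>y. if y = id then 1 else 0)"
  by (rule ext) (simp add: C'_eq KL_id)

lemma C'_s:
  assumes "i \<in> {1..4}"
  shows "C' (s i) = (\<lambda>y. if y = id \<or> y = s i then 1 else 0)"
proof
  fix y
  have nd: "\<not> ld id i"
    by (simp add: ld_def rd_def)
  have "C' (s i \<circ> id) y = C' id y + C' id (s i \<circ> y) - (\<Sum>z\<in>{}. mu z id * C' z y)"
    by (rule C'_rec) (use assms nd in \<open>auto simp: mu_def\<close>)
  moreover have "s i \<circ> y = id \<longleftrightarrow> y = s i"
    by (metis comp_id ss(1,2))
  moreover have "s i \<noteq> id"
    using s_neq[OF assms id_W] by simp
  ultimately show "C' (s i) y = (if y = id \<or> y = s i then 1 else 0)"
    by (simp add: C'_id)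
qed

lemma gmult_C'_s:
  assumes "i \<in> {1..4}"
  shows "gmult (C' (s i)) h x = h x + h (s i \<circ> x)"
proof -
  have ne: "s i \<noteq> id"
    using s_neq[OF assms id_W] by simp
  have "gmult (C' (s i)) h x = (\<Sum>y\<in>{id, s i}. C' (s i) y * h (inv y \<circ> x))"
    unfolding gmult_def by (rule sum.mono_neutral_right) (use assms in \<open>auto simp: C'_s\<close>)
  then show ?thesis
    using ne by (simp add: C'_s[OF assms] inv_id[unfolded id_def[symmetric]])
qed

text \<open>Unitriangularity with respect to length: at a longest element of the support of
  \<open>c\<close> only its own term is nonzero.\<close>

lemma C'_independent:
  assumes z: "\<And>z. (\<Sum>u\<in>W. c u * C' u z) = 0" and x: "x \<in> W"
  shows "c x = (0::int)"
proof (rule ccontr)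
  assume "c x \<noteq> 0"
  define X where "X = {u \<in> W. c u \<noteq> 0}"
  have "finite X" "X \<noteq> {}"
    using x \<open>c x \<noteq> 0\<close> by (auto simp: X_def)
  then obtain u where u: "u \<in> X" "\<And>v. v \<in> X \<Longrightarrow> len v \<le> len u"
    using Max_in[of "len ` X"] Max_ge[of "len ` X"] by fastforce
  have "(\<Sum>v\<in>W. c v * C' v u) = (\<Sum>v\<in>{u}. c v * C' v u)"
  proof (rule sum.mono_neutral_right)
    show "\<forall>v\<in>W - {u}. c v * C' v u = 0"
      using u(2) C'_0 unfolding X_def by fastforce
  qed (use u in \<open>auto simp: X_def\<close>)
  then show False
    using z[of u] u by (simp add: X_def)
qed

lemma occurs_in_coeff:
  assumes "occurs_in x h" "\<And>z. h z = (\<Sum>u\<in>W. d u * C' u z)"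
  shows "d x \<noteq> 0"
proof -
  obtain c where c: "x \<in> W" "h = (\<lambda>z. \<Sum>u\<in>W. c u * C' u z)" "c x \<noteq> 0"
    using assms(1) by (auto simp: occurs_in_def)
  have "(\<Sum>u\<in>W. (c u - d u) * C' u z) = 0" for z
    using fun_cong[OF c(2), of z] assms(2)[of z] by (simp add: left_diff_distrib sum_subtractf)
  from C'_independent[OF this c(1)] show ?thesis
    using c(3) by simp
qed

text \<open>\<open>cell_edge y x\<close>: necessary conditions for \<open>C' x\<close> to occur in a product
  \<open>C' (s i) C' y\<close>, in terms of descents and lengths only.\<close>

definition mu_cand :: "perm \<Rightarrow> perm \<Rightarrow> bool" where
  "mu_cand z v \<longleftrightarrow> len z < len v \<and> odd (len v - len z) \<and>
     (\<forall>t\<in>{1..4}. ld v t \<and> \<not> ld z t \<longrightarrow> v = s t \<circ> z) \<and> (\<forall>t\<in>{1..4}. rd v t \<and> \<not> rd z t \<longrightarrow> v = z \<circ> s t)"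

lemma mu_candI: "z \<in> W \<Longrightarrow> v \<in> W \<Longrightarrow> mu z v \<noteq> 0 \<Longrightarrow> mu_cand z v"
  using mu_left[of z v] mu_right[of z v] by (auto simp: mu_cand_def mu_def split: if_splits)

definition cell_edge :: "perm \<Rightarrow> perm \<Rightarrow> bool" where
  "cell_edge y x \<longleftrightarrow> x = y \<or> (\<exists>i\<in>{1..4}. \<not> ld y i \<and> ld x i \<and> (x = s i \<circ> y \<or> mu_cand x y))"

text \<open>If \<open>i\<close> is a left descent of \<open>y\<close>, the product is
  \<open>2 C' y\<close>; otherwise it is \<open>C' (s i \<circ> y)\<close> plus the mu terms. The
  second claim makes right descents grow along the left preorder, hence constant on left
  cells.\<close>

lemma occurs_edge:
  assumes y: "y \<in> W" and x: "x \<in> W" and r: "r \<in> S" and occ: "occurs_in x (gmult (C' r) (C' y))"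
  shows "cell_edge y x" "\<And>k. k \<in> {1..4} \<Longrightarrow> rd y k \<Longrightarrow> rd x k"
proof -
  obtain i where i: "i \<in> {1..4}" "r = s i"
    using r by (auto simp: S_def)
  have "x = y \<or> (\<not> ld y i \<and> ld x i \<and> (x = s i \<circ> y \<or> mu x y \<noteq> 0))"
  proof (cases "ld y i")
    case True
    have "gmult (C' r) (C' y) z = (\<Sum>u\<in>W. (if u = y then 2 else 0) * C' u z)" for z
    proof -
      have "C' y (s i \<circ> z) = C' y z"
        using C'_left_invariant[OF y i(1) True, of z] C'_off[of z y] C'_off[of "s i \<circ> z" y] i(1)
        by (cases "z \<in> W") simp_all
      then show ?thesis
        unfolding i(2) gmult_C'_s[OF i(1)] using y by (simp add: if_distrib[of "\<lambda>a. a * _"] sum.delta cong: if_cong)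
    qed
    from occurs_in_coeff[OF occ this] show ?thesis
      by (auto split: if_splits)
  next
    case False
    have sy: "s i \<circ> y \<in> W" "ld (s i \<circ> y) i"
      using y i False ld_s[of y i] by auto
    define Z where "Z = {z\<in>W. ld z i}"
    have "gmult (C' r) (C' y) z = (\<Sum>u\<in>W. ((if u = s i \<circ> y then 1 else 0) + (if ld u i then mu u y else 0)) * C' u z)" for z
    proof -
      have "C' (s i \<circ> y) z = C' y z + C' y (s i \<circ> z) - (\<Sum>u\<in>Z. mu u y * C' u z)"
        by (rule C'_rec) (use y i False in \<open>auto simp: Z_def\<close>)
      moreover have "(\<Sum>u\<in>Z. mu u y * C' u z) = (\<Sum>u\<in>W. (if ld u i then mu u y else 0) * C' u z)"
        unfolding Z_def by (rule sum.mono_neutral_cong_left) auto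
      moreover have "(\<Sum>u\<in>W. (if u = s i \<circ> y then 1 else 0) * C' u z) = C' (s i \<circ> y) z"
        using sy(1) by (simp add: if_distrib[of "\<lambda>a. a * _"] sum.delta cong: if_cong)
      ultimately show ?thesis
        unfolding i(2) gmult_C'_s[OF i(1)] by (simp add: distrib_right sum.distrib)
    qed
    from occurs_in_coeff[OF occ this] show ?thesis
      using False sy by (auto split: if_splits)
  qed
  then consider "x = y" | "\<not> ld y i" "ld x i" "x = s i \<circ> y" | "\<not> ld y i" "ld x i" "mu x y \<noteq> 0"
    by blast
  note cases = this
  show "cell_edge y x"
    using cases by cases (use i mu_candI[OF x y] in \<open>auto simp: cell_edge_def\<close>)
  fix k assume k: "k \<in> {1..4}" "rd y k"
  show "rd x k"
  proof (rule ccontr)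
    assume nk: "\<not> rd x k"
    from cases show False
    proof cases
      case 1
      then show False using k nk by simp
    next
      case 2
      have "s i \<circ> y = y \<circ> s k"
        using rd_left_change[OF y i(1) k(1)] k nk 2 by simp
      then show False
        using len_s_left(2)[OF y i(1) 2(1)] len_s_right(1)[OF y k] by simp
    next
      case 3
      \<comment> \<open>A right descent lost from \<open>y\<close> to \<open>x\<close> forces
        \<open>y = x \<circ> s k\<close>. As \<open>i\<close> is a left descent of \<open>x\<close>
        but not of \<open>y\<close>, this product is also \<open>s i \<circ> x\<close>, so
        \<open>y\<close> would be shorter than \<open>x\<close>, whereas mu vanishes unless
        \<open>x\<close> is shorter.\<close>
      have yk: "y = x \<circ> s k"
        using mu_right[OF x y 3(3) k nk] .
      then have "s i \<circ> x = x \<circ> s k"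
        using ld_right_change[OF x i(1) k(1)] 3 by simp
      then have "len x = Suc (len y)"
        using len_s_left(1)[OF x i(1) 3(2)] yk by simp
      then show False
        using 3(3) by (simp add: mu_def)
    qed
  qed
qed

lemma left_le_rd:
  assumes "left_le x y" "k \<in> {1..4}" "rd y k"
  shows "rd x k"
  using assms(1) unfolding left_le_def
proof (induction rule: converse_rtrancl_induct)
  case base
  then show ?case using assms(3) .
next
  case (step x z)
  then obtain r where "x \<in> W" "z \<in> W" "r \<in> S" "occurs_in x (gmult (C' r) (C' z))" by auto
  then show ?case
    using occurs_edge(2) assms(2) step.IH by blast
qed

lemma left_cell_refl: "w \<in> W \<Longrightarrow> w \<in> left_cell w"
  by (simp add: left_cell_def left_le_def)

lemma left_cell_rd: "x \<in> left_cell w \<Longrightarrow> k \<in> {1..4} \<Longrightarrow> rd x k \<longleftrightarrow> rd w k"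
  using left_le_rd by (auto simp: left_cell_def)

lemma J_descents:
  assumes "w \<in> J" "k \<in> {1..4}"
  shows "w \<in> W" "ld w k \<longleftrightarrow> rd w k"
  using assms left_cell_rd[of "inv w" w k] by (auto simp: J_def rd_inv)

text \<open>A chain inside a left cell has constant right descents, so it cannot leave a set closed
  under the edges which preserve the right descents.\<close>

lemma left_cell_subset:
  assumes w: "w \<in> G" "G \<subseteq> W"
    and cl: "\<And>y x. y \<in> G \<Longrightarrow> x \<in> W \<Longrightarrow> (\<forall>k\<in>{1..4}. rd x k \<longleftrightarrow> rd w k) \<Longrightarrow> cell_edge y x \<Longrightarrow> x \<in> G"
    and x: "x \<in> left_cell w"
  shows "x \<in> G"
proof -
  have "left_le x w"
    using x by (simp add: left_cell_def)
  then have "(\<forall>k\<in>{1..4}. rd w k \<longrightarrow> rd x k) \<and> ((\<forall>k\<in>{1..4}. rd x k \<longleftrightarrow> rd w k) \<longrightarrow> x \<in> G)"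
    unfolding left_le_def
  proof (induction rule: converse_rtrancl_induct)
    case base
    then show ?case using w by simp
  next
    case (step x y)
    then obtain r where r: "x \<in> W" "y \<in> W" "r \<in> S" "occurs_in x (gmult (C' r) (C' y))" by auto
    note e = occurs_edge[OF r(2,1,3,4)]
    have "x \<in> G" if "\<forall>k\<in>{1..4}. rd x k \<longleftrightarrow> rd w k"
      using cl[OF _ r(1) that e(1)] step.IH e(2) that by blast
    then show ?case
      using step.IH e(2) by blast
  qed
  then show ?thesis
    using left_cell_rd[OF x] by blast
qed

lemma duflo_eqI:
  assumes "w \<in> W" "\<And>x. x \<in> left_cell w \<Longrightarrow> x \<noteq> w \<Longrightarrow> duflo_fn w < duflo_fn x"
  shows "duflo w = w"
  unfolding duflo_def
proof (rule the_equality)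
  show "w \<in> left_cell w \<and> (\<forall>x\<in>left_cell w. duflo_fn w \<le> duflo_fn x)"
    using left_cell_refl[OF assms(1)] assms(2) by (metis order.refl less_imp_le)
  show "d = w" if "d \<in> left_cell w \<and> (\<forall>x\<in>left_cell w. duflo_fn d \<le> duflo_fn x)" for d
    using that left_cell_refl[OF assms(1)] assms(2) by (metis not_le)
qed

section \<open>Permutations as tuples\<close>

text \<open>One-line notation. The functions with suffix 5 are executable counterparts of the
  notions on \<open>perm\<close>, so that exhaustive checks over the 120 elements of
  \<open>W\<close> become evaluations.\<close>

type_synonym tuple = "nat \<times> nat \<times> nat \<times> nat \<times> nat"

definition tup :: "perm \<Rightarrow> tuple" where "tup w = (w 1, w 2, w 3, w 4, w 5)"

fun perm5 :: "tuple \<Rightarrow> perm" where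
  "perm5 (a, b, c, d, e) = (\<lambda>i. if i = 1 then a else if i = 2 then b else if i = 3 then c else if i = 4 then d
      else if i = 5 then e else i)"

definition range5 :: "nat list" where "range5 = [1, 2, 3, 4, 5]"

definition tuples :: "tuple list" where
  "tuples = [(a, b, c, d, e). a \<leftarrow> range5, b \<leftarrow> removeAll a range5, c \<leftarrow> removeAll b (removeAll a range5),
     d \<leftarrow> removeAll c (removeAll b (removeAll a range5)),
     e \<leftarrow> removeAll d (removeAll c (removeAll b (removeAll a range5)))]"

fun pos5 :: "tuple \<Rightarrow> nat \<Rightarrow> nat" where
  "pos5 (a, b, c, d, e) k = (if a = k then 1 else if b = k then 2 else if c = k then 3 else if d = k then 4 else 5)"

fun rd5 :: "tuple \<Rightarrow> nat \<Rightarrow> bool" where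
  "rd5 (a, b, c, d, e) k = (if k = 1 then b < a else if k = 2 then c < b else if k = 3 then d < c else e < d)"

definition ld5 :: "tuple \<Rightarrow> nat \<Rightarrow> bool" where
  "ld5 t k \<longleftrightarrow> pos5 t (Suc k) < pos5 t k"

fun len5 :: "tuple \<Rightarrow> nat" where
  "len5 (a, b, c, d, e) = of_bool (b < a) + of_bool (c < a) + of_bool (c < b)
   + of_bool (d < a) + of_bool (d < b) + of_bool (d < c)
   + of_bool (e < a) + of_bool (e < b) + of_bool (e < c) + of_bool (e < d)"

definition swap :: "nat \<Rightarrow> nat \<Rightarrow> nat" where
  "swap i j = (if j = i then Suc i else if j = Suc i then i else j)"

fun sl5 :: "nat \<Rightarrow> tuple \<Rightarrow> tuple" where
  "sl5 k (a, b, c, d, e) = (swap k a, swap k b, swap k c, swap k d, swap k e)"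

fun sr5 :: "tuple \<Rightarrow> nat \<Rightarrow> tuple" where
  "sr5 (a, b, c, d, e) k = (if k = 1 then (b, a, c, d, e) else if k = 2 then (a, c, b, d, e)
     else if k = 3 then (a, b, d, c, e) else (a, b, c, e, d))"

lemma perm5_apply: "perm5 (a, b, c, d, e) 1 = a" "perm5 (a, b, c, d, e) 2 = b" "perm5 (a, b, c, d, e) 3 = c"
   "perm5 (a, b, c, d, e) 4 = d" "perm5 (a, b, c, d, e) 5 = e"
  by simp_all

lemma tup_perm5 [simp]: "tup (perm5 t) = t"
  by (cases t) (simp add: tup_def)

lemma in_tuples: "(a, b, c, d, e) \<in> set tuples \<longleftrightarrow> a \<in> {1..5} \<and> b \<in> {1..5} \<and> c \<in> {1..5} \<and> d \<in> {1..5} \<and> e \<in> {1..5}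
    \<and> distinct [a, b, c, d, e]"
proof -
  have "set range5 = {1..5}"
    unfolding range5_def atLeastAtMost_1_5 by simp
  then show ?thesis
    unfolding tuples_def by (auto simp: image_iff)
qed

lemma perm5_tup [simp]: "w \<in> W \<Longrightarrow> perm5 (tup w) = w"
proof
  fix i assume w: "w \<in> W"
  show "perm5 (tup w) i = w i"
  proof (cases "i \<in> {1..5}")
    case True
    then show ?thesis
      unfolding atLeastAtMost_1_5 tup_def by (elim insertE emptyE) simp_all
  next
    case False
    then show ?thesis
      using permutes_not_in[OF W_D[OF w] False] unfolding atLeastAtMost_1_5 tup_def by simp
  qed
qed

lemma tup_in_tuples: "w \<in> W \<Longrightarrow> tup w \<in> set tuples"
  using W_range[of w 1] W_range[of w 2] W_range[of w 3] W_range[of w 4] W_range[of w 5]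
  unfolding tup_def in_tuples by (simp add: W_inj_eq)

lemma perm5_W: "t \<in> set tuples \<Longrightarrow> perm5 t \<in> W"
proof (cases t)
  case (fields a b c d e)
  assume "t \<in> set tuples"
  then have r: "a \<in> {1..5}" "b \<in> {1..5}" "c \<in> {1..5}" "d \<in> {1..5}" "e \<in> {1..5}" "distinct [a, b, c, d, e]"
    unfolding fields in_tuples by blast+
  have m: "perm5 t ` {1..5} \<subseteq> {1..5}"
    unfolding fields atLeastAtMost_1_5 using r(1-5) by (auto simp: atLeastAtMost_1_5)
  have i: "inj_on (perm5 t) {1..5}"
    unfolding fields atLeastAtMost_1_5 using r(6) by (auto simp: inj_on_def)
  have "perm5 t ` {1..5} = {1..5}"
    using endo_inj_surj[OF _ m i] by simp
  then have "bij_betw (perm5 t) {1..5} {1..5}"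
    using i by (simp add: bij_betw_def)
  moreover have "perm5 t i = i" if "i \<notin> {1..5}" for i
    using that unfolding fields perm5.simps atLeastAtMost_1_5 by simp
  ultimately show ?thesis
    by (intro W_I bij_imp_permutes)
qed

lemma tup_eq_iff: "v \<in> W \<Longrightarrow> w \<in> W \<Longrightarrow> tup v = tup w \<longleftrightarrow> v = w"
  by (metis perm5_tup)

lemma atLeastAtMost_cases: "k \<in> {1..4::nat} \<longleftrightarrow> k = 1 \<or> k = 2 \<or> k = 3 \<or> k = 4"
  unfolding atLeastAtMost_1_4 by simp

lemma rd_tup: "k \<in> {1..4} \<Longrightarrow> rd w k \<longleftrightarrow> rd5 (tup w) k"
  unfolding atLeastAtMost_cases by (elim disjE) (simp_all add: rd_def tup_def)

lemma len_tup: "w \<in> W \<Longrightarrow> len w = len5 (tup w)"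
  by (simp only: len_eq_ninv ninv_expand tup_def len5.simps)

lemma pos_tup:
  assumes "w \<in> W" "k \<in> {1..5}"
  shows "pos5 (tup w) k = inv w k"
proof -
  have "inv w k \<in> {1..5}" "w (inv w k) = k"
    using assms W_range[of "inv w" k] by simp_all
  then have c: "inv w k = 1 \<or> inv w k = 2 \<or> inv w k = 3 \<or> inv w k = 4 \<or> inv w k = 5"
    unfolding atLeastAtMost_1_5 by blast
  have e: "w a = k \<longleftrightarrow> a = inv w k" for a
    using inv_W_apply[OF assms(1)] by metis
  show ?thesis
    unfolding tup_def pos5.simps e using c by (elim disjE) simp_all
qed

lemma ld_tup: "w \<in> W \<Longrightarrow> k \<in> {1..4} \<Longrightarrow> ld w k \<longleftrightarrow> ld5 (tup w) k"
  using pos_tup[of w k] pos_tup[of w "Suc k"] by (simp add: ld_def rd_def ld5_def)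

lemma tup_sl: "tup (s k \<circ> w) = sl5 k (tup w)"
  by (simp add: tup_def swap_def s_apply)

lemma tup_sr: "k \<in> {1..4} \<Longrightarrow> tup (w \<circ> s k) = sr5 (tup w) k"
  unfolding atLeastAtMost_cases by (elim disjE) (simp_all add: tup_def s_apply)

lemma s_perm5: "k \<in> {1..4} \<Longrightarrow> t \<in> set tuples \<Longrightarrow> s k \<circ> perm5 t = perm5 (sl5 k t)"
  by (metis perm5_W perm5_tup s_W_iff(1) tup_perm5 tup_sl)

lemma perm5_s: "k \<in> {1..4} \<Longrightarrow> t \<in> set tuples \<Longrightarrow> perm5 t \<circ> s k = perm5 (sr5 t k)"
  by (metis perm5_W perm5_tup s_W_iff(2) tup_perm5 tup_sr)

definition mu_cand5 :: "tuple \<Rightarrow> tuple \<Rightarrow> bool" where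
  "mu_cand5 z v \<longleftrightarrow> len5 z < len5 v \<and> odd (len5 v - len5 z) \<and>
     list_all (\<lambda>t. (ld5 v t \<and> \<not> ld5 z t \<longrightarrow> v = sl5 t z) \<and> (rd5 v t \<and> \<not> rd5 z t \<longrightarrow> v = sr5 z t)) [1, 2, 3, 4]"

lemma mu_cand_tup:
  assumes "z \<in> W" "v \<in> W"
  shows "mu_cand z v \<longleftrightarrow> mu_cand5 (tup z) (tup v)"
proof -
  have s: "v = s t \<circ> z \<longleftrightarrow> tup v = sl5 t (tup z)" if "t \<in> {1..4}" for t
    using tup_eq_iff[of v "s t \<circ> z"] assms that by (simp add: tup_sl)
  have r: "v = z \<circ> s t \<longleftrightarrow> tup v = sr5 (tup z) t" if "t \<in> {1..4}" for t
    using tup_eq_iff[of v "z \<circ> s t"] assms that tup_sr[OF that, of z] by simp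
  have e: "set [1, 2, 3, 4] = {1..4::nat}"
    unfolding atLeastAtMost_1_4 by simp
  have "(ld v t \<and> \<not> ld z t \<longrightarrow> v = s t \<circ> z) \<longleftrightarrow> (ld5 (tup v) t \<and> \<not> ld5 (tup z) t \<longrightarrow> tup v = sl5 t (tup z))"
    "(rd v t \<and> \<not> rd z t \<longrightarrow> v = z \<circ> s t) \<longleftrightarrow> (rd5 (tup v) t \<and> \<not> rd5 (tup z) t \<longrightarrow> tup v = sr5 (tup z) t)"
    if "t \<in> {1..4}" for t
    unfolding s[OF that] r[OF that] ld_tup[OF assms(1) that] ld_tup[OF assms(2) that] rd_tup[OF that] by (rule refl)+
  then show ?thesis
    unfolding mu_cand_def mu_cand5_def list_all_iff e len_tup[OF assms(1)] len_tup[OF assms(2)] by blast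
qed

definition cell_edge5 :: "tuple \<Rightarrow> tuple \<Rightarrow> bool" where
  "cell_edge5 y x \<longleftrightarrow> x = y \<or> list_ex (\<lambda>i. \<not> ld5 y i \<and> ld5 x i \<and> (x = sl5 i y \<or> mu_cand5 x y)) [1, 2, 3, 4]"

lemma cell_edge_tup:
  assumes "y \<in> W" "x \<in> W" "cell_edge y x"
  shows "cell_edge5 (tup y) (tup x)"
proof -
  have e: "set [1, 2, 3, 4] = {1..4::nat}"
    unfolding atLeastAtMost_1_4 by simp
  show ?thesis
    using assms(3) unfolding cell_edge_def cell_edge5_def list_ex_iff e
    using ld_tup[OF assms(1)] ld_tup[OF assms(2)] mu_cand_tup[OF assms(2,1)] tup_sl[of _ y] by blast
qed

lemma rec_candidates:
  assumes v: "v \<in> set tuples" and i: "i \<in> {1..4}"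
    and c: "list_all (\<lambda>z. ld5 z i \<longrightarrow> mu_cand5 z v \<longrightarrow> z \<in> set L) tuples"
    and z: "z \<in> W" "ld z i" "mu z (perm5 v) \<noteq> 0"
  shows "z \<in> perm5 ` set L"
proof -
  have "tup z \<in> set L"
    using c mu_candI[OF z(1) perm5_W[OF v] z(3)] mu_cand_tup[OF z(1) perm5_W[OF v]] ld_tup[OF z(1) i] z tup_in_tuples[OF z(1)]
    by (simp add: list_all_iff)
  then show ?thesis
    using z(1) by (metis image_eqI perm5_tup)
qed


section \<open>The relevant left cells\<close>

text \<open>The four involutions with descent sets \<open>{2, 3}\<close> and \<open>{1, 4}\<close>: \<open>pa = s\<^sub>2 s\<^sub>3 s\<^sub>2\<close> and
  \<open>pc = s\<^sub>1 s\<^sub>2 s\<^sub>3 s\<^sub>4 s\<^sub>3 s\<^sub>2 s\<^sub>1\<close> are those of the theorem, \<open>pb = w\<^sub>0 pe\<close> and \<open>pa = w\<^sub>0 pc\<close>.\<close>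

abbreviation "pa \<equiv> perm5 (1, 4, 3, 2, 5)"
abbreviation "pb \<equiv> perm5 (2, 1, 3, 5, 4)"
abbreviation "pc \<equiv> perm5 (5, 2, 3, 4, 1)"
abbreviation "pe \<equiv> perm5 (4, 5, 3, 1, 2)"
abbreviation "pu \<equiv> perm5 (4, 1, 3, 5, 2)"

text \<open>A set containing the left cell of \<open>pc\<close>, as \<open>cell_e\<close> is one for
  \<open>pe\<close>. Their sizes 6 and 5 are the numbers of standard tableaux of the shapes (3,1,1)
  and (2,2,1), the Robinson-Schensted shapes of \<open>pc\<close> and \<open>pe\<close>.\<close>

definition cell_c :: "tuple list" where
  "cell_c = [(3, 2, 4, 5, 1), (4, 1, 3, 5, 2), (5, 1, 2, 4, 3), (4, 2, 3, 5, 1), (5, 1, 3, 4, 2), (5, 2, 3, 4, 1)]"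

definition cell_e :: "tuple list" where
  "cell_e = [(2, 5, 4, 1, 3), (3, 5, 2, 1, 4), (3, 5, 4, 1, 2), (4, 5, 2, 1, 3), (4, 5, 3, 1, 2)]"

definition rdset :: "tuple \<Rightarrow> bool list" where
  "rdset t = map (rd5 t) [1, 2, 3, 4]"

lemma cell_c_closed:
  "list_all (\<lambda>x. rdset x = [True, False, False, True] \<longrightarrow> list_all (\<lambda>y. cell_edge5 y x \<longrightarrow> x \<in> set cell_c) cell_c) tuples"
  by code_simp

lemma cell_e_closed:
  "list_all (\<lambda>x. rdset x = [False, True, True, False] \<longrightarrow> list_all (\<lambda>y. cell_edge5 y x \<longrightarrow> x \<in> set cell_e) cell_e) tuples"
  by code_simp

text \<open>Serves two purposes: the length bound isolates \<open>pb\<close> as the shortest element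
  with these right descents, and the condition on left descents leaves only \<open>pb\<close> and
  \<open>pc\<close> as possible members of \<open>J\<close>.\<close>

lemma rd_14: "list_all (\<lambda>x. rdset x = [True, False, False, True] \<longrightarrow>
    x = (2, 1, 3, 5, 4) \<or> (len5 x \<ge> 3 \<and> (map (ld5 x) [1, 2, 3, 4] = [True, False, False, True] \<longrightarrow> x = (5, 2, 3, 4, 1)))) tuples"
  by code_simp

lemma rd_23: "list_all (\<lambda>x. rdset x = [False, True, True, False] \<longrightarrow>
    x = (1, 4, 3, 2, 5) \<or> (len5 x \<ge> 4 \<and> (map (ld5 x) [1, 2, 3, 4] = [False, True, True, False] \<longrightarrow> x = (4, 5, 3, 1, 2)))) tuples"
  by code_simp


declare perm5.simps [simp del] in_tuples [simp] ld5_def [simp] swap_def [simp]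

lemma ld_perm5 [simp]: "t \<in> set tuples \<Longrightarrow> k \<in> {1..4} \<Longrightarrow> ld (perm5 t) k \<longleftrightarrow> ld5 t k"
  using ld_tup[OF perm5_W] by (simp only: tup_perm5)

lemma rd_perm5 [simp]: "k \<in> {1..4} \<Longrightarrow> rd (perm5 t) k \<longleftrightarrow> rd5 t k"
  using rd_tup[of k "perm5 t"] by (simp only: tup_perm5)

lemma len_perm5 [simp]: "t \<in> set tuples \<Longrightarrow> len (perm5 t) = len5 t"
  using len_tup[OF perm5_W] by (simp only: tup_perm5)

lemma id_perm5: "id = perm5 (1, 2, 3, 4, 5)"
  using perm5_tup[OF id_W] by (simp add: tup_def)

section \<open>Kazhdan-Lusztig polynomials of the four involutions\<close>

lemma perm5_inj: "perm5 t = perm5 t' \<longleftrightarrow> t = t'"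
  by (metis tup_perm5)

text \<open>Applied with a path leading to \<open>v\<close> itself, which yields the polynomial 1,
  or to a longer element below \<open>v\<close>, for which the degree bound is sharper.\<close>

lemma KL_left_path:
  assumes "v \<in> set tuples" "t \<in> set tuples" "list_all (\<lambda>k. k \<in> {1..4} \<and> ld5 v k) ks"
  shows "KL (perm5 (foldr sl5 ks t)) (perm5 v) = KL (perm5 t) (perm5 v) \<and> foldr sl5 ks t \<in> set tuples"
  using assms(3)
proof (induction ks)
  case (Cons k ks)
  define r where "r = foldr sl5 ks t"
  have k: "k \<in> {1..4}" "ld5 v k" and r: "KL (perm5 r) (perm5 v) = KL (perm5 t) (perm5 v)" "r \<in> set tuples"
    using Cons by (auto simp: r_def)
  have e: "s k \<circ> perm5 r = perm5 (sl5 k r)"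
    using s_perm5[OF k(1) r(2)] .
  have "KL (s k \<circ> perm5 r) (perm5 v) = KL (perm5 r) (perm5 v)"
    using assms(1) k r(2) by (intro KL_left_invariant perm5_W) (auto simp del: ld5_def)
  moreover have "sl5 k r \<in> set tuples"
  proof -
    have "s k \<circ> perm5 r \<in> W"
      using k(1) r(2) by (intro comp_W s_W perm5_W)
    from tup_in_tuples[OF this] show ?thesis
      unfolding e tup_perm5 .
  qed
  ultimately show ?case
    using r unfolding e by (simp add: r_def del: in_tuples)
qed (use assms in simp)

lemma KL_right_path:
  assumes "v \<in> set tuples" "t \<in> set tuples" "list_all (\<lambda>k. k \<in> {1..4} \<and> rd5 v k) ks"
  shows "KL (perm5 (foldl sr5 t ks)) (perm5 v) = KL (perm5 t) (perm5 v)"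
  using assms(2,3)
proof (induction ks arbitrary: t)
  case (Cons k ks)
  have k: "k \<in> {1..4}" "rd5 v k" "list_all (\<lambda>k. k \<in> {1..4} \<and> rd5 v k) ks"
    using Cons.prems by auto
  have e: "perm5 t \<circ> s k = perm5 (sr5 t k)"
    using perm5_s[OF k(1) Cons.prems(1)] .
  have "KL (perm5 t \<circ> s k) (perm5 v) = KL (perm5 t) (perm5 v)"
    using assms(1) k Cons.prems by (intro KL_right_invariant perm5_W) auto
  moreover have "sr5 t k \<in> set tuples"
  proof -
    have "perm5 t \<circ> s k \<in> W"
      using k(1) Cons.prems(1) by (intro comp_W s_W perm5_W)
    from tup_in_tuples[OF this] show ?thesis
      unfolding e tup_perm5 .
  qed
  ultimately show ?case
    using Cons.IH[of "sr5 t k"] k(3) unfolding e by (simp del: in_tuples)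
qed simp

text \<open>\<open>pa\<close> is the longest element of the subgroup generated by \<open>s 2\<close>
  and \<open>s 3\<close>, reached from the identity through right descents of
  \<open>v\<close>.\<close>

lemma KL_id_rd_23:
  assumes "v \<in> set tuples" "rd5 v 2" "rd5 v 3"
  shows "KL id (perm5 v) = KL pa (perm5 v)"
  using KL_right_path[OF assms(1), of "(1, 2, 3, 4, 5)" "[2, 3, 2]"] assms by (simp add: id_perm5)

lemma KL_id_rd_14:
  assumes "v \<in> set tuples" "rd5 v 1" "rd5 v 4"
  shows "KL id (perm5 v) = KL pb (perm5 v)"
  using KL_right_path[OF assms(1), of "(1, 2, 3, 4, 5)" "[1, 4]"] assms by (simp add: id_perm5)

lemma KL_rec5:
  assumes v: "v \<in> set tuples" and i: "i \<in> {1..4}" and nd: "\<not> ld5 v i"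
    and Z: "filter (\<lambda>z. ld5 z i \<and> mu_cand5 z v) tuples = L" and y: "y \<in> set tuples"
  shows "KL (perm5 y) (perm5 (sl5 i v)) =
    (if ld5 y i then KL (perm5 (sl5 i y)) (perm5 v) + monom 1 1 * KL (perm5 y) (perm5 v)
      else monom 1 1 * KL (perm5 (sl5 i y)) (perm5 v) + KL (perm5 y) (perm5 v))
    - (\<Sum>z\<in>set L. Polynomial.smult (mu (perm5 z) (perm5 v)) (monom 1 ((Suc (len5 v) - len5 z) div 2) * KL (perm5 y) (perm5 z)))"
    and "C' (perm5 (sl5 i v)) w = C' (perm5 v) w + C' (perm5 v) (s i \<circ> w)
        - (\<Sum>z\<in>set L. mu (perm5 z) (perm5 v) * C' (perm5 z) w)"
proof -
  have L: "z \<in> set tuples" "ld5 z i" if "z \<in> set L" for z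
    using that unfolding Z[symmetric] by auto
  have c: "list_all (\<lambda>z. ld5 z i \<longrightarrow> mu_cand5 z v \<longrightarrow> z \<in> set L) tuples"
    unfolding Z[symmetric] by (simp add: list_all_iff del: in_tuples)
  have sv: "perm5 (sl5 i v) = s i \<circ> perm5 v" and sy: "perm5 (sl5 i y) = s i \<circ> perm5 y"
    using s_perm5 i v y by metis+
  have nd': "\<not> ld (perm5 v) i"
    using nd v i by (simp del: in_tuples ld5_def)
  have Z1: "finite (perm5 ` set L)" "\<And>z. z \<in> W \<Longrightarrow> ld z i \<Longrightarrow> mu z (perm5 v) \<noteq> 0 \<Longrightarrow> z \<in> perm5 ` set L"
    "\<And>z. z \<in> perm5 ` set L \<Longrightarrow> z \<in> W \<and> ld z i"
    using rec_candidates[OF v i c] L perm5_W i by (auto simp del: in_tuples ld5_def)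
  have inj: "inj_on perm5 (set L)"
    by (auto simp: inj_on_def perm5_inj)
  show "KL (perm5 y) (perm5 (sl5 i v)) =
    (if ld5 y i then KL (perm5 (sl5 i y)) (perm5 v) + monom 1 1 * KL (perm5 y) (perm5 v)
      else monom 1 1 * KL (perm5 (sl5 i y)) (perm5 v) + KL (perm5 y) (perm5 v))
    - (\<Sum>z\<in>set L. Polynomial.smult (mu (perm5 z) (perm5 v)) (monom 1 ((Suc (len5 v) - len5 z) div 2) * KL (perm5 y) (perm5 z)))"
    using KL_rec_superset[OF perm5_W[OF v] i nd' Z1, where y = "perm5 y"] y i v L
    unfolding sv sy by (simp add: sum.reindex[OF inj] del: in_tuples ld5_def)
  show "C' (perm5 (sl5 i v)) w = C' (perm5 v) w + C' (perm5 v) (s i \<circ> w)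
        - (\<Sum>z\<in>set L. mu (perm5 z) (perm5 v) * C' (perm5 z) w)"
    using C'_rec[OF perm5_W[OF v] i nd' Z1, where y = w] unfolding sv by (simp add: sum.reindex[OF inj])
qed

lemma mu_sl5: "t \<in> set tuples \<Longrightarrow> k \<in> {1..4} \<Longrightarrow> \<not> ld5 t k \<Longrightarrow> mu (perm5 t) (perm5 (sl5 k t)) = 1"
  using mu_s_left[of "perm5 t" k] perm5_W[of t] s_perm5[of k t] by (simp del: in_tuples ld5_def)

text \<open>The possible correction terms in the recursion steps used below, found by exhaustive
  search; the values of mu at them are determined separately.\<close>

lemma rec_42351: "filter (\<lambda>z. ld5 z 4 \<and> mu_cand5 z (4, 2, 3, 5, 1)) tuples = []"
  and rec_41352: "filter (\<lambda>z. ld5 z 1 \<and> mu_cand5 z (4, 1, 3, 5, 2)) tuples = []"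
  and rec_41253: "filter (\<lambda>z. ld5 z 2 \<and> mu_cand5 z (4, 1, 2, 5, 3)) tuples = [(3, 1, 2, 5, 4)]"
  and rec_31254: "filter (\<lambda>z. ld5 z 3 \<and> mu_cand5 z (3, 1, 2, 5, 4)) tuples = []"
  and rec_21354: "filter (\<lambda>z. ld5 z 2 \<and> mu_cand5 z (2, 1, 3, 5, 4)) tuples = []"
  and rec_45213: "set (filter (\<lambda>z. ld5 z 2 \<and> mu_cand5 z (4, 5, 2, 1, 3)) tuples) = {(3, 5, 2, 1, 4), (4, 3, 2, 1, 5)}"
  and rec_35214: "filter (\<lambda>z. ld5 z 3 \<and> mu_cand5 z (3, 5, 2, 1, 4)) tuples = []"
  and rec_25314: "filter (\<lambda>z. ld5 z 2 \<and> mu_cand5 z (2, 5, 3, 1, 4)) tuples = [(1, 5, 3, 2, 4)]"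
  and rec_15324: "filter (\<lambda>z. ld5 z 1 \<and> mu_cand5 z (1, 5, 3, 2, 4)) tuples = []"
  and rec_14325: "filter (\<lambda>z. ld5 z 4 \<and> mu_cand5 z (1, 4, 3, 2, 5)) tuples = []"
    "filter (\<lambda>z. ld5 z 1 \<and> mu_cand5 z (1, 4, 3, 2, 5)) tuples = []"
  and rec_24315: "filter (\<lambda>z. ld5 z 2 \<and> mu_cand5 z (2, 4, 3, 1, 5)) tuples = [(1, 4, 3, 2, 5)]"
  and rec_34215: "filter (\<lambda>z. ld5 z 3 \<and> mu_cand5 z (3, 4, 2, 1, 5)) tuples = [(2, 4, 3, 1, 5)]"
  and rec_12345: "filter (\<lambda>z. ld5 z 2 \<and> mu_cand5 z (1, 2, 3, 4, 5)) tuples = []"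
     "filter (\<lambda>z. ld5 z 4 \<and> mu_cand5 z (1, 2, 3, 4, 5)) tuples = []"
  and rec_13245: "filter (\<lambda>z. ld5 z 3 \<and> mu_cand5 z (1, 3, 2, 4, 5)) tuples = []"
  and rec_14235: "filter (\<lambda>z. ld5 z 2 \<and> mu_cand5 z (1, 4, 2, 3, 5)) tuples = [(1, 3, 2, 4, 5)]"
  and rec_12354: "filter (\<lambda>z. ld5 z 1 \<and> mu_cand5 z (1, 2, 3, 5, 4)) tuples = []"
  by code_simp+

text \<open>\<open>pc\<close> arises from \<open>pu\<close> by left multiplication with
  \<open>s 1\<close> and then \<open>s 4\<close>. Neither step has a correction term and each
  contributes a factor \<open>1 + q\<close>.\<close>

lemma KL_pb_pc: "KL pb pc = 1 + 2 * monom 1 1 + monom 1 2"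
proof -
  let ?v = "(4, 2, 3, 5, 1)" and ?u = "(4, 1, 3, 5, 2)"
  have u: "KL pb (perm5 ?u) = 1"
    using KL_left_path[of ?u "(2, 1, 3, 5, 4)" "[2, 3, 2]"] perm5_W[of ?u] by simp
  have u': "KL (perm5 (1, 2, 3, 5, 4)) (perm5 ?u) = 1"
    using KL_right_path[of ?u "(1, 2, 3, 5, 4)" "[1]"] u by simp
  have v: "KL pb (perm5 ?v) = 1 + monom 1 1"
    using KL_rec5(1)[OF _ _ _ rec_41352, of "(2, 1, 3, 5, 4)"] u u' by simp
  have v': "KL (perm5 (2, 1, 3, 4, 5)) (perm5 ?v) = 1 + monom 1 1"
    using KL_right_path[of ?v "(2, 1, 3, 4, 5)" "[4]"] v by simp
  show ?thesis
    using KL_rec5(1)[OF _ _ _ rec_42351, of "(2, 1, 3, 5, 4)"] v v'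
    by (simp add: distrib_left mult_monom)
qed

text \<open>The lengths differ by one, but the two elements are not related by a simple reflection
  on either side: the exchanged values 3 and 5 are not neighbours, nor are their positions. The
  value therefore comes from the recursion.\<close>

lemma mu_43215: "mu (perm5 (4, 3, 2, 1, 5)) (perm5 (4, 5, 2, 1, 3)) = 1"
proof -
  have "KL (perm5 (2, 4, 3, 1, 5)) (perm5 (2, 5, 3, 1, 4)) = 1"
    using KL_left_path[of "(2, 5, 3, 1, 4)" "(2, 4, 3, 1, 5)" "[4]"] perm5_W[of "(2, 5, 3, 1, 4)"] by simp
  then have "KL (perm5 (3, 4, 2, 1, 5)) (perm5 (3, 5, 2, 1, 4)) = 1"
    using KL_rec5(1)[OF _ _ _ rec_25314, of "(3, 4, 2, 1, 5)"] perm5_W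
      KL_eq_0_len[of "perm5 (2, 5, 3, 1, 4)" "perm5 (3, 4, 2, 1, 5)"]
      KL_eq_0_len[of "perm5 (1, 5, 3, 2, 4)" "perm5 (3, 4, 2, 1, 5)"] by (simp add: perm5_inj)
  then have "KL (perm5 (4, 3, 2, 1, 5)) (perm5 (4, 5, 2, 1, 3)) = 1"
    using KL_rec5(1)[OF _ _ _ rec_35214, of "(4, 3, 2, 1, 5)"] perm5_W
      KL_eq_0_len[of "perm5 (3, 5, 2, 1, 4)" "perm5 (4, 3, 2, 1, 5)"] by (simp add: perm5_inj)
  then show ?thesis
    by (simp add: mu_def)
qed

text \<open>The two recursion steps give \<open>(1 + q)^2\<close>, and the last one has two
  correction terms, each equal to \<open>q\<close>.\<close>

lemma KL_pa_pe: "KL pa pe = 1 + monom 1 2"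
proof -
  let ?v = "(4, 5, 2, 1, 3)" and ?r = "(3, 5, 2, 1, 4)"
  have r: "KL pa (perm5 ?r) = 1"
    using KL_left_path[of ?r "(1, 4, 3, 2, 5)" "[2, 1, 4]"] perm5_W[of ?r] by simp
  have r': "KL (perm5 (1, 3, 4, 2, 5)) (perm5 ?r) = 1"
    using KL_right_path[of ?r "(1, 3, 4, 2, 5)" "[2]"] r by simp
  have v: "KL pa (perm5 ?v) = 1 + monom 1 1"
    using KL_rec5(1)[OF _ _ _ rec_35214, of "(1, 4, 3, 2, 5)"] r r' by simp
  have v': "KL (perm5 (1, 4, 2, 3, 5)) (perm5 ?v) = 1 + monom 1 1"
    using KL_right_path[of ?v "(1, 4, 2, 3, 5)" "[3]"] v by simp
  have m: "KL pa (perm5 (4, 3, 2, 1, 5)) = 1"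
    using KL_left_path[of "(4, 3, 2, 1, 5)" "(1, 4, 3, 2, 5)" "[3, 2, 1]"] perm5_W[of "(4, 3, 2, 1, 5)"] by simp
  have mu: "mu (perm5 ?r) (perm5 ?v) = 1"
    using mu_sl5[of ?r 3] by simp
  show ?thesis
    using KL_rec5(1)[OF _ _ _ refl, of ?v 2 "(1, 4, 3, 2, 5)"] v v' m r mu mu_43215 unfolding rec_45213
    by (simp add: distrib_left mult_monom)
qed

text \<open>The degree bound at \<open>z\<close>, in place of the identity, leaves at least
  \<open>len z + 1\<close>. So the longer the \<open>z\<close> with the same polynomial, the better
  the bound.\<close>

lemma duflo_fn_bound:
  assumes "x \<in> W" "KL id x = KL z x" "z \<noteq> x" "len z < len x"
  shows "duflo_fn x > int (len z)"
proof (cases "bruhat z x")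
  case True
  then have "2 * degree (KL z x) + 1 \<le> len x - len z"
    using KL_degree assms by blast
  then show ?thesis
    unfolding duflo_fn_def assms(2) using assms(4) by linarith
next
  case False
  then show ?thesis
    unfolding duflo_fn_def assms(2) using assms KL_not_bruhat by simp
qed

lemma rdset_left_cell:
  assumes "x \<in> left_cell (perm5 t)"
  shows "x \<in> W" "rdset (tup x) = rdset t" "tup x \<in> set tuples" "perm5 (tup x) = x"
proof -
  show x: "x \<in> W"
    using assms by (simp add: left_cell_def)
  have "rd5 (tup x) k \<longleftrightarrow> rd5 t k" if "k \<in> {1..4}" for k
    using left_cell_rd[OF assms that] that by (simp add: rd_tup[of k x, symmetric])
  then show "rdset (tup x) = rdset t"
    unfolding rdset_def by simp
  show "tup x \<in> set tuples" "perm5 (tup x) = x"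
    using x tup_in_tuples perm5_tup by blast+
qed

text \<open>Knowledge of the cell beyond its right descents is avoided: \<open>duflo_fn pa\<close>
  equals \<open>len pa\<close>, and the bound with \<open>z = pa\<close> puts every other element
  with these right descents above it.\<close>

lemma duflo_pa: "duflo pa = pa"
proof (rule duflo_eqI)
  fix x assume x: "x \<in> left_cell pa" "x \<noteq> pa"
  note c = rdset_left_cell[OF x(1)]
  have r: "rd5 (tup x) 2" "rd5 (tup x) 3" "rdset (tup x) = [False, True, True, False]"
    using c(2) by (simp_all add: rdset_def)
  have "tup x \<noteq> (1, 4, 3, 2, 5)"
    using x(2) c(4) by metis
  then have "len5 (tup x) \<ge> 4"
    using rd_23 c(3) r(3) unfolding list_all_iff by blast
  then have "len x > 3"
    using len_tup[OF c(1)] by simp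
  moreover have "KL id x = KL pa x"
    using KL_id_rd_23[OF c(3) r(1,2)] unfolding c(4) .
  ultimately have "duflo_fn x > int (len pa)"
    using c(1) x(2) by (intro duflo_fn_bound) auto
  moreover have "KL id pa = KL pa pa"
    using KL_id_rd_23[of "(1, 4, 3, 2, 5)"] by simp
  ultimately show "duflo_fn pa < duflo_fn x"
    using perm5_W[of "(1, 4, 3, 2, 5)"] by (simp add: duflo_fn_def)
qed (simp add: perm5_W)

lemma duflo_pb: "duflo pb = pb"
proof (rule duflo_eqI)
  fix x assume x: "x \<in> left_cell pb" "x \<noteq> pb"
  note c = rdset_left_cell[OF x(1)]
  have r: "rd5 (tup x) 1" "rd5 (tup x) 4" "rdset (tup x) = [True, False, False, True]"
    using c(2) by (simp_all add: rdset_def)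
  have "tup x \<noteq> (2, 1, 3, 5, 4)"
    using x(2) c(4) by metis
  then have "len5 (tup x) \<ge> 3"
    using rd_14 c(3) r(3) unfolding list_all_iff by blast
  then have "len x > 2"
    using len_tup[OF c(1)] by simp
  moreover have "KL id x = KL pb x"
    using KL_id_rd_14[OF c(3) r(1,2)] unfolding c(4) .
  ultimately have "duflo_fn x > int (len pb)"
    using c(1) x(2) by (intro duflo_fn_bound) auto
  moreover have "KL id pb = KL pb pb"
    using KL_id_rd_14[of "(2, 1, 3, 5, 4)"] by simp
  ultimately show "duflo_fn pb < duflo_fn x"
    using perm5_W[of "(2, 1, 3, 5, 4)"] by (simp add: duflo_fn_def)
qed (simp add: perm5_W)

lemma left_cell_tuples:
  assumes t: "t \<in> set G" "set G \<subseteq> set tuples"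
    and c: "list_all (\<lambda>x. rdset x = rdset t \<longrightarrow> list_all (\<lambda>y. cell_edge5 y x \<longrightarrow> x \<in> set G) G) tuples"
    and x: "x \<in> left_cell (perm5 t)"
  shows "tup x \<in> set G"
proof -
  have "x \<in> perm5 ` set G"
  proof (rule left_cell_subset[OF _ _ _ x])
    show "perm5 ` set G \<subseteq> W"
      using t(2) perm5_W by blast
    fix y z assume y: "y \<in> perm5 ` set G" and z: "z \<in> W" "\<forall>k\<in>{1..4}. rd z k \<longleftrightarrow> rd (perm5 t) k" "cell_edge y z"
    have "y \<in> W"
      using y t(2) perm5_W by blast
    then have "cell_edge5 (tup y) (tup z)"
      using cell_edge_tup z by blast
    moreover have "tup y \<in> set G"
      using y by auto
    moreover have "rdset (tup z) = rdset t"
      using z(2) unfolding rdset_def by (simp add: rd_tup[symmetric, of _ z])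
    ultimately have "tup z \<in> set G"
      using c tup_in_tuples[OF z(1)] unfolding list_all_iff by blast
    then show "z \<in> perm5 ` set G"
      using z(1) by (metis image_eqI perm5_tup)
  qed (use t in blast)
  then show ?thesis by auto
qed

text \<open>\<open>pa\<close> has the same right descents and the smaller value 3, so here the
  enclosing set \<open>cell_e\<close> is essential to keep it out. The competitors must exceed
  \<open>duflo_fn pe = 8 - 2 * 2\<close>.\<close>

lemma duflo_pe: "duflo pe = pe"
proof (rule duflo_eqI)
  fix x assume x: "x \<in> left_cell pe" "x \<noteq> pe"
  note c = rdset_left_cell[OF x(1)]
  have "tup x \<in> set cell_e"
    by (rule left_cell_tuples[OF _ _ _ x(1)]) (use cell_e_closed in \<open>simp_all add: rdset_def cell_e_def\<close>)
  then consider "tup x = (2, 5, 4, 1, 3)" | "tup x = (3, 5, 2, 1, 4)" | "tup x = (3, 5, 4, 1, 2)"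
    | "tup x = (4, 5, 2, 1, 3)" | "tup x = (4, 5, 3, 1, 2)"
    unfolding cell_e_def by auto
  then have "duflo_fn x > 4"
  proof cases
    case 1
    have "KL id (perm5 (2, 5, 4, 1, 3)) = 1"
      using KL_id_rd_23[of "(2, 5, 4, 1, 3)"] KL_left_path[of "(2, 5, 4, 1, 3)" "(1, 4, 3, 2, 5)" "[3, 1, 4]"]
        perm5_W[of "(2, 5, 4, 1, 3)"] by simp
    then have "duflo_fn (perm5 (2, 5, 4, 1, 3)) > 4"
      by (simp add: duflo_fn_def)
    then show ?thesis using 1 c(4) by simp
  next
    case 2
    have "KL id (perm5 (3, 5, 2, 1, 4)) = 1"
      using KL_id_rd_23[of "(3, 5, 2, 1, 4)"] KL_left_path[of "(3, 5, 2, 1, 4)" "(1, 4, 3, 2, 5)" "[2, 1, 4]"]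
        perm5_W[of "(3, 5, 2, 1, 4)"] by simp
    then have "duflo_fn (perm5 (3, 5, 2, 1, 4)) > 4"
      by (simp add: duflo_fn_def)
    then show ?thesis using 2 c(4) by simp
  next
    case 3
    have "duflo_fn (perm5 (3, 5, 4, 1, 2)) > int (len pa)"
      using KL_id_rd_23[of "(3, 5, 4, 1, 2)"] by (intro duflo_fn_bound) (auto simp: perm5_W perm5_inj)
    \<comment> \<open>The bound gives more than 3; the length 7 makes the value odd, which excludes
      4.\<close>
    then have "duflo_fn (perm5 (3, 5, 4, 1, 2)) > 4"
      unfolding duflo_fn_def by simp
    then show ?thesis using 3 c(4) by simp
  next
    case 4
    have "duflo_fn (perm5 (4, 5, 2, 1, 3)) > int (len pa)"
      using KL_id_rd_23[of "(4, 5, 2, 1, 3)"] by (intro duflo_fn_bound) (auto simp: perm5_W perm5_inj)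
    then have "duflo_fn (perm5 (4, 5, 2, 1, 3)) > 4"
      unfolding duflo_fn_def by simp
    then show ?thesis using 4 c(4) by simp
  qed (use x(2) c(4) in simp)
  moreover have "duflo_fn pe = 4"
  proof -
    have "degree (1 + monom 1 2 :: int poly) = 2"
      by (subst degree_add_eq_right) (simp_all add: degree_monom_eq)
    then show ?thesis
      using KL_id_rd_23[of "(4, 5, 3, 1, 2)"] KL_pa_pe by (simp add: duflo_fn_def)
  qed
  ultimately show "duflo_fn pe < duflo_fn x" by simp
qed (simp add: perm5_W)

text \<open>As for \<open>pe\<close>: \<open>pb\<close> has the same right descents and the smaller
  value 2, and \<open>cell_c\<close> keeps it out. The value to exceed is 7 - 2 * 2 = 3.\<close>

lemma duflo_pc: "duflo pc = pc"
proof (rule duflo_eqI)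
  fix x assume x: "x \<in> left_cell pc" "x \<noteq> pc"
  note c = rdset_left_cell[OF x(1)]
  have "tup x \<in> set cell_c"
    by (rule left_cell_tuples[OF _ _ _ x(1)]) (use cell_c_closed in \<open>simp_all add: rdset_def cell_c_def\<close>)
  then consider "tup x = (3, 2, 4, 5, 1)" | "tup x = (4, 1, 3, 5, 2)" | "tup x = (5, 1, 2, 4, 3)"
    | "tup x = (4, 2, 3, 5, 1)" | "tup x = (5, 1, 3, 4, 2)" | "tup x = (5, 2, 3, 4, 1)"
    unfolding cell_c_def by auto
  then have "duflo_fn x > 3"
  proof cases
    case 1
    \<comment> \<open>With \<open>z = pb\<close> the bound would still allow the value 3. Two left
      descents lead to an element of length 4 with the same polynomial.\<close>
    have "KL id (perm5 (3, 2, 4, 5, 1)) = KL (perm5 (3, 2, 1, 5, 4)) (perm5 (3, 2, 4, 5, 1))"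
      using KL_id_rd_14[of "(3, 2, 4, 5, 1)"] KL_left_path[of "(3, 2, 4, 5, 1)" "(2, 1, 3, 5, 4)" "[1, 2]"] by simp
    then have "duflo_fn (perm5 (3, 2, 4, 5, 1)) > int (len (perm5 (3, 2, 1, 5, 4)))"
      by (intro duflo_fn_bound) (auto simp: perm5_W perm5_inj)
    then show ?thesis using 1 c(4) by simp
  next
    case 2
    have "KL id (perm5 (4, 1, 3, 5, 2)) = 1"
      using KL_id_rd_14[of "(4, 1, 3, 5, 2)"] KL_left_path[of "(4, 1, 3, 5, 2)" "(2, 1, 3, 5, 4)" "[2, 3, 2]"]
        perm5_W[of "(4, 1, 3, 5, 2)"] by simp
    then have "duflo_fn (perm5 (4, 1, 3, 5, 2)) > 3"
      by (simp add: duflo_fn_def)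
    then show ?thesis using 2 c(4) by simp
  next
    case 3
    have "KL id (perm5 (5, 1, 2, 4, 3)) = KL (perm5 (2, 1, 5, 4, 3)) (perm5 (5, 1, 2, 4, 3))"
      using KL_id_rd_14[of "(5, 1, 2, 4, 3)"] KL_left_path[of "(5, 1, 2, 4, 3)" "(2, 1, 3, 5, 4)" "[4, 3]"] by simp
    then have "duflo_fn (perm5 (5, 1, 2, 4, 3)) > int (len (perm5 (2, 1, 5, 4, 3)))"
      by (intro duflo_fn_bound) (auto simp: perm5_W perm5_inj)
    then show ?thesis using 3 c(4) by simp
  next
    case 4
    have "duflo_fn (perm5 (4, 2, 3, 5, 1)) > int (len pb)"
      using KL_id_rd_14[of "(4, 2, 3, 5, 1)"] by (intro duflo_fn_bound) (auto simp: perm5_W perm5_inj)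
    then have "duflo_fn (perm5 (4, 2, 3, 5, 1)) > 3"
      unfolding duflo_fn_def by simp
    then show ?thesis using 4 c(4) by simp
  next
    case 5
    have "duflo_fn (perm5 (5, 1, 3, 4, 2)) > int (len pb)"
      using KL_id_rd_14[of "(5, 1, 3, 4, 2)"] by (intro duflo_fn_bound) (auto simp: perm5_W perm5_inj)
    then have "duflo_fn (perm5 (5, 1, 3, 4, 2)) > 3"
      unfolding duflo_fn_def by simp
    then show ?thesis using 5 c(4) by simp
  qed (use x(2) c(4) in simp)
  moreover have "duflo_fn pc = 3"
  proof -
    have "degree (1 + 2 * monom 1 1 + monom 1 2 :: int poly) = 2"
    proof -
      have "2 * monom 1 1 = (monom 2 1 :: int poly)"
        by (metis add_monom mult_2 one_add_one)
      then show ?thesis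
        by (subst degree_add_eq_right) (auto intro!: degree_add_less simp: degree_monom_eq)
    qed
    then show ?thesis
      using KL_id_rd_14[of "(5, 2, 3, 4, 1)"] KL_pb_pc by (simp add: duflo_fn_def)
  qed
  ultimately show "duflo_fn pc < duflo_fn x" by simp
qed (simp add: perm5_W)

lemma J_rd_14:
  assumes "w \<in> J" "\<And>k. k \<in> {1..4} \<Longrightarrow> ld w k \<longleftrightarrow> k = 1 \<or> k = 4"
  shows "w = pb \<or> w = pc"
proof -
  have w: "w \<in> W"
    using J_descents(1)[OF assms(1), of 1] by simp
  have r: "ld5 (tup w) k \<longleftrightarrow> k = 1 \<or> k = 4" "rd5 (tup w) k \<longleftrightarrow> k = 1 \<or> k = 4" if "k \<in> {1..4}" for k
    unfolding ld_tup[OF w that, symmetric] rd_tup[OF that, symmetric]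
    using J_descents(2)[OF assms(1) that] assms(2)[OF that] by simp_all
  have "rdset (tup w) = [True, False, False, True]" "map (ld5 (tup w)) [1, 2, 3, 4] = [True, False, False, True]"
    unfolding rdset_def by (simp_all add: r del: ld5_def)
  then have "tup w = (2, 1, 3, 5, 4) \<or> tup w = (5, 2, 3, 4, 1)"
    using bspec[OF rd_14[unfolded list_all_iff] tup_in_tuples[OF w]] by metis
  then have "perm5 (tup w) = pb \<or> perm5 (tup w) = pc"
    by metis
  then show ?thesis
    unfolding perm5_tup[OF w] .
qed

lemma J_rd_23:
  assumes "w \<in> J" "\<And>k. k \<in> {1..4} \<Longrightarrow> ld w k \<longleftrightarrow> k = 2 \<or> k = 3"
  shows "w = pa \<or> w = pe"
proof -
  have w: "w \<in> W"
    using J_descents(1)[OF assms(1), of 1] by simp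
  have r: "ld5 (tup w) k \<longleftrightarrow> k = 2 \<or> k = 3" "rd5 (tup w) k \<longleftrightarrow> k = 2 \<or> k = 3" if "k \<in> {1..4}" for k
    unfolding ld_tup[OF w that, symmetric] rd_tup[OF that, symmetric]
    using J_descents(2)[OF assms(1) that] assms(2)[OF that] by simp_all
  have "rdset (tup w) = [False, True, True, False]" "map (ld5 (tup w)) [1, 2, 3, 4] = [False, True, True, False]"
    unfolding rdset_def by (simp_all add: r del: ld5_def)
  then have "tup w = (1, 4, 3, 2, 5) \<or> tup w = (4, 5, 3, 1, 2)"
    using bspec[OF rd_23[unfolded list_all_iff] tup_in_tuples[OF w]] by metis
  then have "perm5 (tup w) = pa \<or> perm5 (tup w) = pe"
    by metis
  then show ?thesis
    unfolding perm5_tup[OF w] .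
qed

section \<open>The group ring of the weight lattice\<close>

text \<open>The lexicographic order makes the weight lattice an ordered group, and the group ring of
  an ordered group over the integers is an integral domain. Cancellation in \<open>ZT\<close> rests
  on this.\<close>

instance prod :: (ordered_cancel_ab_semigroup_add, ordered_ab_semigroup_add) ordered_ab_semigroup_add
proof intro_classes
  fix a b c :: "'a \<times> 'b"
  assume "a \<le> b"
  then have "fst a < fst b \<or> fst a \<le> fst b \<and> snd a \<le> snd b"
    unfolding less_eq_prod_def .
  then have "fst c + fst a < fst c + fst b \<or> fst c + fst a \<le> fst c + fst b \<and> snd c + snd a \<le> snd c + snd b"
    using add_strict_left_mono[of "fst a" "fst b" "fst c"] add_left_mono[of "fst a" "fst b" "fst c"] add_left_mono[of "snd a" "snd b" "snd c"] by metis
  then show "c + a \<le> c + b"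
    unfolding less_eq_prod_def fst_add snd_add .
qed

instance prod :: (ordered_cancel_comm_monoid_add, ordered_cancel_comm_monoid_add) ordered_cancel_comm_monoid_add ..

lemma ex_mult: "ex \<mu> * ex \<nu> = ex (\<mu> + \<nu>)"
  by (simp add: ex_def mult_single)

lemma ex_0 [simp]: "ex 0 = 1"
  by (simp add: ex_def)

lemma ex_inj [simp]: "ex \<mu> = ex \<nu> \<longleftrightarrow> \<mu> = \<nu>"
  by (metis ex_def lookup_single_eq lookup_single_not_eq zero_neq_one)

lemma ex_power: "ex \<mu> ^ n = ex (\<Sum>i<n. \<mu>)"
  by (induction n) (simp_all add: ex_mult add.commute)

lemma single_ex: "Poly_Mapping.single \<mu> c = of_int c * ex \<mu>"
  by (simp add: ex_def mult_single flip: single_of_int)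

lemma ZT_sum_ex: "f = (\<Sum>\<mu>\<in>Poly_Mapping.keys f. of_int (Poly_Mapping.lookup f \<mu>) * ex \<mu>)"
  using poly_mapping_sum_singles[of f] by (simp add: single_ex)

lemma ZT_induct [case_names zero ex add scale]:
  assumes "Q 0" "\<And>\<mu>. Q (ex \<mu>)" "\<And>f g. Q f \<Longrightarrow> Q g \<Longrightarrow> Q (f + g)" "\<And>c f. Q f \<Longrightarrow> Q (of_int c * f)"
  shows "Q (f :: ZT)"
  by (induction f rule: poly_mapping_induct) (use assms in \<open>auto simp: single_ex\<close>)

lemma eps_wt: "j \<in> {1..5} \<Longrightarrow> eps (wt e) j = e j - e 5"
  unfolding atLeastAtMost_1_5 by (elim insertE emptyE) (simp_all add: wt_def)

lemma wt_eps [simp]: "wt (eps \<mu>) = \<mu>"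
  by (cases \<mu>) (simp add: wt_def)

lemma eps_add: "eps (\<mu> + \<nu>) j = eps \<mu> j + eps \<nu> j"
  by (cases \<mu>; cases \<nu>) simp

lemma eps_0 [simp]: "eps 0 j = 0"
  by (simp add: zero_prod_def)

lemma eps_uminus: "eps (- \<mu>) j = - eps \<mu> j"
  by (cases \<mu>) simp

lemma wt_add: "wt (\<lambda>j. e j + f j) = wt e + wt f"
  by (simp add: wt_def)

lemma act_wt_add: "act_wt w (\<mu> + \<nu>) = act_wt w \<mu> + act_wt w \<nu>"
  unfolding act_wt_def o_def eps_add wt_add ..

lemma act_wt_0 [simp]: "act_wt w 0 = 0"
  using act_wt_add[of w 0 0] by simp

lemma act_wt_id [simp]: "act_wt id \<mu> = \<mu>"
  unfolding act_wt_def inv_id comp_id wt_eps ..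

lemma act_wt_uminus: "act_wt w (- \<mu>) = - act_wt w \<mu>"
  using act_wt_add[of w \<mu> "- \<mu>"] by (simp add: eq_neg_iff_add_eq_0 add.commute)

lemma eps_act_wt:
  assumes "w \<in> W" "j \<in> {1..5}"
  shows "eps (act_wt w \<mu>) j = eps \<mu> (inv w j) - eps \<mu> (inv w 5)"
  unfolding act_wt_def eps_wt[OF assms(2)] by simp

lemma act_wt_comp:
  assumes "v \<in> W" "w \<in> W"
  shows "act_wt (v \<circ> w) \<mu> = act_wt v (act_wt w \<mu>)"
proof -
  have r: "inv v j \<in> {1..5}" if "j \<in> {1..5}" for j
    using W_range[of "inv v" j] assms that by simp
  have e: "eps (act_wt w \<mu>) (inv v j) = eps \<mu> (inv w (inv v j)) - eps \<mu> (inv w 5)" if "j \<in> {1..5}" for j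
    using eps_act_wt[OF assms(2) r[OF that]] .
  have i: "inv (v \<circ> w) = inv w \<circ> inv v"
    using assms by (rule inv_comp_W)
  show ?thesis
    unfolding act_wt_def[of "v \<circ> w"] act_wt_def[of v] i
    using e[of 1] e[of 2] e[of 3] e[of 4] e[of 5] by (simp add: wt_def)
qed

lemma act_wt_s: "act_wt (s 1) (a, b, c, d) = (- a, a + b, c, d)" "act_wt (s 2) (a, b, c, d) = (a + b, - b, b + c, d)"
    "act_wt (s 3) (a, b, c, d) = (a, b + c, - c, c + d)" "act_wt (s 4) (a, b, c, d) = (a, b, c + d, - d)"
  by (simp_all add: act_wt_def wt_def s_apply)

lemma act_ex [simp]: "act w (ex \<mu>) = ex (act_wt w \<mu>)"
  by (simp add: act_def ex_def)

lemma act_simps [simp]: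
  "act w 0 = 0" "act w 1 = 1" "act w (f + g) = act w f + act w g" "act w (f - g) = act w f - act w g"
  "act w (- f) = - act w f" "act w (f * g) = act w f * act w g"
  "act w (\<Sum>i\<in>A. h i) = (\<Sum>i\<in>A. act w (h i))"
  by (simp_all add: act_def push_add push_diff push_uminus push_mult push_sum act_wt_add flip: single_one)

lemma act_of_int [simp]: "act w (of_int n) = of_int n"
  by (simp add: act_def flip: single_of_int)

lemma act_of_nat [simp]: "act w (of_nat n) = of_nat n"
  using act_of_int[of w "int n"] by simp

lemma act_prod: "act w (\<Prod>i\<in>A. h i) = (\<Prod>i\<in>A. act w (h i))"
  by (induction A rule: infinite_finite_induct) simp_all

lemma act_id [simp]: "act id f = f"
  by (induction f rule: ZT_induct) (simp_all add: act_wt_id[unfolded id_def])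

lemma act_comp: "v \<in> W \<Longrightarrow> w \<in> W \<Longrightarrow> act (v \<circ> w) f = act v (act w f)"
  by (induction f rule: ZT_induct) (simp_all add: act_wt_comp)

definition invariant :: "ZT \<Rightarrow> bool" where
  "invariant f \<longleftrightarrow> (\<forall>w\<in>W. act w f = f)"

lemma invariant_simps [simp, intro]:
  "invariant 0" "invariant 1" "invariant (of_int n)"
  "invariant f \<Longrightarrow> invariant g \<Longrightarrow> invariant (f + g)"
  "invariant f \<Longrightarrow> invariant g \<Longrightarrow> invariant (f - g)"
  "invariant f \<Longrightarrow> invariant g \<Longrightarrow> invariant (f * g)"
  "invariant f \<Longrightarrow> invariant (- f)"
  by (auto simp: invariant_def)

lemma invariant_sum [intro]: "(\<And>i. i \<in> A \<Longrightarrow> invariant (h i)) \<Longrightarrow> invariant (\<Sum>i\<in>A. h i)"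
  by (auto simp: invariant_def)

section \<open>Antisymmetrization and the Weyl denominator\<close>

lemma permutation_W: "w \<in> W \<Longrightarrow> permutation w"
  using W_D permutation_permutes by blast

lemma sign_comp_W: "v \<in> W \<Longrightarrow> w \<in> W \<Longrightarrow> sign (v \<circ> w) = sign v * sign w"
  by (simp add: sign_compose permutation_W)

lemma sign_s [simp]: "sign (s i) = -1"
  by (simp add: s_def sign_swap_id)

lemma sign_mult_sign: "sign v * sign v * k = (k :: int)" "sign v * k * sign v = k"
  by (simp_all add: sign_def)

definition Alt :: "ZT \<Rightarrow> ZT" where
  "Alt f = (\<Sum>y\<in>W. of_int (sign y) * act y f)"

lemma Alt_add: "Alt (f + g) = Alt f + Alt g"
  by (simp add: Alt_def distrib_left sum.distrib)

lemma Alt_diff: "Alt (f - g) = Alt f - Alt g"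
  by (simp add: Alt_def right_diff_distrib sum_subtractf)

lemma Alt_mult_invariant: "invariant h \<Longrightarrow> Alt (h * f) = h * Alt f"
  by (simp add: Alt_def invariant_def sum_distrib_left mult.left_commute)

lemma Alt_0 [simp]: "Alt 0 = 0"
  by (simp add: Alt_def)

lemma Alt_sum: "Alt (\<Sum>i\<in>A. f i) = (\<Sum>i\<in>A. Alt (f i))"
  by (induction A rule: infinite_finite_induct) (simp_all add: Alt_add)

lemma W_reindex: "v \<in> W \<Longrightarrow> (\<Sum>y\<in>W. g (v \<circ> y)) = (\<Sum>y\<in>W. g y)"
  by (rule sum.reindex_bij_witness[of _ "\<lambda>y. inv v \<circ> y" "\<lambda>y. v \<circ> y"]) (auto simp: o_assoc)

lemma W_reindex_right: "v \<in> W \<Longrightarrow> (\<Sum>y\<in>W. g (y \<circ> v)) = (\<Sum>y\<in>W. g y)"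
  by (rule sum.reindex_bij_witness[of _ "\<lambda>y. y \<circ> inv v" "\<lambda>y. y \<circ> v"]) (auto simp: o_assoc[symmetric])

lemma act_Alt:
  assumes v: "v \<in> W"
  shows "act v (Alt f) = of_int (sign v) * Alt f"
proof -
  have "of_int (sign v) * Alt f = of_int (sign v) * (\<Sum>y\<in>W. of_int (sign (v \<circ> y)) * act (v \<circ> y) f)"
    unfolding Alt_def using W_reindex[OF v, of "\<lambda>y. of_int (sign y) * act y f"] by simp
  also have "\<dots> = (\<Sum>y\<in>W. of_int (sign y) * act v (act y f))"
    unfolding sum_distrib_left using v
    by (intro sum.cong refl) (simp only: sign_comp_W act_comp sign_mult_sign flip: mult.assoc of_int_mult)
  also have "\<dots> = act v (Alt f)"
    unfolding Alt_def by (simp only: act_simps act_of_int)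
  finally show ?thesis ..
qed

lemma Alt_act:
  assumes v: "v \<in> W"
  shows "Alt (act v f) = of_int (sign v) * Alt f"
proof -
  have "of_int (sign v) * Alt f = of_int (sign v) * (\<Sum>y\<in>W. of_int (sign (y \<circ> v)) * act (y \<circ> v) f)"
    unfolding Alt_def using W_reindex_right[OF v, of "\<lambda>y. of_int (sign y) * act y f"] by simp
  also have "\<dots> = (\<Sum>y\<in>W. of_int (sign y) * act y (act v f))"
    unfolding sum_distrib_left using v
    by (intro sum.cong refl) (simp only: sign_comp_W act_comp sign_mult_sign flip: mult.assoc of_int_mult)
  also have "\<dots> = Alt (act v f)"
    unfolding Alt_def ..
  finally show ?thesis ..
qed

lemma ZT_eq_neg_self: "f = - f \<Longrightarrow> f = (0 :: ZT)"
proof (rule poly_mapping_eqI)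
  fix k assume "f = - f"
  then have "Poly_Mapping.lookup f k = Poly_Mapping.lookup (- f) k"
    by (rule arg_cong)
  then show "Poly_Mapping.lookup f k = Poly_Mapping.lookup 0 k"
    by simp
qed

lemma Alt_eq_0:
  assumes "v \<in> W" "sign v = -1" "act v f = f"
  shows "Alt f = 0"
  using Alt_act[OF assms(1), of f] assms by (intro ZT_eq_neg_self) simp

section \<open>Divisibility of alternating sums by the Weyl denominator\<close>

definition root :: "nat \<Rightarrow> nat \<Rightarrow> weight" where
  "root i j = wt (\<lambda>k. of_bool (k = i) - of_bool (k = j))"

lemma pos_roots_explicit: "pos_roots = {(2,-1,0,0), (1,1,-1,0), (1,0,1,-1), (1,0,0,1), (-1,2,-1,0), (-1,1,1,-1), (-1,1,0,1),
   (0,-1,2,-1), (0,-1,1,1), (0,0,-1,2)}" (is "_ = ?R")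
proof -
  have "pos_roots = (\<lambda>(i, j). root i j) ` {(1,2),(1,3),(1,4),(1,5),(2,3),(2,4),(2,5),(3,4),(3,5),(4,5)}" (is "_ = _ ` ?I")
  proof -
    have *: "(i, j) \<in> ?I" if "1 \<le> i" "i < j" "j \<le> 5" for i j :: nat
    proof -
      have "i \<in> {1..4}" "j \<in> {1..5}"
        using that by simp_all
      then show ?thesis
        using that(2) unfolding atLeastAtMost_1_4 atLeastAtMost_1_5 by (elim insertE emptyE; simp)
    qed
    have "{(i, j). 1 \<le> i \<and> i < j \<and> j \<le> (5::nat)} = ?I" (is "?A = _")
    proof (intro equalityI subsetI)
      fix p
      assume "p \<in> ?I"
      then show "p \<in> ?A"
        by (elim insertE emptyE; simp)
    next
      fix p
      assume "p \<in> ?A"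
      then show "p \<in> ?I"
        using * by (cases p) simp
    qed
    moreover have "pos_roots = (\<lambda>(i, j). root i j) ` {(i, j). 1 \<le> i \<and> i < j \<and> j \<le> (5::nat)}"
    proof (intro equalityI subsetI)
      fix x
      assume "x \<in> pos_roots"
      then obtain i j where "1 \<le> i" "i < j" "j \<le> 5" "x = root i j"
        unfolding pos_roots_def root_def by blast
      then show "x \<in> (\<lambda>(i, j). root i j) ` {(i, j). 1 \<le> i \<and> i < j \<and> j \<le> (5::nat)}"
        by (intro image_eqI[of _ _ "(i, j)"]) simp_all
    next
      fix x
      assume "x \<in> (\<lambda>(i, j). root i j) ` {(i, j). 1 \<le> i \<and> i < j \<and> j \<le> (5::nat)}"
      then obtain i j where "1 \<le> i" "i < j" "j \<le> 5" "x = root i j"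
        by auto
      then show "x \<in> pos_roots"
        unfolding pos_roots_def root_def by blast
    qed
    ultimately show ?thesis
      by simp
  qed
  also have "\<dots> = ?R"
    by (simp add: root_def wt_def)
  finally show ?thesis .
qed

lemma nu_eq: "nu = 10"
  by (simp add: nu_def pos_roots_explicit)

lemma finite_pos_roots [simp]: "finite pos_roots"
  by (simp add: pos_roots_explicit)

lemma act_wt_transpose:
  assumes "1 \<le> i" "i < j" "j \<le> 5"
  shows "act_wt (transpose i j) \<mu> = \<mu> + scale_wt (eps \<mu> j - eps \<mu> i) (root i j)"
proof -
  have "i \<in> {1..4}" "j \<in> {1..5}"
    using assms by simp_all
  then show ?thesis
    using assms(2) unfolding atLeastAtMost_1_4 atLeastAtMost_1_5 act_wt_def root_def
    by (cases \<mu>) (elim insertE emptyE; simp add: wt_def transpose_def)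
qed

lemma pos_rootsE:
  assumes "\<alpha> \<in> pos_roots"
  obtains i j where "1 \<le> i" "i < j" "j \<le> 5" "\<alpha> = root i j"
  using assms unfolding pos_roots_def root_def by blast

lemma scale_wt_add: "scale_wt (m + n) \<alpha> = scale_wt m \<alpha> + scale_wt n \<alpha>"
  by (cases \<alpha>) (simp add: distrib_right)

lemma scale_wt_simps [simp]: "scale_wt 0 \<alpha> = 0" "scale_wt 1 \<alpha> = \<alpha>" "scale_wt (- m) \<alpha> = - scale_wt m \<alpha>"
    "scale_wt m 0 = 0"
  by (cases \<alpha>; simp add: zero_prod_def)+

lemma scale_wt_distrib: "scale_wt m (\<alpha> + \<beta>) = scale_wt m \<alpha> + scale_wt m \<beta>"
  by (cases \<alpha>; cases \<beta>) (simp add: distrib_left)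

text \<open>Positive roots are primitive in the weight lattice, so each one is split off by an integral
  linear form; collapsing the lattice along the root exhibits \<open>1 - ex (- \<alpha>)\<close> as a prime element.\<close>

lemma root_functional:
  assumes "\<alpha> \<in> pos_roots"
  obtains l :: "weight \<Rightarrow> int" where "\<And>\<mu> \<nu>. l (\<mu> + \<nu>) = l \<mu> + l \<nu>" "l \<alpha> = 1"
proof -
  let ?l = "\<lambda>m n p r (a, b, c, d). m * a + n * b + p * c + r * (d :: int)"
  have add: "?l m n p r (\<mu> + \<nu>) = ?l m n p r \<mu> + ?l m n p r \<nu>" for m n p r :: int and \<mu> \<nu>
    by (cases \<mu>; cases \<nu>) (simp add: algebra_simps)
  consider "?l 1 0 0 0 \<alpha> = 1" | "?l (-1) 0 0 0 \<alpha> = 1" | "?l 0 (-1) 0 0 \<alpha> = 1" | "?l 0 0 (-1) 0 \<alpha> = 1"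
    using assms unfolding pos_roots_explicit by (elim insertE emptyE) simp_all
  then show ?thesis
    by cases (rule that[OF add], assumption)+
qed

lemma one_minus_dvd_diff:
  fixes \<alpha> \<mu> :: weight
  shows "(1 - ex (- \<alpha>)) dvd (ex \<mu> - ex (\<mu> - scale_wt k \<alpha>))"
proof -
  have p: "ex (- \<alpha>) ^ n = ex (- scale_wt (int n) \<alpha>)" for n
    by (induction n) (simp_all add: ex_mult scale_wt_add)
  have d: "(1 - ex (- \<alpha>)) dvd (1 - ex (- scale_wt (int n) \<alpha>))" for n
    using one_diff_power_eq[of "ex (- \<alpha>)" n] by (simp add: p)
  show ?thesis
  proof (cases "k \<ge> 0")
    case True
    then obtain n where k: "k = int n"
      using nonneg_int_cases by blast
    have "ex \<mu> - ex (\<mu> - scale_wt k \<alpha>) = ex \<mu> * (1 - ex (- scale_wt (int n) \<alpha>))"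
      by (simp add: right_diff_distrib ex_mult k)
    then show ?thesis
      using d[of n] by simp
  next
    case False
    then obtain n where k: "k = - int n"
      using neg_int_cases[of k] by (metis not_le)
    have "ex \<mu> - ex (\<mu> - scale_wt k \<alpha>) = - (ex (\<mu> + scale_wt (int n) \<alpha>) * (1 - ex (- scale_wt (int n) \<alpha>)))"
      by (simp add: right_diff_distrib ex_mult k)
    then show ?thesis
      using d[of n] by simp
  qed
qed

text \<open>Modulo \<open>1 - ex (- \<alpha>)\<close> the elements \<open>ex \<mu>\<close> and
  \<open>ex (r \<mu>)\<close> agree, so \<open>f\<close> is congruent to \<open>push r f\<close>.
  Conversely, the ring homomorphism \<open>push r\<close> annihilates
  \<open>1 - ex (- \<alpha>)\<close>.\<close>

lemma one_minus_dvd_iff: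
  assumes l: "\<And>\<mu> \<nu>. l (\<mu> + \<nu>) = l \<mu> + l \<nu>" "l \<alpha> = (1 :: int)"
  defines "r \<equiv> \<lambda>\<mu>. \<mu> - scale_wt (l \<mu>) \<alpha>"
  shows "(1 - ex (- \<alpha>)) dvd f \<longleftrightarrow> push r f = 0"
proof
  have r_add: "r (\<mu> + \<nu>) = r \<mu> + r \<nu>" for \<mu> \<nu>
    by (simp add: r_def l scale_wt_add)
  have l0: "l 0 = 0"
    using l(1)[of 0 0] by simp
  have "l (- \<alpha>) = - 1"
    using l(1)[of \<alpha> "- \<alpha>"] l(2) l0 by simp
  then have r0: "r (- \<alpha>) = 0" "r 0 = 0"
    using l0 by (simp_all add: r_def)
  show "push r f = 0" if "(1 - ex (- \<alpha>)) dvd f"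
  proof -
    obtain g where "f = (1 - ex (- \<alpha>)) * g"
      using \<open>(1 - ex (- \<alpha>)) dvd f\<close> by (rule dvdE)
    then have "push r f = push r (1 - ex (- \<alpha>)) * push r g"
      by (simp add: push_mult r_add)
    moreover have "push r (1 - ex (- \<alpha>)) = 0"
      using r0 by (simp add: push_diff ex_def flip: single_one)
    ultimately show ?thesis by simp
  qed
  show "(1 - ex (- \<alpha>)) dvd f" if "push r f = 0"
  proof -
    have "(1 - ex (- \<alpha>)) dvd (f - push r f)"
    proof (induction f rule: ZT_induct)
      case (ex \<mu>)
      show ?case
        using one_minus_dvd_diff[of \<alpha> \<mu> "l \<mu>"] by (simp add: ex_def r_def)
    next
      case (add f g)
      then show ?case
        using dvd_add[of "1 - ex (- \<alpha>)" "f - push r f" "g - push r g"] by (simp add: push_add algebra_simps)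
    next
      case (scale c f)
      have "push r (of_int c * f) = of_int c * push r f"
        using r0 push_mult[of r "of_int c" f] r_add by (simp flip: single_of_int)
      then show ?case
        using scale by (simp flip: right_diff_distrib)
    qed simp
    then show ?thesis
      using that by simp
  qed
qed

lemma one_minus_ex_neq_0: "\<mu> \<noteq> 0 \<Longrightarrow> 1 - ex \<mu> \<noteq> 0"
  using ex_inj[of 0 \<mu>] by auto

lemma pos_roots_not_multiple:
  assumes "\<alpha> \<in> pos_roots" "\<beta> \<in> pos_roots" "\<alpha> \<noteq> \<beta>"
  shows "\<beta> \<noteq> scale_wt k \<alpha>"
  using assms unfolding pos_roots_explicit by (elim insertE emptyE) auto

text \<open>Prime factors are split off one at a time. Positive roots are not multiples of each
  other, so \<open>push r\<close> for one root does not annihilate the factors of the others, and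
  the product can be cancelled in an integral domain.\<close>

lemma prod_roots_dvd:
  assumes "finite F" "F \<subseteq> pos_roots" "\<And>\<alpha>. \<alpha> \<in> F \<Longrightarrow> (1 - ex (- \<alpha>)) dvd f"
  shows "(\<Prod>\<alpha>\<in>F. 1 - ex (- \<alpha>)) dvd f"
  using assms
proof (induction F)
  case (insert \<alpha> F)
  then obtain g where g: "f = (\<Prod>\<alpha>\<in>F. 1 - ex (- \<alpha>)) * g"
    by (metis dvdE insert_iff insert_subset)
  obtain l :: "weight \<Rightarrow> int" where l: "\<And>\<mu> \<nu>. l (\<mu> + \<nu>) = l \<mu> + l \<nu>" "l \<alpha> = 1"
    using root_functional[of \<alpha>] insert.prems by blast
  define r where "r = (\<lambda>\<mu>. \<mu> - scale_wt (l \<mu>) \<alpha>)"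
  have r_add: "r (\<mu> + \<nu>) = r \<mu> + r \<nu>" for \<mu> \<nu>
    by (simp add: r_def l scale_wt_add)
  have d: "(1 - ex (- \<alpha>)) dvd h \<longleftrightarrow> push r h = 0" for h
    unfolding r_def by (rule one_minus_dvd_iff[OF l])
  have "push r (1 - ex (- \<beta>)) \<noteq> 0" if "\<beta> \<in> F" for \<beta>
  proof -
    have "r (- \<beta>) \<noteq> 0"
    proof
      assume "r (- \<beta>) = 0"
      then have "- \<beta> = scale_wt (l (- \<beta>)) \<alpha>"
        by (simp add: r_def)
      then have "- (- \<beta>) = - scale_wt (l (- \<beta>)) \<alpha>"
        by (rule arg_cong)
      then have "\<beta> = scale_wt (- l (- \<beta>)) \<alpha>"
        by simp
      then show False
        using pos_roots_not_multiple[of \<alpha> \<beta>] insert.hyps insert.prems(1) that by blast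
    qed
    moreover have "r 0 = 0"
      using r_add[of 0 0] by simp
    ultimately show ?thesis
      using one_minus_ex_neq_0[of "r (- \<beta>)"] by (simp add: push_diff ex_def flip: single_one)
  qed
  moreover have "push r (\<Prod>\<beta>\<in>F. 1 - ex (- \<beta>)) = (\<Prod>\<beta>\<in>F. push r (1 - ex (- \<beta>)))"
  proof -
    have "push r 1 = 1"
      using r_add[of 0 0] by (simp flip: single_one)
    with insert.hyps(1) show ?thesis
      by (induction F rule: finite_induct) (simp_all add: push_mult r_add)
  qed
  ultimately have "push r (\<Prod>\<beta>\<in>F. 1 - ex (- \<beta>)) \<noteq> 0"
    using insert.hyps(1) by simp
  moreover have "push r f = 0"
    using d insert.prems(2) by blast
  ultimately have "push r g = 0"
    unfolding g push_mult[of r, OF r_add] by simp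
  then have "(1 - ex (- \<alpha>)) dvd g"
    using d by blast
  then show ?case
    using insert.hyps by (simp add: g mult_dvd_mono mult.commute)
qed simp

text \<open>The reflection of a root moves weights along that root, so it disappears after the
  collapse \<open>push r\<close>; but it changes the sign of an alternating sum. Hence
  \<open>push r (Alt f)\<close> is its own negative.\<close>

lemma weyl_denom_dvd_Alt: "weyl_denom dvd Alt f"
proof -
  have "(1 - ex (- \<alpha>)) dvd Alt f" if \<alpha>: "\<alpha> \<in> pos_roots" for \<alpha>
  proof -
    obtain i j where ij: "1 \<le> i" "i < j" "j \<le> 5" "\<alpha> = root i j"
      using \<alpha> by (rule pos_rootsE)
    obtain l :: "weight \<Rightarrow> int" where l: "\<And>\<mu> \<nu>. l (\<mu> + \<nu>) = l \<mu> + l \<nu>" "l \<alpha> = 1"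
      using root_functional[OF \<alpha>] by blast
    define r where "r = (\<lambda>\<mu>. \<mu> - scale_wt (l \<mu>) \<alpha>)"
    have t: "transpose i j \<in> W" "sign (transpose i j) = -1"
      using ij by (auto intro!: transpose_W simp: sign_swap_id)
    have l0: "l 0 = 0"
      using l(1)[of 0 0] by simp
    have ls: "l (scale_wt (int n) \<alpha>) = int n" for n
      by (induction n) (simp_all add: scale_wt_add l l0)
    have ls': "l (scale_wt k \<alpha>) = k" for k
    proof (cases "k \<ge> 0")
      case False
      then obtain n where "k = - int n"
        using neg_int_cases[of k] by (metis not_le)
      then show ?thesis
        using ls[of n] l(1)[of "scale_wt (int n) \<alpha>" "- scale_wt (int n) \<alpha>"] l0 by simp
    qed (use ls in \<open>auto elim: nonneg_int_cases\<close>)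
    have "r (act_wt (transpose i j) \<mu>) = r \<mu>" for \<mu>
      unfolding act_wt_transpose[OF ij(1-3)] ij(4)[symmetric] r_def by (simp add: l ls' scale_wt_add)
    then have "push r (act (transpose i j) g) = push r g" for g
      by (simp add: act_def push_push o_def)
    then have "push r (Alt f) = - push r (Alt f)"
      using act_Alt[OF t(1), of f] t(2) by (metis push_uminus mult_minus1 of_int_minus of_int_1)
    then have "push r (Alt f) = 0"
      by (rule ZT_eq_neg_self)
    then show ?thesis
      unfolding r_def using one_minus_dvd_iff[OF l] by blast
  qed
  then have "(\<Prod>\<alpha>\<in>pos_roots. 1 - ex (- \<alpha>)) dvd Alt f"
    by (intro prod_roots_dvd) auto
  then obtain g where "Alt f = (\<Prod>\<alpha>\<in>pos_roots. 1 - ex (- \<alpha>)) * g"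
    by (rule dvdE)
  then have "Alt f = weyl_denom * (ex (- fund_sum {1..4}) * g)"
    unfolding weyl_denom_def by (simp add: mult.assoc mult.left_commute[of "ex (- fund_sum {1..4})"])
      (simp add: mult.assoc[symmetric] ex_mult)
  then show ?thesis by simp
qed

lemma weyl_denom_neq_0 [simp]: "weyl_denom \<noteq> 0"
proof -
  have "ex (fund_sum {1..4}) \<noteq> 0"
    by (metis ex_def lookup_single_eq lookup_zero zero_neq_one)
  moreover have "1 - ex (- \<alpha>) \<noteq> 0" if "\<alpha> \<in> pos_roots" for \<alpha>
    using that by (intro one_minus_ex_neq_0) (auto simp: pos_roots_explicit zero_prod_def)
  ultimately show ?thesis
    by (simp add: weyl_denom_def)
qed

lemma exact_quot_eq: "g \<noteq> 0 \<Longrightarrow> g * h = f \<Longrightarrow> exact_quot f g = h"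
  unfolding exact_quot_def by (rule the_equality) auto

lemma pairing_Alt: "weyl_denom * pairing f g = Alt (f * g)"
proof -
  obtain h where "Alt (f * g) = weyl_denom * h"
    using weyl_denom_dvd_Alt by (rule dvdE)
  then show ?thesis
    unfolding pairing_def Alt_def[symmetric] using exact_quot_eq[of weyl_denom h] by simp
qed

lemma pairing_eqI: "weyl_denom * h = Alt (f * g) \<Longrightarrow> pairing f g = h"
  using pairing_Alt[of f g] by (metis mult_cancel_left weyl_denom_neq_0)

lemma pairing_add_left: "pairing (f + f') g = pairing f g + pairing f' g"
  by (rule pairing_eqI) (simp add: distrib_left distrib_right pairing_Alt Alt_add)

lemma pairing_diff_left: "pairing (f - f') g = pairing f g - pairing f' g"
  by (rule pairing_eqI) (simp add: left_diff_distrib right_diff_distrib pairing_Alt Alt_diff)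

lemma pairing_scale_left: "invariant h \<Longrightarrow> pairing (h * f) g = h * pairing f g"
  by (rule pairing_eqI) (simp add: mult.left_commute[of weyl_denom] pairing_Alt Alt_mult_invariant mult.assoc)

lemma pairing_commute: "pairing f g = pairing g f"
  by (simp add: pairing_def mult.commute)

lemma pairing_0 [simp]: "pairing 0 g = 0" "pairing g 0 = 0"
  by (rule pairing_eqI; simp)+

lemma pairing_sum_left: "pairing (\<Sum>i\<in>A. f i) g = (\<Sum>i\<in>A. pairing (f i) g)"
  by (induction A rule: infinite_finite_induct) (simp_all add: pairing_add_left)

text \<open>A simple reflection permutes the positive roots other than its own, whose factor
  together with \<open>ex \<rho>\<close> produces the sign.\<close>

lemma act_weyl_denom_s:
  assumes i: "i \<in> {1..4}"
  shows "act (s i) weyl_denom = - weyl_denom"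
proof -
  define \<alpha> :: weight where "\<alpha> = root i (Suc i)"
  define \<rho> where "\<rho> = fund_sum {1..4}"
  let ?F = "\<lambda>\<beta>. 1 - ex (- \<beta>)"
  have i': "i \<in> {1, 2, 3, 4}"
    using i unfolding atLeastAtMost_1_4 .
  have \<rho>: "\<rho> = (1, 1, 1, 1)"
    unfolding \<rho>_def fund_sum_def atLeastAtMost_1_4 by (simp add: fund_def)
  have a: "\<alpha> \<in> pos_roots" "act_wt (s i) \<alpha> = - \<alpha>" "act_wt (s i) \<rho> = \<rho> - \<alpha>"
    using i' unfolding \<alpha>_def \<rho> pos_roots_explicit
    by (elim insertE emptyE; simp add: root_def wt_def act_wt_s)+
  have inj: "inj_on (act_wt (s i)) A" for A
    by (rule inj_on_inverseI[of _ "act_wt (s i)"]) (use act_wt_comp[of "s i" "s i"] i in simp)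
  have stable: "act_wt (s i) \<beta> \<in> pos_roots - {\<alpha>}" if "\<beta> \<in> pos_roots - {\<alpha>}" for \<beta>
  proof -
    have "\<beta> \<in> pos_roots" "\<beta> \<noteq> \<alpha>"
      using that by auto
    then show ?thesis
      using i' unfolding \<alpha>_def pos_roots_explicit
      by (elim insertE emptyE; simp add: root_def wt_def act_wt_s)
  qed
  have im: "act_wt (s i) ` (pos_roots - {\<alpha>}) = pos_roots - {\<alpha>}"
    using stable by (intro endo_inj_surj inj finite_Diff finite_pos_roots) blast
  have "(\<Prod>\<beta>\<in>pos_roots - {\<alpha>}. ?F (act_wt (s i) \<beta>)) = (\<Prod>\<beta>\<in>pos_roots - {\<alpha>}. ?F \<beta>)"
    using prod.reindex[OF inj, of ?F "pos_roots - {\<alpha>}"] unfolding im by (simp add: o_def)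
  then have "act (s i) (\<Prod>\<beta>\<in>pos_roots. ?F \<beta>) = ?F (- \<alpha>) * (\<Prod>\<beta>\<in>pos_roots - {\<alpha>}. ?F \<beta>)"
    unfolding act_prod prod.remove[OF finite_pos_roots a(1)] by (simp add: act_wt_uminus a(2) act_prod)
  then have "act (s i) weyl_denom = (ex (\<rho> - \<alpha>) * ?F (- \<alpha>)) * (\<Prod>\<beta>\<in>pos_roots - {\<alpha>}. ?F \<beta>)"
    unfolding weyl_denom_def by (simp add: a(3) mult.assoc flip: \<rho>_def)
  also have "ex (\<rho> - \<alpha>) * ?F (- \<alpha>) = - (ex \<rho> * ?F \<alpha>)"
    by (simp add: right_diff_distrib ex_mult)
  finally show ?thesis
    unfolding weyl_denom_def prod.remove[OF finite_pos_roots a(1)] by (simp add: mult.assoc flip: \<rho>_def)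
qed

lemma act_weyl_denom: "w \<in> W \<Longrightarrow> act w weyl_denom = of_int (sign w) * weyl_denom"
proof (induction rule: W_induct)
  case id
  show ?case
    by (simp add: id_def[symmetric])
next
  case (step w i)
  have "act (s i \<circ> w) weyl_denom = of_int (sign (s i \<circ> w)) * weyl_denom"
    using step act_comp[of "s i" w weyl_denom] sign_comp_W[of "s i" w] by (simp add: act_weyl_denom_s)
  then show ?case
    by (simp add: o_def)
qed

lemma invariant_pairing [simp]: "invariant (pairing f g)"
  unfolding invariant_def
proof
  fix w assume w: "w \<in> W"
  have "of_int (sign w) * (weyl_denom * act w (pairing f g)) = act w weyl_denom * act w (pairing f g)"
    by (simp only: act_weyl_denom[OF w] mult.assoc)
  also have "\<dots> = act w (weyl_denom * pairing f g)"
    by (simp only: act_simps)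
  also have "\<dots> = of_int (sign w) * (weyl_denom * pairing f g)"
    by (simp only: pairing_Alt act_Alt[OF w])
  finally show "act w (pairing f g) = pairing f g"
    by (auto simp: sign_def split: if_splits)
qed

lemma pairing_scale_right: "invariant h \<Longrightarrow> pairing f (h * g) = h * pairing f g"
  using pairing_scale_left[of h g f] by (simp only: pairing_commute[of f])

lemma pairing_sum_right: "pairing g (\<Sum>i\<in>A. f i) = (\<Sum>i\<in>A. pairing g (f i))"
  using pairing_sum_left[of f A g] by (simp only: pairing_commute[of g])

lemma pairing_diff_right: "pairing f (g - g') = pairing f g - pairing f g'"
  using pairing_diff_left[of g g' f] by (simp only: pairing_commute[of f])

text \<open>Weights are nested pairs; quantifiers over them are to stay whole.\<close>

declare split_paired_All [simp del] split_paired_Ex [simp del]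

section \<open>Dominant weights\<close>

text \<open>\<open>ht\<close> is the pairing with the sum of the positive coroots.\<close>

fun ht :: "weight \<Rightarrow> int" where "ht (a, b, c, d) = 4 * a + 6 * b + 6 * c + 4 * d"

text \<open>The class of a weight modulo the root lattice.\<close>

fun wclass :: "weight \<Rightarrow> int" where "wclass (a, b, c, d) = (a + 2 * b + 3 * c + 4 * d) mod 5"

definition rho :: weight where "rho = fund_sum {1..4}"

lemma rho_eq: "rho = (1, 1, 1, 1)"
  unfolding rho_def fund_sum_def atLeastAtMost_1_4 by (simp add: fund_def)

lemma ht_add: "ht (\<mu> + \<nu>) = ht \<mu> + ht \<nu>"
  by (cases \<mu>; cases \<nu>) simp

lemma ht_0 [simp]: "ht 0 = 0"
  by (simp add: zero_prod_def)

lemma ht_uminus: "ht (- \<mu>) = - ht \<mu>"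
  by (cases \<mu>) simp

lemma ht_act_s: "i \<in> {1..4} \<Longrightarrow> ht (act_wt (s i) \<mu>) = ht \<mu> - 2 * (eps \<mu> i - eps \<mu> (Suc i))"
  unfolding atLeastAtMost_1_4 by (cases \<mu>) (elim insertE emptyE; simp add: act_wt_s)

lemma wclass_act_s: "i \<in> {1..4} \<Longrightarrow> wclass (act_wt (s i) \<mu>) = wclass \<mu>"
proof -
  assume i: "i \<in> {1..4}"
  obtain a b c d where \<mu>: "\<mu> = (a, b, c, d)" by (cases \<mu>)
  have e: "(- a + 2 * (a + b) + 3 * c + 4 * d) = (a + 2 * b + 3 * c + 4 * d)"
    "(a + b + 2 * - b + 3 * (b + c) + 4 * d) = (a + 2 * b + 3 * c + 4 * d)"
    "(a + 2 * (b + c) + 3 * - c + 4 * (c + d)) = (a + 2 * b + 3 * c + 4 * d)"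
    "(a + 2 * b + 3 * (c + d) + 4 * - d) = (a + 2 * b + 3 * c + 4 * d) + 5 * (- d)"
    by simp_all
  show ?thesis
    using i unfolding atLeastAtMost_1_4 \<mu>
    by (elim insertE emptyE; simp only: act_wt_s wclass.simps e mod_mult_self2)
qed

lemma wclass_act: "w \<in> W \<Longrightarrow> wclass (act_wt w \<mu>) = wclass \<mu>"
proof (induction rule: W_induct)
  case id
  show ?case by (simp add: act_wt_id[unfolded id_def])
next
  case (step w i)
  then have "wclass (act_wt (s i \<circ> w) \<mu>) = wclass \<mu>"
    using act_wt_comp[of "s i" w \<mu>] wclass_act_s[of i "act_wt w \<mu>"] by simp
  then show ?case by (simp add: o_def)
qed

definition dominant :: "weight \<Rightarrow> bool" where
  "dominant \<mu> \<longleftrightarrow> (\<forall>i\<in>{1..4}. eps \<mu> (Suc i) \<le> eps \<mu> i)"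

lemma dominant_iff: "dominant (a, b, c, d) \<longleftrightarrow> 0 \<le> a \<and> 0 \<le> b \<and> 0 \<le> c \<and> 0 \<le> d"
  unfolding dominant_def atLeastAtMost_1_4 by simp

lemma act_wt_s_fixed: "i \<in> {1..4} \<Longrightarrow> eps \<mu> i = eps \<mu> (Suc i) \<Longrightarrow> act_wt (s i) \<mu> = \<mu>"
  unfolding atLeastAtMost_1_4 by (cases \<mu>) (elim insertE emptyE; simp add: act_wt_s)

lemma dominant_antimono:
  assumes "dominant \<mu>" "1 \<le> i" "i \<le> j" "j \<le> 5"
  shows "eps \<mu> j \<le> eps \<mu> i"
  using assms(3,4)
proof (induction j rule: dec_induct)
  case (step n)
  then have "n \<in> {1..4}"
    using assms(2) by simp
  then show ?case
    using assms(1) step unfolding dominant_def by force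
qed simp

text \<open>Along an increasing chain of left multiplications every step subtracts twice a
  difference of coordinates, nonnegative because \<open>inv w i\<close> precedes
  \<open>inv w (Suc i)\<close>; a zero difference means that the weight is fixed.\<close>

lemma ht_act_le:
  assumes "dominant \<kappa>" "w \<in> W"
  shows "ht (act_wt w \<kappa>) \<le> ht \<kappa> \<and> (ht (act_wt w \<kappa>) = ht \<kappa> \<longrightarrow> act_wt w \<kappa> = \<kappa>)"
  using assms(2)
proof (induction rule: W_induct)
  case id
  show ?case by (simp add: act_wt_id[unfolded id_def])
next
  case (step w i)
  define \<mu> where "\<mu> = act_wt w \<kappa>"
  have IH: "ht \<mu> \<le> ht \<kappa>" "ht \<mu> = ht \<kappa> \<Longrightarrow> \<mu> = \<kappa>"
    using step.IH[OF step.hyps(1)] by (auto simp: \<mu>_def)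
  have c: "act_wt (s i \<circ> w) \<kappa> = act_wt (s i) \<mu>"
    unfolding \<mu>_def using step.hyps by (intro act_wt_comp) auto
  have r: "i \<in> {1..5}" "Suc i \<in> {1..5}"
    using step.hyps(2) by auto
  have o: "inv w i \<le> inv w (Suc i)"
    using step.hyps(3) by (simp add: ld_def rd_def)
  have r': "1 \<le> inv w i" "inv w (Suc i) \<le> 5"
    using W_range[of "inv w" i] W_range[of "inv w" "Suc i"] r step.hyps(1) by auto
  have "eps \<mu> (Suc i) \<le> eps \<mu> i"
    using dominant_antimono[OF assms(1) r'(1) o r'(2)] eps_act_wt[OF step.hyps(1) r(1), of \<kappa>]
      eps_act_wt[OF step.hyps(1) r(2), of \<kappa>] by (simp add: \<mu>_def)
  moreover have "act_wt (s i) \<mu> = \<mu>" if "eps \<mu> i = eps \<mu> (Suc i)"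
    using act_wt_s_fixed[OF step.hyps(2) that] .
  ultimately have "ht (act_wt (s i \<circ> w) \<kappa>) \<le> ht \<kappa> \<and> (ht (act_wt (s i \<circ> w) \<kappa>) = ht \<kappa> \<longrightarrow> act_wt (s i \<circ> w) \<kappa> = \<kappa>)"
    unfolding c ht_act_s[OF step.hyps(2)] using IH by auto
  then show ?case by (simp add: o_def)
qed

lemma dominant_conjugate: "\<exists>x\<in>W. dominant (act_wt x \<mu>)"
proof -
  let ?H = "(\<lambda>x. ht (act_wt x \<mu>)) ` W"
  have "Max ?H \<in> ?H"
    using id_W by (intro Max_in) (simp, metis empty_iff image_is_empty)
  then obtain x where x: "x \<in> W" "ht (act_wt x \<mu>) = Max ?H" by auto
  have "eps (act_wt x \<mu>) (Suc i) \<le> eps (act_wt x \<mu>) i" if i: "i \<in> {1..4}" for i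
  proof -
    have "ht (act_wt (s i \<circ> x) \<mu>) \<le> Max ?H"
      using i x(1) by (intro Max_ge) auto
    then show ?thesis
      using act_wt_comp[of "s i" x \<mu>] i x by (simp add: ht_act_s)
  qed
  then show ?thesis
    using x(1) unfolding dominant_def by blast
qed

lemma Alt_ex_singular:
  assumes "x \<in> W" "i \<in> {1..4}" "eps (act_wt x \<kappa>) i = eps (act_wt x \<kappa>) (Suc i)"
  shows "Alt (ex \<kappa>) = 0"
proof -
  have "Alt (ex (act_wt x \<kappa>)) = 0"
    using act_wt_s_fixed[OF assms(2,3)] assms(2) by (intro Alt_eq_0[of "s i"]) auto
  moreover have "Alt (ex (act_wt x \<kappa>)) = of_int (sign x) * Alt (ex \<kappa>)"
    using Alt_act[OF assms(1), of "ex \<kappa>"] by simp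
  ultimately show ?thesis
    by (auto simp: sign_def split: if_splits)
qed

text \<open>A weight with nonzero alternating sum is conjugate to \<open>rho + \<nu>\<close> with \<open>\<nu>\<close> dominant, and a
  nonzero dominant weight has height at least 4.\<close>

lemma Alt_ex_nonzero:
  assumes "Alt (ex \<kappa>) \<noteq> 0"
  obtains x where "x \<in> W" "act_wt x \<kappa> = rho \<or> ht (act_wt x \<kappa>) \<ge> ht rho + 4"
proof -
  obtain x where x: "x \<in> W" "dominant (act_wt x \<kappa>)"
    using dominant_conjugate by blast
  obtain a b c d where k: "act_wt x \<kappa> = (a, b, c, d)" by (cases "act_wt x \<kappa>")
  have "eps (act_wt x \<kappa>) (Suc i) \<noteq> eps (act_wt x \<kappa>) i" if "i \<in> {1..4}" for i
    using Alt_ex_singular[OF x(1) that] assms by metis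
  then have "eps (act_wt x \<kappa>) (Suc i) < eps (act_wt x \<kappa>) i" if "i \<in> {1..4}" for i
    using x(2) that unfolding dominant_def by (metis order_le_less)
  from this[of 1] this[of 2] this[of 3] this[of 4] have "a \<ge> 1" "b \<ge> 1" "c \<ge> 1" "d \<ge> 1"
    unfolding k by simp_all
  then have "act_wt x \<kappa> = rho \<or> ht (act_wt x \<kappa>) \<ge> ht rho + 4"
    unfolding k rho_eq by (simp) linarith
  then show ?thesis
    using that x(1) by blast
qed

section \<open>The Weyl denominator formula\<close>

definition keys_below :: "int \<Rightarrow> ZT \<Rightarrow> bool" where
  "keys_below n f \<longleftrightarrow> (\<forall>\<mu>\<in>Poly_Mapping.keys f. ht \<mu> < n)"

lemma keys_below_mult: "keys_below m f \<Longrightarrow> (\<forall>\<mu>\<in>Poly_Mapping.keys g. ht \<mu> \<le> n) \<Longrightarrow> keys_below (m + n) (f * g)"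
  using keys_mult[of f g] unfolding keys_below_def by (fastforce simp: ht_add)

lemma keys_below_add: "keys_below m f \<Longrightarrow> keys_below m g \<Longrightarrow> keys_below m (f + g)"
  using keys_add[of f g] unfolding keys_below_def by blast

lemma keys_below_uminus: "keys_below m f \<Longrightarrow> keys_below m (- f)"
  by (simp add: keys_below_def)

lemma pos_roots_ht: "\<alpha> \<in> pos_roots \<Longrightarrow> ht \<alpha> > 0"
  unfolding pos_roots_explicit by (elim insertE emptyE) simp_all

lemma prod_roots_leading:
  "finite F \<Longrightarrow> F \<subseteq> pos_roots \<Longrightarrow> keys_below 0 ((\<Prod>\<alpha>\<in>F. 1 - ex (- \<alpha>)) - 1)"
proof (induction F rule: finite_induct)
  case empty
  then show ?case by (simp add: keys_below_def)
next
  case (insert \<alpha> F)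
  define g where "g = (\<Prod>\<alpha>\<in>F. 1 - ex (- \<alpha>)) - 1"
  have g: "keys_below 0 g"
    using insert by (simp add: g_def)
  have \<alpha>: "ht (- \<alpha>) < 0"
    using insert.prems pos_roots_ht by (auto simp: ht_uminus)
  then have e: "keys_below 0 (ex (- \<alpha>))" "\<forall>\<mu>\<in>Poly_Mapping.keys (ex (- \<alpha>)). ht \<mu> \<le> 0"
    by (simp_all add: keys_below_def ex_def)
  have eq: "(\<Prod>\<alpha>\<in>insert \<alpha> F. 1 - ex (- \<alpha>)) - 1 = (g + - (ex (- \<alpha>))) + - (g * ex (- \<alpha>))"
    using insert.hyps by (simp add: g_def algebra_simps)
  have k: "keys_below 0 (g * ex (- \<alpha>))"
    using keys_below_mult[OF g e(2)] by simp
  show ?case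
    unfolding eq by (intro keys_below_add keys_below_uminus g e(1) k)
qed

lemma act_rho_inj:
  assumes "w \<in> W" "act_wt w rho = rho"
  shows "w = id"
proof (rule no_descent_id[OF assms(1)])
  fix k assume k: "k \<in> {1..4::nat}"
  have iW: "inv w \<in> W" using assms by simp
  have "act_wt (inv w) rho = rho"
    using act_wt_comp[of "inv w" w rho] assms by simp
  then have e: "eps rho j = eps rho (w j) - eps rho (w 5)" if "j \<in> {1..5}" for j
    using eps_act_wt[OF iW that, of rho] assms(1) by simp
  have r: "eps rho j = 5 - int j" if "j \<in> {1..5}" for j
    using that unfolding atLeastAtMost_1_5 rho_eq by (elim insertE emptyE) simp_all
  have j: "k \<in> {1..5}" "Suc k \<in> {1..5}" "w k \<in> {1..5}" "w (Suc k) \<in> {1..5}"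
    using k W_range[OF assms(1), of k] W_range[OF assms(1), of "Suc k"] by auto
  show "w k < w (Suc k)"
    using e[OF j(1)] e[OF j(2)] r[OF j(1)] r[OF j(2)] r[OF j(3)] r[OF j(4)] by linarith
qed

definition rev5 :: perm where "rev5 = perm5 (5, 4, 3, 2, 1)"

lemma rev5_W [simp]: "rev5 \<in> W"
  by (simp add: rev5_def perm5_W)

lemma inv_rev5: "inv rev5 = rev5"
  by (rule inv_unique_comp) (rule ext, simp add: rev5_def perm5.simps)+

lemma act_rev5: "act_wt rev5 (a, b, c, d) = (- d, - c, - b, - a)"
  unfolding act_wt_def inv_rev5 by (simp add: rev5_def wt_def perm5.simps)

lemma keys_act: "w \<in> W \<Longrightarrow> \<mu> \<in> Poly_Mapping.keys f \<Longrightarrow> act_wt w \<mu> \<in> Poly_Mapping.keys (act w f)"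
proof -
  assume w: "w \<in> W" and \<mu>: "\<mu> \<in> Poly_Mapping.keys f"
  have inj: "act_wt w \<nu> = act_wt w \<mu> \<longleftrightarrow> \<nu> = \<mu>" for \<nu>
    using act_wt_comp[of "inv w" w] w by (metis act_wt_id inv_W inv_o_W(1))
  have "Poly_Mapping.lookup (act w f) (act_wt w \<mu>) = Poly_Mapping.lookup f \<mu>"
    unfolding act_def push_def lookup_sum lookup_single using \<mu> by (simp add: inj when_def)
  then show ?thesis
    using \<mu> by (simp add: in_keys_iff)
qed

lemma lookup_of_int_ex: "Poly_Mapping.lookup (of_int c * ex \<nu>) \<kappa> = (if \<nu> = \<kappa> then c else 0)"
  by (simp add: ex_def mult_single lookup_single when_def flip: single_of_int)

lemma lookup_ex_mult: "Poly_Mapping.lookup (ex \<nu> * f) (\<nu> + \<mu>) = Poly_Mapping.lookup f \<mu>"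
proof (induction f rule: poly_mapping_induct)
  case (single k v)
  show ?case
    by (simp add: ex_def mult_single lookup_single when_def)
qed (simp_all add: distrib_left lookup_add)

text \<open>The quotient \<open>h\<close> by the Weyl denominator is invariant. A weight of
  \<open>h\<close> of maximal height cannot cancel in the product, so \<open>rho\<close> plus it is
  conjugate to \<open>rho\<close> and its height is at most 0. Symmetry under the longest element
  leaves only the weight 0, whose coefficient is 1.\<close>

lemma Alt_rho: "Alt (ex rho) = weyl_denom"
proof -
  define h where "h = pairing (ex rho) 1"
  have h: "weyl_denom * h = Alt (ex rho)"
    unfolding h_def pairing_Alt by simp
  define g where "g = (\<Prod>\<alpha>\<in>pos_roots. 1 - ex (- \<alpha>)) - 1"
  have g: "keys_below 0 g"
    unfolding g_def by (rule prod_roots_leading) auto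
  have d: "weyl_denom = ex rho * (1 + g)"
    by (simp add: weyl_denom_def g_def rho_def)
  have Alt_keys: "\<exists>w\<in>W. \<kappa> = act_wt w rho" if "\<kappa> \<in> Poly_Mapping.keys (Alt (ex rho))" for \<kappa>
  proof (rule ccontr)
    assume n: "\<not> ?thesis"
    have "Poly_Mapping.lookup (Alt (ex rho)) \<kappa> = 0"
      unfolding Alt_def act_ex lookup_sum lookup_of_int_ex
    proof (intro sum.neutral ballI)
      fix w
      assume "w \<in> W"
      then have "act_wt w rho \<noteq> \<kappa>"
        using n by blast
      then show "(if act_wt w rho = \<kappa> then sign w else 0) = 0"
        by simp
    qed
    then show False
      using that by (simp add: in_keys_iff)
  qed
  have dom: "dominant rho"
    by (simp add: rho_eq dominant_iff)
  have top: "ht \<mu> \<le> 0 \<and> (ht \<mu> = 0 \<longrightarrow> \<mu> = 0)" if \<mu>: "\<mu> \<in> Poly_Mapping.keys h" and m: "\<And>\<nu>. \<nu> \<in> Poly_Mapping.keys h \<Longrightarrow> ht \<nu> \<le> ht \<mu>" for \<mu>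
  proof -
    have "Alt (ex rho) = ex rho * h + ex rho * (g * h)"
      unfolding h[symmetric] d by (simp add: algebra_simps)
    then have "Poly_Mapping.lookup (Alt (ex rho)) (rho + \<mu>) = Poly_Mapping.lookup h \<mu> + Poly_Mapping.lookup (g * h) \<mu>"
      by (simp add: lookup_add lookup_ex_mult)
    moreover have "keys_below (0 + ht \<mu>) (g * h)"
      by (rule keys_below_mult[OF g]) (use m in blast)
    then have "\<mu> \<notin> Poly_Mapping.keys (g * h)"
      unfolding keys_below_def by force
    then have "Poly_Mapping.lookup (g * h) \<mu> = 0"
      by (simp add: in_keys_iff)
    ultimately have "rho + \<mu> \<in> Poly_Mapping.keys (Alt (ex rho))"
      using \<mu> by (simp add: in_keys_iff)
    then obtain w where w: "w \<in> W" "rho + \<mu> = act_wt w rho"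
      using Alt_keys by blast
    have "ht rho + ht \<mu> \<le> ht rho \<and> (ht rho + ht \<mu> = ht rho \<longrightarrow> rho + \<mu> = rho)"
      using ht_act_le[OF dom w(1)] unfolding w(2)[symmetric] ht_add .
    then show ?thesis by simp
  qed
  have keys0: "\<mu> = 0" if \<mu>: "\<mu> \<in> Poly_Mapping.keys h" for \<mu>
  proof -
    let ?H = "ht ` Poly_Mapping.keys h"
    have "Max ?H \<in> ?H"
      using \<mu> by (intro Max_in) auto
    then obtain \<nu> where \<nu>: "\<nu> \<in> Poly_Mapping.keys h" "ht \<nu> = Max ?H" by auto
    have m: "ht \<kappa> \<le> ht \<nu>" if "\<kappa> \<in> Poly_Mapping.keys h" for \<kappa>
      unfolding \<nu>(2) using that by (intro Max_ge) auto
    have n0: "ht \<nu> \<le> 0"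
      using top[OF \<nu>(1) m] by blast
    \<comment> \<open>The longest element negates heights, so an upper bound for heights of weights
      of \<open>h\<close> is also a lower bound.\<close>
    have "act_wt rev5 \<mu> \<in> Poly_Mapping.keys h"
    proof -
      have "act rev5 h = h"
        using invariant_pairing[of "ex rho" 1] rev5_W unfolding h_def invariant_def by blast
      then show ?thesis
        using keys_act[OF rev5_W \<mu>] by simp
    qed
    moreover have "ht (act_wt rev5 \<mu>) = - ht \<mu>"
      by (cases \<mu>) (simp add: act_rev5)
    ultimately have "- ht \<mu> \<le> ht \<nu>" "ht \<mu> \<le> ht \<nu>"
      using m[of "act_wt rev5 \<mu>"] m[OF \<mu>] by simp_all
    then have z: "ht \<mu> = 0" "ht \<nu> = 0"
      using n0 by linarith+
    have "ht \<kappa> \<le> ht \<mu>" if "\<kappa> \<in> Poly_Mapping.keys h" for \<kappa>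
      using m[OF that] z by simp
    then show ?thesis
      using top[OF \<mu>] z(1) by blast
  qed
  have "Poly_Mapping.lookup h 0 = 1"
  proof -
    have dh: "weyl_denom * h = ex rho * h + ex rho * (g * h)"
      unfolding d by (simp add: algebra_simps)
    have l: "Poly_Mapping.lookup (ex rho * f) rho = Poly_Mapping.lookup f 0" for f
      using lookup_ex_mult[of rho f 0] by simp
    have "keys_below (0 + 0) (g * h)"
      by (rule keys_below_mult[OF g], rule ballI, drule keys0) simp
    then have "0 \<notin> Poly_Mapping.keys (g * h)"
      unfolding keys_below_def by force
    then have "Poly_Mapping.lookup (g * h) 0 = 0"
      by (simp add: in_keys_iff)
    then have "Poly_Mapping.lookup (Alt (ex rho)) rho = Poly_Mapping.lookup h 0"
      unfolding h[symmetric] dh by (simp add: lookup_add l)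
    moreover have "Poly_Mapping.lookup (Alt (ex rho)) rho = (\<Sum>w\<in>{id}. sign w)"
    proof -
      have "Poly_Mapping.lookup (Alt (ex rho)) rho = (\<Sum>w\<in>W. if act_wt w rho = rho then sign w else 0)"
        unfolding Alt_def act_ex lookup_sum lookup_of_int_ex ..
      also have "\<dots> = (\<Sum>w\<in>W. if w = id then sign w else 0)"
      proof (rule sum.cong[OF refl])
        fix w
        assume "w \<in> W"
        then show "(if act_wt w rho = rho then sign w else 0) = (if w = id then sign w else 0)"
          using act_rho_inj[of w] by (cases "w = id") auto
      qed
      also have "\<dots> = (\<Sum>w\<in>{id}. sign w)"
        by simp
      finally show ?thesis .
    qed
    ultimately show ?thesis
      by (simp add: sign_id)
  qed
  moreover have "Poly_Mapping.lookup h k = 0" if "k \<noteq> 0" for k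
    using keys0[of k] that by (auto simp: in_keys_iff)
  ultimately have "h = 1"
    by (intro poly_mapping_eqI) (simp add: lookup_one when_def)
  then show ?thesis
    using h by simp
qed

section \<open>The virtual dimension\<close>

text \<open>The linear functional with value \<open>\<phi> \<mu>\<close> at \<open>ex \<mu>\<close>.
  For polynomial \<open>\<phi>\<close> it acts like a differential operator evaluated at the
  identity of the torus.\<close>

definition eval_fun :: "(weight \<Rightarrow> int) \<Rightarrow> ZT \<Rightarrow> int" where
  "eval_fun \<phi> f = (\<Sum>\<mu>\<in>Poly_Mapping.keys f. Poly_Mapping.lookup f \<mu> * \<phi> \<mu>)"

lemma eval_fun_superset:
  assumes "finite A" "Poly_Mapping.keys f \<subseteq> A"
  shows "eval_fun \<phi> f = (\<Sum>\<mu>\<in>A. Poly_Mapping.lookup f \<mu> * \<phi> \<mu>)"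
  unfolding eval_fun_def
  by (rule sum.mono_neutral_left) (use assms in \<open>auto simp: not_in_keys_iff_lookup_eq_zero\<close>)

lemma eval_fun_add: "eval_fun \<phi> (f + g) = eval_fun \<phi> f + eval_fun \<phi> g"
proof -
  let ?A = "Poly_Mapping.keys f \<union> Poly_Mapping.keys g"
  have "Poly_Mapping.keys (f + g) \<subseteq> ?A"
    by (rule keys_add)
  then show ?thesis
    by (simp add: eval_fun_superset[of ?A] lookup_add distrib_right sum.distrib)
qed

lemma eval_fun_0 [simp]: "eval_fun \<phi> 0 = 0"
  by (simp add: eval_fun_def)

lemma eval_fun_uminus: "eval_fun \<phi> (- f) = - eval_fun \<phi> f"
  using eval_fun_add[of \<phi> f "- f"] by simp

lemma eval_fun_diff: "eval_fun \<phi> (f - g) = eval_fun \<phi> f - eval_fun \<phi> g"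
  using eval_fun_add[of \<phi> f "- g"] by (simp add: eval_fun_uminus)

lemma eval_fun_sum: "eval_fun \<phi> (\<Sum>i\<in>A. f i) = (\<Sum>i\<in>A. eval_fun \<phi> (f i))"
  by (induction A rule: infinite_finite_induct) (simp_all add: eval_fun_add)

lemma eval_fun_ex [simp]: "eval_fun \<phi> (ex \<mu>) = \<phi> \<mu>"
  by (simp add: eval_fun_def ex_def)

lemma eval_fun_scale: "eval_fun \<phi> (of_int c * f) = c * eval_fun \<phi> f"
proof (induction f rule: poly_mapping_induct)
  case (single x d)
  show ?case
    by (simp add: eval_fun_def mult_single lookup_single flip: single_of_int)
qed (simp_all add: distrib_left eval_fun_add)

lemma eval_fun_ex_mult: "eval_fun \<phi> (ex \<mu> * f) = eval_fun (\<lambda>\<nu>. \<phi> (\<mu> + \<nu>)) f"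
  by (induction f rule: ZT_induct)
    (simp_all add: distrib_left eval_fun_add ex_mult eval_fun_scale mult.left_commute[of "ex \<mu>"])

lemma eval_fun_act: "eval_fun \<phi> (act w f) = eval_fun (\<lambda>\<nu>. \<phi> (act_wt w \<nu>)) f"
  by (induction f rule: ZT_induct) (simp_all add: eval_fun_add eval_fun_scale)

lemma eval_fun_cmult: "eval_fun (\<lambda>\<nu>. c * \<phi> \<nu>) f = c * eval_fun \<phi> f"
  by (simp add: eval_fun_def sum_distrib_left mult.left_commute)

lemma vdim_eval: "vdim f = eval_fun (\<lambda>_. 1) f"
  by (simp add: vdim_def eval_fun_def)

lemma vdim_simps [simp]: "vdim 0 = 0" "vdim 1 = 1" "vdim (f + g) = vdim f + vdim g" "vdim (f - g) = vdim f - vdim g"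
    "vdim (- f) = - vdim f" "vdim (ex \<mu>) = 1"
  using eval_fun_ex[of "\<lambda>_. 1" 0]
  by (simp_all add: vdim_eval eval_fun_add eval_fun_diff eval_fun_uminus)

lemma vdim_mult [simp]: "vdim (f * g) = vdim f * vdim g"
proof (induction f rule: ZT_induct)
  case (ex \<mu>)
  show ?case by (simp add: vdim_eval eval_fun_ex_mult)
qed (simp_all add: distrib_right vdim_eval eval_fun_add eval_fun_scale mult.assoc)

lemma vdim_sum: "vdim (\<Sum>i\<in>A. f i) = (\<Sum>i\<in>A. vdim (f i))"
  by (simp add: vdim_eval eval_fun_sum)

text \<open>Polynomial functions of degree at most \<open>n\<close> on the weight lattice, in terms of iterated
  differences.\<close>

fun deg_le :: "nat \<Rightarrow> (weight \<Rightarrow> int) \<Rightarrow> bool" where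
  "deg_le 0 \<phi> \<longleftrightarrow> (\<forall>\<mu> \<nu>. \<phi> \<mu> = \<phi> \<nu>)"
| "deg_le (Suc n) \<phi> \<longleftrightarrow> (\<forall>\<alpha>. deg_le n (\<lambda>\<mu>. \<phi> \<mu> - \<phi> (\<mu> + \<alpha>)))"

lemma deg_le_shift: "deg_le n \<phi> \<Longrightarrow> deg_le n (\<lambda>\<mu>. \<phi> (\<beta> + \<mu>))"
proof (induction n arbitrary: \<phi>)
  case 0
  then show ?case by simp
next
  case (Suc n)
  then have "deg_le n (\<lambda>\<mu>. \<phi> (\<beta> + \<mu>) - \<phi> (\<beta> + \<mu> + \<alpha>))" for \<alpha>
    using Suc.IH[of "\<lambda>\<mu>. \<phi> \<mu> - \<phi> (\<mu> + \<alpha>)"] by simp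
  then show ?case by (simp add: add.assoc)
qed

lemma deg_le_zero: "deg_le n (\<lambda>_. 0)"
  by (induction n) simp_all

lemma deg_le_Suc: "deg_le n \<phi> \<Longrightarrow> deg_le (Suc n) \<phi>"
proof (induction n arbitrary: \<phi>)
  case 0
  then have "\<phi> \<mu> - \<phi> (\<mu> + \<alpha>) = 0" for \<mu> \<alpha>
    using 0[unfolded deg_le.simps, rule_format, of \<mu> "\<mu> + \<alpha>"] by simp
  then show ?case by simp
next
  case (Suc n)
  have "deg_le (Suc n) (\<lambda>\<mu>. \<phi> \<mu> - \<phi> (\<mu> + \<alpha>))" for \<alpha>
    using Suc.prems by (intro Suc.IH) simp
  then show ?case
    by (subst deg_le.simps(2)) blast
qed

lemma deg_le_add: "deg_le n \<phi> \<Longrightarrow> deg_le n \<psi> \<Longrightarrow> deg_le n (\<lambda>\<mu>. \<phi> \<mu> + \<psi> \<mu>)"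
proof (induction n arbitrary: \<phi> \<psi>)
  case 0
  then show ?case unfolding deg_le.simps by metis
next
  case (Suc n)
  have "deg_le n (\<lambda>\<mu>. (\<phi> \<mu> - \<phi> (\<mu> + \<alpha>)) + (\<psi> \<mu> - \<psi> (\<mu> + \<alpha>)))" for \<alpha>
    using Suc.prems by (intro Suc.IH) simp_all
  then show ?case by (simp add: algebra_simps)
qed

text \<open>Discrete Leibniz rule: the difference of the product is the sum of a difference of
  \<open>\<phi>\<close> times \<open>\<psi>\<close> and a shift of \<open>\<phi>\<close> times a
  difference of \<open>\<psi>\<close>.\<close>

lemma deg_le_mult: "deg_le m \<phi> \<Longrightarrow> deg_le n \<psi> \<Longrightarrow> deg_le (m + n) (\<lambda>\<mu>. \<phi> \<mu> * \<psi> \<mu>)"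
proof (induction "m + n" arbitrary: m n \<phi> \<psi> rule: less_induct)
  case less
  have const: "\<exists>c. \<forall>\<mu>. \<chi> \<mu> = c" if "deg_le 0 \<chi>" for \<chi> :: "weight \<Rightarrow> int"
    using that by auto
  have scale: "deg_le k \<chi> \<Longrightarrow> deg_le k (\<lambda>\<mu>. c * \<chi> \<mu>)" for k c and \<chi> :: "weight \<Rightarrow> int"
  proof (induction k arbitrary: \<chi>)
    case 0
    then show ?case unfolding deg_le.simps by metis
  next
    case (Suc k)
    have "deg_le k (\<lambda>\<mu>. c * (\<chi> \<mu> - \<chi> (\<mu> + \<alpha>)))" for \<alpha>
      using Suc.prems by (intro Suc.IH) simp
    then show ?case by (simp add: right_diff_distrib)
  qed
  show ?case
  proof (cases m)
    case 0
    then obtain c where "\<And>\<mu>. \<phi> \<mu> = c"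
      using const[of \<phi>] less.prems by auto
    then show ?thesis
      using scale[OF less.prems(2), of c] 0 by simp
  next
    case m: (Suc m')
    show ?thesis
    proof (cases n)
      case 0
      then obtain c where "\<And>\<mu>. \<psi> \<mu> = c"
        using const[of \<psi>] less.prems by auto
      then show ?thesis
        using scale[OF less.prems(1), of c] 0 by (simp add: mult.commute)
    next
      case n: (Suc n')
      have "deg_le (m' + n) (\<lambda>\<mu>. (\<phi> \<mu> - \<phi> (\<mu> + \<alpha>)) * \<psi> \<mu> + \<phi> (\<alpha> + \<mu>) * (\<psi> \<mu> - \<psi> (\<mu> + \<alpha>)))" for \<alpha>
      proof (rule deg_le_add)
        show "deg_le (m' + n) (\<lambda>\<mu>. (\<phi> \<mu> - \<phi> (\<mu> + \<alpha>)) * \<psi> \<mu>)"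
          using less.prems m by (intro less.hyps) simp_all
        have "deg_le (m + n') (\<lambda>\<mu>. \<phi> (\<alpha> + \<mu>) * (\<psi> \<mu> - \<psi> (\<mu> + \<alpha>)))"
          using less.prems n by (intro less.hyps deg_le_shift) simp_all
        then show "deg_le (m' + n) (\<lambda>\<mu>. \<phi> (\<alpha> + \<mu>) * (\<psi> \<mu> - \<psi> (\<mu> + \<alpha>)))"
          using m n by simp
      qed
      then show ?thesis
        using m by (simp add: algebra_simps)
    qed
  qed
qed

text \<open>Multiplication by \<open>1 - ex (- \<alpha>)\<close> amounts to a difference operator on
  \<open>\<phi>\<close>. After as many differences as the degree a constant is left, which sees only
  the virtual dimension of \<open>h\<close>.\<close>

lemma eval_fun_prod_differences:
  assumes "finite F"
  shows "deg_le (card F) \<phi> \<Longrightarrow> eval_fun \<phi> ((\<Prod>\<alpha>\<in>F. 1 - ex (- \<alpha>)) * h) = eval_fun \<phi> (\<Prod>\<alpha>\<in>F. 1 - ex (- \<alpha>)) * vdim h"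
  using assms
proof (induction F arbitrary: \<phi> rule: finite_induct)
  case empty
  then obtain c where "\<And>\<mu>. \<phi> \<mu> = c * 1" by auto
  then have "\<phi> = (\<lambda>\<mu>. c * 1)" by auto
  then show ?case
    using eval_fun_ex[of \<phi> 0] eval_fun_cmult[of c "\<lambda>_. 1" h] by (simp add: vdim_eval)
next
  case (insert \<alpha> F)
  have *: "eval_fun \<phi> ((1 - ex (- \<alpha>)) * f) = eval_fun (\<lambda>\<mu>. \<phi> \<mu> - \<phi> (\<mu> + - \<alpha>)) f" for f
  proof -
    have "eval_fun \<phi> ((1 - ex (- \<alpha>)) * f) = eval_fun \<phi> f - eval_fun (\<lambda>\<mu>. \<phi> (- \<alpha> + \<mu>)) f"
      by (simp add: left_diff_distrib eval_fun_diff eval_fun_ex_mult)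
    then show ?thesis
      by (simp add: eval_fun_def right_diff_distrib sum_subtractf add.commute)
  qed
  have "\<forall>\<beta>. deg_le (card F) (\<lambda>\<mu>. \<phi> \<mu> - \<phi> (\<mu> + \<beta>))"
    using insert.prems insert.hyps by simp
  then have "deg_le (card F) (\<lambda>\<mu>. \<phi> \<mu> - \<phi> (\<mu> + - \<alpha>))"
    by (rule spec)
  from insert.IH[OF this] show ?case
    using insert.hyps by (simp add: mult.assoc *)
qed

text \<open>The numerator of Weyl's dimension formula, the product over the ten positive coroots,
  written as a Vandermonde product in the coordinates \<open>eps\<close>.\<close>

definition Dt :: "weight \<Rightarrow> int" where
  "Dt \<mu> = (eps \<mu> 1 - eps \<mu> 2) * (eps \<mu> 1 - eps \<mu> 3) * (eps \<mu> 1 - eps \<mu> 4) * (eps \<mu> 1 - eps \<mu> 5)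
    * (eps \<mu> 2 - eps \<mu> 3) * (eps \<mu> 2 - eps \<mu> 4) * (eps \<mu> 2 - eps \<mu> 5)
    * (eps \<mu> 3 - eps \<mu> 4) * (eps \<mu> 3 - eps \<mu> 5) * (eps \<mu> 4 - eps \<mu> 5)"

lemma Dt_eq: "Dt (a, b, c, d) =
  a * (a + b) * (a + b + c) * (a + b + c + d) * b * (b + c) * (b + c + d) * c * (c + d) * d"
  by (simp add: Dt_def)

lemma Dt_act_s:
  assumes "i \<in> {1..4}"
  shows "Dt (act_wt (s i) \<mu>) = - Dt \<mu>"
proof -
  obtain a b c d where \<mu>: "\<mu> = (a, b, c, d)"
    by (cases \<mu>)
  consider "i = 1" | "i = 2" | "i = 3" | "i = 4"
    using assms by force
  then show ?thesis
    by cases (simp_all add: \<mu> act_wt_s Dt_eq, simp_all add: ac_simps)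
qed

lemma Dt_act: "w \<in> W \<Longrightarrow> Dt (act_wt w \<mu>) = sign w * Dt \<mu>"
proof (induction rule: W_induct)
  case id
  show ?case by (simp add: act_wt_id[unfolded id_def] sign_id[unfolded id_def])
next
  case (step w i)
  then have "Dt (act_wt (s i \<circ> w) \<mu>) = sign (s i \<circ> w) * Dt \<mu>"
    using act_wt_comp[of "s i" w \<mu>] Dt_act_s[of i "act_wt w \<mu>"] sign_comp_W[of "s i" w] by simp
  then show ?case by (simp add: o_def)
qed

lemma deg_le_Dt: "deg_le 10 (\<lambda>\<mu>. Dt (\<beta> + \<mu>))"
proof -
  have "deg_le (Suc 0) (\<lambda>\<mu>. eps \<mu> i - eps \<mu> j)" for i j
    by (simp add: eps_add)
  then have l: "deg_le 1 (\<lambda>\<mu>. eps \<mu> i - eps \<mu> j)" for i j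
    by (simp add: One_nat_def)
  have "deg_le (1 + 1 + 1 + 1 + 1 + 1 + 1 + 1 + 1 + 1) Dt"
    unfolding Dt_def by (intro deg_le_mult l)
  then have "deg_le 10 Dt"
    by simp
  then show ?thesis
    by (rule deg_le_shift)
qed

lemma card_W: "card W = 120"
  by (simp add: W_def card_permutations fact_numeral)

text \<open>\<open>Dt\<close> applied to \<open>weyl_denom * h\<close> gives a constant times
  \<open>vdim h\<close>; applied to an alternating sum it gives 120 times its value, since
  \<open>Dt\<close> is itself alternating and \<open>card W = 120\<close>. The denominator formula
  fixes the constant as 120 times \<open>Dt rho = 288\<close>.\<close>

lemma vdim_pairing: "288 * vdim (pairing f g) = eval_fun Dt (f * g)"
proof -
  define c where "c = eval_fun (\<lambda>\<mu>. Dt (rho + \<mu>)) (\<Prod>\<alpha>\<in>pos_roots. 1 - ex (- \<alpha>))"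
  have card: "card pos_roots = 10"
    using nu_eq by (simp add: nu_def)
  have d: "eval_fun Dt (weyl_denom * h) = c * vdim h" for h
    unfolding weyl_denom_def mult.assoc eval_fun_ex_mult rho_def[symmetric] c_def
    by (rule eval_fun_prod_differences) (simp_all add: card deg_le_Dt)
  have A: "eval_fun Dt (Alt h) = 120 * eval_fun Dt h" for h
  proof -
    have "eval_fun Dt (Alt h) = (\<Sum>w\<in>W. sign w * eval_fun (\<lambda>\<mu>. Dt (act_wt w \<mu>)) h)"
      by (simp add: Alt_def eval_fun_sum eval_fun_scale eval_fun_act)
    also have "\<dots> = (\<Sum>w\<in>W. eval_fun Dt h)"
      by (intro sum.cong refl) (simp add: Dt_act eval_fun_cmult flip: mult.assoc)
    finally show ?thesis
      by (simp add: card_W)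
  qed
  have "c = 120 * Dt rho"
    using d[of 1] A[of "ex rho"] by (simp add: Alt_rho)
  then have c: "c = 120 * 288"
    by (simp add: rho_eq Dt_def)
  have "c * vdim (pairing f g) = 120 * eval_fun Dt (f * g)"
    using d[of "pairing f g"] A[of "f * g"] by (simp add: pairing_Alt)
  then show ?thesis
    unfolding c by simp
qed

section \<open>Stabilizers of weights\<close>

definition asc_wt :: "perm \<Rightarrow> weight" where "asc_wt w = fund_sum ({1..4} - right_descents w)"

text \<open>Complementary to \<open>asc_wt\<close>, the weight in the definition of
  \<open>f_basis\<close>: the two add up to \<open>rho\<close>, which makes the diagonal pairings
  nonzero.\<close>

definition desc_wt :: "perm \<Rightarrow> weight" where "desc_wt w = fund_sum (right_descents w)"

definition stab :: "weight \<Rightarrow> perm set" where "stab \<mu> = {u \<in> W. act_wt u \<mu> = \<mu>}"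

lemma fund_sum_eq:
  "finite I \<Longrightarrow> fund_sum I = (of_bool (1 \<in> I), of_bool (2 \<in> I), of_bool (3 \<in> I), of_bool (4 \<in> I))"
proof (induction I rule: finite_induct)
  case empty
  show ?case by (simp add: fund_sum_def zero_prod_def)
next
  case (insert x F)
  then have "fund_sum (insert x F) = fund x + (of_bool (1 \<in> F), of_bool (2 \<in> F), of_bool (3 \<in> F), of_bool (4 \<in> F))"
    by (simp add: fund_sum_def)
  then show ?case
    using insert.hyps(2) by (cases "x = 1"; cases "x = 2"; cases "x = 3"; cases "x = 4") (simp_all add: fund_def)
qed

lemma eps_fund_sum_diff:
  assumes "finite I" "k \<in> {1..4}"
  shows "eps (fund_sum I) k - eps (fund_sum I) (Suc k) = of_bool (k \<in> I)"
  using assms(2) unfolding fund_sum_eq[OF assms(1)] atLeastAtMost_1_4 by (elim insertE emptyE) simp_all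

lemma dominant_fund_sum: "finite I \<Longrightarrow> dominant (fund_sum I)"
  by (simp add: fund_sum_eq dominant_iff)

lemma finite_right_descents [simp]: "finite (right_descents w)" and right_descents_subset: "right_descents w \<subseteq> {1..4}"
  by (auto simp: right_descents_def)

lemma asc_desc: "asc_wt w + desc_wt w = rho"
  unfolding asc_wt_def desc_wt_def rho_def fund_sum_def
  using sum.subset_diff[OF right_descents_subset[of w], of fund] by simp

lemma dominant_asc: "dominant (asc_wt w)" and dominant_desc: "dominant (desc_wt w)"
  by (simp_all add: asc_wt_def desc_wt_def dominant_fund_sum)

lemma id_stab [simp]: "id \<in> stab \<mu>"
  by (simp add: stab_def)

lemma stab_W: "u \<in> stab \<mu> \<Longrightarrow> u \<in> W"
  by (simp add: stab_def)

lemma stab_comp: "u \<in> stab \<mu> \<Longrightarrow> v \<in> stab \<mu> \<Longrightarrow> u \<circ> v \<in> stab \<mu>"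
  by (simp add: stab_def act_wt_comp)

lemma stab_inv: "u \<in> stab \<mu> \<Longrightarrow> inv u \<in> stab \<mu>"
  using act_wt_comp[of "inv u" u \<mu>] by (simp add: stab_def)

lemma finite_stab [simp]: "finite (stab \<mu>)"
  by (rule finite_subset[OF _ finite_W]) (auto simp: stab_def)

lemma stab_eps:
  assumes u: "u \<in> stab \<mu>" and i: "i \<in> {1..5}" and j: "j \<in> {1..5}"
  shows "eps \<mu> (u i) - eps \<mu> (u j) = eps \<mu> i - eps \<mu> j"
proof -
  have uW: "u \<in> W" and e: "act_wt u \<mu> = \<mu>"
    using u by (simp_all add: stab_def)
  have "eps \<mu> (u k) = eps \<mu> k - eps \<mu> (inv u 5)" if "k \<in> {1..5}" for k
    using eps_act_wt[OF uW W_range[OF uW that], of \<mu>] uW by (simp add: e)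
  from this[OF i] this[OF j] show ?thesis by simp
qed

lemma stab_descents:
  assumes "u \<in> stab (fund_sum I)" "finite I" "k \<in> {1..4}" "rd u k"
  shows "k \<notin> I"
proof
  assume k: "k \<in> I"
  have uW: "u \<in> W"
    using assms(1) by (rule stab_W)
  have r: "k \<in> {1..5}" "Suc k \<in> {1..5}"
    using assms(3) by auto
  have "eps (fund_sum I) (u k) \<le> eps (fund_sum I) (u (Suc k))"
    using W_range[OF uW r(1)] W_range[OF uW r(2)] assms(4)
    by (intro dominant_antimono[OF dominant_fund_sum[OF assms(2)]]) (auto simp: rd_def)
  then show False
    using stab_eps[OF assms(1) r] eps_fund_sum_diff[OF assms(2,3)] k by simp
qed

lemma s_stab:
  assumes "finite I" "k \<in> {1..4}" "k \<notin> I"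
  shows "s k \<in> stab (fund_sum I)"
  using act_wt_s_fixed[OF assms(2), of "fund_sum I"] eps_fund_sum_diff[OF assms(1,2)] assms by (simp add: stab_def)

text \<open>The stabilizer of a dominant weight is generated by simple reflections: a right descent
  of a stabilizing element is itself a reflection in the stabilizer, and removing it shortens the
  element.\<close>

lemma stab_induct [consumes 2, case_names id step]:
  assumes "u \<in> stab (fund_sum I)" "finite I" "Q id"
    and step: "\<And>u k. u \<in> stab (fund_sum I) \<Longrightarrow> k \<in> {1..4} \<Longrightarrow> k \<notin> I \<Longrightarrow> \<not> rd u k \<Longrightarrow> Q u \<Longrightarrow> Q (u \<circ> s k)"
  shows "Q u"
  using assms(1)
proof (induction "len u" arbitrary: u rule: less_induct)
  case less
  have uW: "u \<in> W"
    using less.prems by (rule stab_W)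
  show ?case
  proof (cases "u = id")
    case False
    then obtain k where k: "k \<in> {1..4}" "\<not> u k < u (Suc k)"
      using no_descent_id[OF uW] by blast
    then have r: "rd u k"
      using W_inj_eq[OF uW, of k "Suc k"] by (auto simp: rd_def)
    have kI: "k \<notin> I"
      by (rule stab_descents[OF less.prems assms(2) k(1) r])
    have st: "u \<circ> s k \<in> stab (fund_sum I)"
      by (rule stab_comp[OF less.prems s_stab[OF assms(2) k(1) kI]])
    have l: "len u = Suc (len (u \<circ> s k))"
      by (rule len_s_right(1)[OF uW k(1) r])
    have nr: "\<not> rd (u \<circ> s k) k"
      using r by (simp add: rd_def s_apply)
    have "Q (u \<circ> s k)"
      using less.hyps[OF _ st] l by simp
    then have "Q (u \<circ> s k \<circ> s k)"
      using step[OF st k(1) kI nr] by blast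
    then show ?thesis by simp
  qed (use assms(3) in simp)
qed

text \<open>Trades the existence of a word for an equation on weights, which can be evaluated on
  tuples.\<close>

lemma parabolic_eq_stab:
  assumes "I \<subseteq> {1..4}"
  shows "parabolic I = stab (fund_sum ({1..4} - I))"
proof (intro equalityI subsetI)
  fix u
  assume "u \<in> parabolic I"
  then obtain "is" where "set is \<subseteq> I" "u = sprod is"
    by (auto simp: parabolic_def)
  then show "u \<in> stab (fund_sum ({1..4} - I))"
  proof (induction "is" arbitrary: u)
    case (Cons i "is")
    then have "i \<in> I" "sprod is \<in> stab (fund_sum ({1..4} - I))"
      by auto
    then have "s i \<circ> sprod is \<in> stab (fund_sum ({1..4} - I))"
      using assms by (intro stab_comp s_stab) auto
    then show ?case
      using Cons.prems(2) by (simp add: o_def)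
  qed simp
next
  fix u
  assume "u \<in> stab (fund_sum ({1..4} - I))"
  then show "u \<in> parabolic I"
  proof (rule stab_induct)
    have "sprod [] \<in> parabolic I"
      unfolding parabolic_def by (rule CollectI, rule exI[of _ "[]"]) simp
    then show "id \<in> parabolic I" by simp
  next
    fix u k
    assume k: "k \<in> {1..4::nat}" "k \<notin> {1..4} - I" and "u \<in> parabolic I"
    then obtain "is" where "set is \<subseteq> I" "u = sprod is"
      by (auto simp: parabolic_def)
    then show "u \<circ> s k \<in> parabolic I"
      using k unfolding parabolic_def by (intro CollectI exI[of _ "is @ [k]"]) auto
  qed simp
qed

lemma C'_stab:
  assumes "w \<in> W" "y \<in> W" "u \<in> stab (asc_wt w)"
  shows "C' w (y \<circ> u) = C' w y"
  using assms(3) unfolding asc_wt_def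
proof (rule stab_induct)
  fix u k
  assume u: "u \<in> stab (fund_sum ({1..4} - right_descents w))" "k \<in> {1..4}" "k \<notin> {1..4} - right_descents w"
    and IH: "C' w (y \<circ> u) = C' w y"
  have "rd w k"
    using u(2,3) right_descents_eq[OF assms(1)] by simp
  then have "C' w ((y \<circ> u) \<circ> s k) = C' w (y \<circ> u)"
    using C'_right_invariant[OF assms(1) u(2)] assms(2) stab_W[OF u(1)] by simp
  then show "C' w (y \<circ> (u \<circ> s k)) = C' w y"
    by (simp add: IH o_assoc)
qed simp_all

text \<open>Positions with equal coordinates of \<open>desc_wt v\<close> form an interval without
  descents, on which \<open>v\<close> increases.\<close>

lemma block_mono:
  assumes v: "v \<in> W" and "1 \<le> i" "i < j" "j \<le> 5" "eps (desc_wt v) i = eps (desc_wt v) j"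
  shows "v i < v j"
proof -
  have "i \<le> j" using assms by simp
  then have "j \<le> 5 \<longrightarrow> eps (desc_wt v) i = eps (desc_wt v) j \<longrightarrow> i < j \<longrightarrow> v i < v j"
  proof (induction j rule: dec_induct)
    case (step n)
    show ?case
    proof (intro impI)
      assume n: "Suc n \<le> 5" and e: "eps (desc_wt v) i = eps (desc_wt v) (Suc n)"
      have n4: "n \<in> {1..4}"
        using n step.hyps assms(2) by simp
      have "eps (desc_wt v) (Suc n) \<le> eps (desc_wt v) n" "eps (desc_wt v) n \<le> eps (desc_wt v) i"
        using n step.hyps assms(2) by (auto intro!: dominant_antimono[OF dominant_desc])
      then have e': "eps (desc_wt v) n = eps (desc_wt v) (Suc n)" "eps (desc_wt v) i = eps (desc_wt v) n"
        using e by simp_all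
      then have "n \<notin> right_descents v"
        using eps_fund_sum_diff[OF finite_right_descents n4, of v] unfolding desc_wt_def by auto
      then have "\<not> rd v n"
        using n4 right_descents_eq[OF v] by simp
      then have "v n < v (Suc n)"
        using W_inj_eq[OF v, of n "Suc n"] by (auto simp: rd_def)
      then show "v i < v (Suc n)"
        using step.IH n e' step.hyps by (cases "i = n") auto
    qed
  qed simp
  then show ?thesis
    using assms by blast
qed

text \<open>\<open>v\<close> is the unique shortest element of its coset by the stabilizer of
  \<open>desc_wt v\<close>, since it is increasing on the blocks permuted by that
  stabilizer.\<close>

lemma len_stab:
  assumes v: "v \<in> W" and "u \<in> stab (desc_wt v)"
  shows "u = id \<or> len v < len (v \<circ> u)"
proof -
  have "len v \<le> len (v \<circ> u) \<and> (u = id \<or> len v < len (v \<circ> u))"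
    using assms(2) unfolding desc_wt_def
  proof (rule stab_induct)
    fix u k
    assume u: "u \<in> stab (fund_sum (right_descents v))" "k \<in> {1..4}" "k \<notin> right_descents v" "\<not> rd u k"
      and IH: "len v \<le> len (v \<circ> u) \<and> (u = id \<or> len v < len (v \<circ> u))"
    have uW: "u \<in> W"
      using u(1) by (rule stab_W)
    have r: "k \<in> {1..5}" "Suc k \<in> {1..5}"
      using u(2) by auto
    have lt: "u k < u (Suc k)"
      using u(4) W_inj_eq[OF uW, of k "Suc k"] by (auto simp: rd_def)
    have "eps (desc_wt v) (u k) = eps (desc_wt v) (u (Suc k))"
      using stab_eps[OF u(1) r] eps_fund_sum_diff[OF finite_right_descents u(2), of v] u(3) unfolding desc_wt_def by simp
    then have "v (u k) < v (u (Suc k))"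
      using W_range[OF uW r(1)] W_range[OF uW r(2)] lt by (intro block_mono[OF v]) auto
    then have "\<not> rd (v \<circ> u) k"
      by (simp add: rd_def)
    then have "len (v \<circ> u \<circ> s k) = Suc (len (v \<circ> u))"
      using len_s_right(2)[of "v \<circ> u" k] v uW u(2) by simp
    then show "len v \<le> len (v \<circ> (u \<circ> s k)) \<and> (u \<circ> s k = id \<or> len v < len (v \<circ> (u \<circ> s k)))"
      using IH by (simp add: o_assoc)
  qed simp_all
  then show ?thesis by blast
qed

section \<open>Sums over cosets\<close>

lemma sum_cosets:
  fixes F :: "perm \<Rightarrow> 'c :: comm_monoid_add"
  shows "(\<Sum>y\<in>W. F y) = (\<Sum>X\<in>(\<lambda>y. (\<circ>) y ` H) ` W. \<Sum>y\<in>{y\<in>W. (\<circ>) y ` H = X}. F y)"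
  by (rule sum.image_gen[OF finite_W])

locale perm_subgroup =
  fixes H :: "perm set"
  assumes sub: "H \<subseteq> W" and id_H: "id \<in> H"
    and comp_H: "u \<in> H \<Longrightarrow> v \<in> H \<Longrightarrow> u \<circ> v \<in> H" and inv_H: "u \<in> H \<Longrightarrow> inv u \<in> H"
begin

definition cosets :: "perm set set" where "cosets = (\<lambda>y. (\<circ>) y ` H) ` W"

lemma finite_cosets [simp]: "finite cosets"
  by (simp add: cosets_def)

lemma fin: "finite H"
  using sub finite_W by (rule finite_subset)

lemma coset_eq:
  assumes y: "y \<in> W"
  shows "{x \<in> W. (\<circ>) x ` H = (\<circ>) y ` H} = (\<circ>) y ` H"
proof (intro equalityI subsetI)
  fix x
  assume "x \<in> {x \<in> W. (\<circ>) x ` H = (\<circ>) y ` H}"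
  moreover have "x \<circ> id \<in> (\<circ>) x ` H"
    using id_H by (rule imageI)
  ultimately show "x \<in> (\<circ>) y ` H" by simp
next
  fix x
  assume "x \<in> (\<circ>) y ` H"
  then obtain h where h: "h \<in> H" "x = y \<circ> h" by blast
  have hW: "h \<in> W" using h sub by blast
  have "(\<circ>) x ` H = (\<circ>) y ` H"
  proof (intro equalityI subsetI)
    fix z
    assume "z \<in> (\<circ>) x ` H"
    then obtain k where "k \<in> H" "z = y \<circ> (h \<circ> k)"
      using h by (auto simp: o_assoc)
    then show "z \<in> (\<circ>) y ` H"
      using comp_H[OF h(1)] by blast
  next
    fix z
    assume "z \<in> (\<circ>) y ` H"
    then obtain k where k: "k \<in> H" "z = y \<circ> k" by blast
    have "h \<circ> (inv h \<circ> k) = k"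
      using hW by (simp add: o_assoc)
    then have "z = x \<circ> (inv h \<circ> k)"
      using k h by (simp add: o_assoc[symmetric])
    then show "z \<in> (\<circ>) x ` H"
      using comp_H[OF inv_H[OF h(1)] k(1)] by blast
  qed
  then show "x \<in> {x \<in> W. (\<circ>) x ` H = (\<circ>) y ` H}"
    using y h hW by simp
qed

lemma inj_coset: "y \<in> W \<Longrightarrow> inj_on ((\<circ>) y) H"
  by (rule inj_on_inverseI[of _ "(\<circ>) (inv y)"]) (simp add: o_assoc)

lemma card_W_cosets: "card W = card cosets * card H"
proof -
  have "card W = (\<Sum>X\<in>cosets. \<Sum>y\<in>{y\<in>W. (\<circ>) y ` H = X}. 1)"
    using sum_cosets[of "\<lambda>_. 1 :: nat" H] unfolding cosets_def by simp
  also have "\<dots> = (\<Sum>X\<in>cosets. card H)"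
  proof (rule sum.cong[OF refl])
    fix X
    assume "X \<in> cosets"
    then obtain y where "y \<in> W" "X = (\<circ>) y ` H"
      by (auto simp: cosets_def)
    then show "(\<Sum>y\<in>{y\<in>W. (\<circ>) y ` H = X}. 1) = card H"
      by (simp add: coset_eq card_image[OF inj_coset])
  qed
  finally show ?thesis by simp
qed

text \<open>Yields the integrality of \<open>f_basis\<close>: the summands are constant on the
  cosets of the stabilizer by whose order one divides.\<close>

lemma card_dvd_sum:
  fixes F :: "perm \<Rightarrow> 'c :: comm_ring_1"
  assumes "\<And>y h. y \<in> W \<Longrightarrow> h \<in> H \<Longrightarrow> F (y \<circ> h) = F y"
  shows "of_nat (card H) dvd (\<Sum>y\<in>W. F y)"
  unfolding sum_cosets[of F H]
proof (rule dvd_sum)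
  fix X
  assume "X \<in> (\<lambda>y. (\<circ>) y ` H) ` W"
  then obtain y where y: "y \<in> W" "X = (\<circ>) y ` H" by blast
  have "(\<Sum>x\<in>{x\<in>W. (\<circ>) x ` H = X}. F x) = (\<Sum>x\<in>(\<circ>) y ` H. F x)"
    using y coset_eq by simp
  also have "\<dots> = of_nat (card H) * F y"
    using assms[OF y(1)] by (simp add: sum.reindex[OF inj_coset[OF y(1)]])
  finally show "of_nat (card H) dvd (\<Sum>x\<in>{x\<in>W. (\<circ>) x ` H = X}. F x)"
    by simp
qed

end

lemma perm_subgroup_stab: "perm_subgroup (stab \<mu>)"
  by unfold_locales (auto intro: stab_W stab_comp stab_inv)

section \<open>The basis \<open>f\<close> and its pairings\<close>

definition stab_order :: "perm \<Rightarrow> nat" where "stab_order w = card (stab (asc_wt w))"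

lemma stab_order_pos: "stab_order w \<noteq> 0"
  unfolding stab_order_def card_0_eq[OF finite_stab] using id_stab by blast

lemma f_basis_eq:
  assumes w: "w \<in> W"
  shows "of_nat (stab_order w) * f_basis w = gact (C' w) (ex (asc_wt w))"
proof -
  interpret perm_subgroup "stab (asc_wt w)"
    by (rule perm_subgroup_stab)
  have "of_nat (stab_order w) dvd gact (C' w) (ex (asc_wt w))"
    unfolding stab_order_def gact_def
  proof (rule card_dvd_sum)
    fix y h
    assume "y \<in> W" "h \<in> stab (asc_wt w)"
    then show "of_int (C' w (y \<circ> h)) * act (y \<circ> h) (ex (asc_wt w)) = of_int (C' w y) * act y (ex (asc_wt w))"
      using C'_stab[OF w] by (simp add: act_wt_comp stab_def)
  qed
  then obtain h where h: "gact (C' w) (ex (asc_wt w)) = of_nat (stab_order w) * h"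
    by (rule dvdE)
  have "card (parabolic (right_descents w)) = stab_order w"
    unfolding parabolic_eq_stab[OF right_descents_subset] stab_order_def asc_wt_def ..
  then have "f_basis w = h"
    unfolding f_basis_def asc_wt_def[symmetric] using stab_order_pos[of w] h by (intro exact_quot_eq) simp_all
  then show ?thesis
    using h by simp
qed

lemma f_basis_eqI: "w \<in> W \<Longrightarrow> gact (C' w) (ex (asc_wt w)) = of_nat (stab_order w) * h \<Longrightarrow> f_basis w = h"
  using f_basis_eq[of w] stab_order_pos[of w] by simp

definition e_desc :: "perm \<Rightarrow> ZT" where "e_desc v = ex (act_wt v (desc_wt v))"

lemma invariant_of_nat [simp]: "invariant (of_nat n)"
  using invariant_simps(3)[of "int n"] by simp

lemma pairing_f_basis:
  assumes "w \<in> W"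
  shows "of_nat (stab_order w) * pairing (f_basis w) g = (\<Sum>y\<in>W. of_int (C' w y) * pairing (ex (act_wt y (asc_wt w))) g)"
  unfolding pairing_scale_left[OF invariant_of_nat, symmetric] f_basis_eq[OF assms] gact_def pairing_sum_left
  by (intro sum.cong refl) (simp add: pairing_scale_left)

lemma pairing_f_basis_neq_0:
  assumes "w \<in> W" "pairing (f_basis w) (ex \<nu>) \<noteq> 0"
  obtains y where "y \<in> W" "C' w y \<noteq> 0" "Alt (ex (act_wt y (asc_wt w) + \<nu>)) \<noteq> 0"
proof -
  have "of_nat (stab_order w) * pairing (f_basis w) (ex \<nu>) \<noteq> 0"
    using assms(2) stab_order_pos[of w] by simp
  then obtain y where y: "y \<in> W" "of_int (C' w y) * pairing (ex (act_wt y (asc_wt w))) (ex \<nu>) \<noteq> 0"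
    unfolding pairing_f_basis[OF assms(1)] by (rule sum.not_neutral_contains_not_neutral)
  then have "C' w y \<noteq> 0" "pairing (ex (act_wt y (asc_wt w))) (ex \<nu>) \<noteq> 0"
    by auto
  moreover from this(2) have "Alt (ex (act_wt y (asc_wt w) + \<nu>)) \<noteq> 0"
    using pairing_Alt[of "ex (act_wt y (asc_wt w))" "ex \<nu>"] by (auto simp: ex_mult)
  ultimately show ?thesis
    using that y(1) by blast
qed

lemma wclass_add: "wclass (\<mu> + \<nu>) = (wclass \<mu> + wclass \<nu>) mod 5"
proof -
  obtain a b c d where \<mu>: "\<mu> = (a, b, c, d)" by (cases \<mu>)
  obtain a' b' c' d' where \<nu>: "\<nu> = (a', b', c', d')" by (cases \<nu>)
  have e: "(a + a' + 2 * (b + b') + 3 * (c + c') + 4 * (d + d')) = (a + 2 * b + 3 * c + 4 * d) + (a' + 2 * b' + 3 * c' + 4 * d')"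
    by simp
  then show ?thesis
    unfolding \<mu> \<nu> by (simp only: add_Pair wclass.simps e mod_add_eq)
qed

lemma wclass_cancel:
  assumes "wclass (\<kappa> + \<mu>) = wclass (\<kappa> + \<nu>)"
  shows "wclass \<mu> = wclass \<nu>"
proof -
  have r: "0 \<le> wclass \<mu> \<and> wclass \<mu> < 5" for \<mu>
    by (cases \<mu>) simp
  have cancel: "m = n" if "(k + m) mod 5 = (k + n) mod 5" "0 \<le> m \<and> m < 5" "0 \<le> n \<and> n < 5" for k m n :: int
  proof -
    have "5 dvd m - n"
      using that(1) by (simp add: mod_eq_dvd_iff)
    then show ?thesis
      using that(2,3) by presburger
  qed
  show ?thesis
    using assms unfolding wclass_add by (rule cancel[OF _ r r])
qed

text \<open>A surviving weight has a conjugate that is \<open>rho\<close> or has height at least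
  \<open>ht rho + 4\<close>, while its height is at most
  \<open>ht (asc_wt w) + ht (desc_wt v)\<close>. Subtracting \<open>ht (asc_wt w)\<close> leaves the
  claim; in the case of \<open>rho\<close>, comparing classes modulo the root lattice gives the
  congruence.\<close>

lemma N_height:
  assumes "w \<in> W" "v \<in> W" "pairing (f_basis w) (e_desc v) \<noteq> 0"
  shows "ht (desc_wt w) + 4 \<le> ht (desc_wt v) \<or>
    (ht (desc_wt w) \<le> ht (desc_wt v) \<and> wclass (desc_wt w) = wclass (desc_wt v))"
proof -
  obtain y where y: "y \<in> W" "C' w y \<noteq> 0" "Alt (ex (act_wt y (asc_wt w) + act_wt v (desc_wt v))) \<noteq> 0"
    using pairing_f_basis_neq_0[OF assms(1) assms(3)[unfolded e_desc_def]] by blast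
  obtain x where x: "x \<in> W" "act_wt x (act_wt y (asc_wt w) + act_wt v (desc_wt v)) = rho \<or>
      ht (act_wt x (act_wt y (asc_wt w) + act_wt v (desc_wt v))) \<ge> ht rho + 4"
    using Alt_ex_nonzero[OF y(3)] by blast
  have e: "act_wt x (act_wt y (asc_wt w) + act_wt v (desc_wt v)) = act_wt (x \<circ> y) (asc_wt w) + act_wt (x \<circ> v) (desc_wt v)"
    using x y assms(2) by (simp add: act_wt_add act_wt_comp)
  have h: "ht (act_wt (x \<circ> y) (asc_wt w)) \<le> ht (asc_wt w)" "ht (act_wt (x \<circ> v) (desc_wt v)) \<le> ht (desc_wt v)"
    using ht_act_le[OF dominant_asc] ht_act_le[OF dominant_desc] x y assms(2) by auto
  have r: "ht rho = ht (asc_wt w) + ht (desc_wt w)"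
    by (simp add: ht_add flip: asc_desc[of w])
  have c: "wclass (desc_wt w) = wclass (desc_wt v)" if "act_wt x (act_wt y (asc_wt w) + act_wt v (desc_wt v)) = rho"
  proof -
    have "wclass (asc_wt w + desc_wt v) = wclass rho"
      unfolding that[symmetric] e wclass_add using x y assms(2) by (simp add: wclass_act)
    then show ?thesis
      using wclass_cancel[of "asc_wt w" "desc_wt v" "desc_wt w"] unfolding asc_desc[of w, symmetric] by simp
  qed
  show ?thesis
    using x(2)
  proof
    assume a: "act_wt x (act_wt y (asc_wt w) + act_wt v (desc_wt v)) = rho"
    have "ht (act_wt (x \<circ> y) (asc_wt w)) + ht (act_wt (x \<circ> v) (desc_wt v)) = ht rho"
      using arg_cong[OF a, of ht] unfolding e ht_add .
    then have "ht (desc_wt w) \<le> ht (desc_wt v)"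
      using h r by linarith
    then show ?thesis
      using c[OF a] by blast
  next
    assume "ht (act_wt x (act_wt y (asc_wt w) + act_wt v (desc_wt v))) \<ge> ht rho + 4"
    then show ?thesis
      using h r unfolding e ht_add by linarith
  qed
qed

text \<open>With equal descents the height estimate has no slack, so both summands are at their
  maximal heights and the conjugating elements lie in the two stabilizers.\<close>

lemma Alt_same_descents:
  assumes "w \<in> W" "v \<in> W" "y \<in> W" "right_descents w = right_descents v"
    and "Alt (ex (act_wt y (asc_wt w) + act_wt v (desc_wt v))) \<noteq> 0"
  obtains u z where "u \<in> stab (desc_wt v)" "z \<in> stab (asc_wt w)" "y = v \<circ> u \<circ> z"
proof -
  have d: "desc_wt v = desc_wt w"
    using assms(4) by (simp add: desc_wt_def)
  obtain x where x: "x \<in> W" "act_wt x (act_wt y (asc_wt w) + act_wt v (desc_wt v)) = rho \<or>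
      ht (act_wt x (act_wt y (asc_wt w) + act_wt v (desc_wt v))) \<ge> ht rho + 4"
    using Alt_ex_nonzero[OF assms(5)] by blast
  have e: "act_wt x (act_wt y (asc_wt w) + act_wt v (desc_wt v)) = act_wt (x \<circ> y) (asc_wt w) + act_wt (x \<circ> v) (desc_wt v)"
    using x assms(2,3) by (simp add: act_wt_add act_wt_comp)
  have xy: "x \<circ> y \<in> W" "x \<circ> v \<in> W"
    using x assms by auto
  note h = ht_act_le[OF dominant_asc[of w] xy(1)] ht_act_le[OF dominant_desc[of v] xy(2)]
  have r: "ht rho = ht (asc_wt w) + ht (desc_wt v)"
    by (simp add: ht_add d flip: asc_desc[of w])
  have "ht (act_wt (x \<circ> y) (asc_wt w)) + ht (act_wt (x \<circ> v) (desc_wt v)) \<ge> ht rho"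
    using x(2) unfolding e ht_add[symmetric] by (elim disjE) simp_all
  then have "ht (act_wt (x \<circ> y) (asc_wt w)) = ht (asc_wt w)" "ht (act_wt (x \<circ> v) (desc_wt v)) = ht (desc_wt v)"
    using h r by linarith+
  then have "x \<circ> y \<in> stab (asc_wt w)" "x \<circ> v \<in> stab (desc_wt v)"
    using h xy by (simp_all add: stab_def)
  moreover have "y = v \<circ> inv (x \<circ> v) \<circ> (x \<circ> y)"
  proof -
    have "v \<circ> inv (x \<circ> v) \<circ> (x \<circ> y) = (v \<circ> inv v) \<circ> (inv x \<circ> x) \<circ> y"
      using x(1) assms(2) by (simp only: inv_comp_W o_assoc)
    then show ?thesis
      using x(1) assms(2) by simp
  qed
  ultimately show ?thesis
    using that stab_inv by blast
qed

lemma C'_nonzero_coset: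
  assumes "w \<in> W" "v \<in> W" "u \<in> stab (desc_wt v)" "z \<in> stab (asc_wt w)" "C' w (v \<circ> u \<circ> z) \<noteq> 0"
  shows "(v = w \<and> u = id) \<or> len v < len w"
proof -
  have "u \<in> W"
    using assms(3) by (rule stab_W)
  then have "C' w (v \<circ> u) \<noteq> 0"
    using C'_stab[of w "v \<circ> u" z] assms by simp
  then have "v \<circ> u = w \<or> len (v \<circ> u) < len w"
    using C'_0[OF assms(1), of "v \<circ> u"] by (metis not_le)
  then show ?thesis
    using len_stab[OF assms(2,3)] by auto
qed

lemma N_same_descents:
  assumes "w \<in> W" "v \<in> W" "right_descents w = right_descents v" "pairing (f_basis w) (e_desc v) \<noteq> 0"
  shows "v = w \<or> len v < len w"
proof -
  obtain y where y: "y \<in> W" "C' w y \<noteq> 0" "Alt (ex (act_wt y (asc_wt w) + act_wt v (desc_wt v))) \<noteq> 0"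
    using pairing_f_basis_neq_0[OF assms(1) assms(4)[unfolded e_desc_def]] by blast
  obtain u z where "u \<in> stab (desc_wt v)" "z \<in> stab (asc_wt w)" "y = v \<circ> u \<circ> z"
    using Alt_same_descents[OF assms(1,2) y(1) assms(3) y(3)] by blast
  then show ?thesis
    using C'_nonzero_coset[OF assms(1,2)] y(2) by blast
qed

text \<open>Only the coset of \<open>w\<close> by the stabilizer of \<open>asc_wt w\<close>
  contributes. There the product is \<open>act w (ex rho)\<close>, so each member gives
  \<open>sign w\<close> by the denominator formula, and their number is the divisor in
  \<open>f_basis\<close>.\<close>

lemma N_diagonal:
  assumes w: "w \<in> W"
  shows "pairing (f_basis w) (e_desc w) = of_int (sign w)"
proof -
  interpret perm_subgroup "stab (asc_wt w)"
    by (rule perm_subgroup_stab)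
  let ?F = "\<lambda>y. of_int (C' w y) * pairing (ex (act_wt y (asc_wt w))) (e_desc w)"
  have on: "?F y = of_int (sign w)" if y: "y \<in> (\<circ>) w ` stab (asc_wt w)" for y
  proof -
    obtain z where z: "z \<in> stab (asc_wt w)" "y = w \<circ> z"
      using y by blast
    have "act_wt y (asc_wt w) = act_wt w (asc_wt w)"
      using z w act_wt_comp[of w z] by (simp add: stab_def)
    moreover have "pairing (ex (act_wt w (asc_wt w))) (e_desc w) = of_int (sign w)"
    proof (rule pairing_eqI)
      have "ex (act_wt w (asc_wt w)) * e_desc w = act w (ex rho)"
        unfolding e_desc_def asc_desc[of w, symmetric] by (simp add: ex_mult act_wt_add)
      then show "weyl_denom * of_int (sign w) = Alt (ex (act_wt w (asc_wt w)) * e_desc w)"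
        by (simp only: Alt_act[OF w] Alt_rho mult.commute)
    qed
    ultimately show ?thesis
      using C'_stab[OF w w z(1)] w by (simp add: z(2))
  qed
  have off: "?F y = 0" if "y \<in> W - (\<circ>) w ` stab (asc_wt w)" for y
  proof (rule ccontr)
    assume a: "?F y \<noteq> 0"
    then have "C' w y \<noteq> 0" "pairing (ex (act_wt y (asc_wt w))) (e_desc w) \<noteq> 0"
      by auto
    moreover from this(2) have "Alt (ex (act_wt y (asc_wt w) + act_wt w (desc_wt w))) \<noteq> 0"
      using pairing_Alt[of "ex (act_wt y (asc_wt w))" "e_desc w"] by (auto simp: e_desc_def ex_mult)
    moreover have "y \<in> W"
      using that by blast
    ultimately obtain u z where uz: "u \<in> stab (desc_wt w)" "z \<in> stab (asc_wt w)" "y = w \<circ> u \<circ> z"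
      using Alt_same_descents[OF w w _ refl] by blast
    then have "u = id"
      using C'_nonzero_coset[OF w w uz(1,2)] \<open>C' w y \<noteq> 0\<close> by simp
    then show False
      using that uz by auto
  qed
  have "of_nat (stab_order w) * pairing (f_basis w) (e_desc w) = (\<Sum>y\<in>W. ?F y)"
    by (rule pairing_f_basis[OF w])
  also have "\<dots> = (\<Sum>y\<in>(\<circ>) w ` stab (asc_wt w). ?F y)"
    by (rule sum.mono_neutral_right) (use off w in \<open>auto dest: stab_W\<close>)
  also have "\<dots> = (\<Sum>y\<in>(\<circ>) w ` stab (asc_wt w). of_int (sign w))"
    using on by (intro sum.cong refl)
  also have "\<dots> = of_nat (stab_order w) * of_int (sign w)"
    by (simp add: card_image[OF inj_coset[OF w]] stab_order_def)
  finally show ?thesis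
    using stab_order_pos[of w] by simp
qed

text \<open>Lexicographic: first the height of the descent weight, then length with reversed sign,
  since for equal descents a nonzero pairing makes the second element the shorter one.\<close>

definition rk :: "perm \<Rightarrow> int \<times> int" where "rk w = (ht (desc_wt w), - int (len w))"

text \<open>For coordinates 0 and 1 the height determines the sums \<open>a + d\<close> and
  \<open>b + c\<close>; once these are fixed, the class modulo 5 determines \<open>a\<close> and
  \<open>b\<close>.\<close>

lemma ht_wclass_01:
  fixes a b c d a' b' c' d' :: int
  assumes r: "a \<in> {0..1}" "b \<in> {0..1}" "c \<in> {0..1}" "d \<in> {0..1}" "a' \<in> {0..1}" "b' \<in> {0..1}" "c' \<in> {0..1}" "d' \<in> {0..1}"
    and h: "ht (a, b, c, d) = ht (a', b', c', d')" and m: "wclass (a, b, c, d) = wclass (a', b', c', d')"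
  shows "(a, b, c, d) = (a', b', c', d')"
proof -
  have *: "p = 0 \<and> q = 0" if "2 * p + 3 * q = 0" "- 2 \<le> p" "p \<le> 2" "- 2 \<le> q" "q \<le> 2" for p q :: int
    using that by presburger
  have "(a - a') + (d - d') = 0 \<and> (b - b') + (c - c') = 0"
    using r h by (intro *) auto
  then have d: "d' = a + d - a'" "c' = b + c - b'"
    by auto
  have "5 dvd (a + 2 * b + 3 * c + 4 * d) - (a' + 2 * b' + 3 * c' + 4 * d')"
    using m by (simp only: wclass.simps mod_eq_dvd_iff)
  also have "(a + 2 * b + 3 * c + 4 * d) - (a' + 2 * b' + 3 * c' + 4 * d') = - (3 * (a - a') + (b - b'))"
    unfolding d by simp
  finally have 1: "5 dvd 3 * (a - a') + (b - b')"
    by (simp only: dvd_minus_iff)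
  have 2: "i = 0 \<and> j = 0" if "5 dvd 3 * i + j" "- 1 \<le> i" "i \<le> 1" "- 1 \<le> j" "j \<le> 1" for i j :: int
    using that by presburger
  have "a - a' = 0 \<and> b - b' = 0"
    using r by (intro 2[OF 1]) auto
  then show ?thesis
    using d by simp
qed

lemma descents_determined:
  assumes "ht (desc_wt w) = ht (desc_wt v)" "wclass (desc_wt w) = wclass (desc_wt v)"
  shows "right_descents w = right_descents v"
proof -
  have "desc_wt w = desc_wt v"
    using assms unfolding desc_wt_def fund_sum_eq[OF finite_right_descents] by (intro ht_wclass_01) simp_all
  then have "1 \<in> right_descents w \<longleftrightarrow> 1 \<in> right_descents v" "2 \<in> right_descents w \<longleftrightarrow> 2 \<in> right_descents v"
    "3 \<in> right_descents w \<longleftrightarrow> 3 \<in> right_descents v" "4 \<in> right_descents w \<longleftrightarrow> 4 \<in> right_descents v"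
    unfolding desc_wt_def fund_sum_eq[OF finite_right_descents] by (simp_all add: of_bool_eq_iff)
  then have "k \<in> right_descents w \<longleftrightarrow> k \<in> right_descents v" if "k \<in> {1..4}" for k
    using that unfolding atLeastAtMost_1_4 by (elim insertE emptyE) simp_all
  then show ?thesis
    using right_descents_subset by blast
qed

lemma N_triangular:
  assumes "w \<in> W" "v \<in> W" "pairing (f_basis w) (e_desc v) \<noteq> 0"
  shows "v = w \<or> rk w < rk v"
proof (cases "right_descents w = right_descents v")
  case True
  then show ?thesis
    using N_same_descents[OF assms(1,2) True assms(3)] by (auto simp: rk_def desc_wt_def less_prod_def)
next
  case False
  then have "ht (desc_wt w) < ht (desc_wt v)"
    using N_height[OF assms] descents_determined[of w v] False by linarith
  then show ?thesis
    by (simp add: rk_def less_prod_def)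
qed

section \<open>Triangular systems and determinants over an integral domain\<close>

lemma triangular_kernel:
  fixes N :: "'a \<Rightarrow> 'a \<Rightarrow> 'c :: idom" and r :: "'a \<Rightarrow> 'o :: linorder"
  assumes "finite Y" and diag: "\<And>w. w \<in> Y \<Longrightarrow> N w w \<noteq> 0"
    and tri: "\<And>w v. w \<in> Y \<Longrightarrow> v \<in> Y \<Longrightarrow> N w v \<noteq> 0 \<Longrightarrow> v = w \<or> r w < r v"
    and ker: "\<And>v. v \<in> Y \<Longrightarrow> (\<Sum>w\<in>Y. c w * N w v) = 0" and "w \<in> Y"
  shows "c w = 0"
proof (rule ccontr)
  assume "c w \<noteq> 0"
  define Z where "Z = {w \<in> Y. c w \<noteq> 0}"
  have Z: "finite Z" "Z \<noteq> {}"
    using \<open>finite Y\<close> \<open>w \<in> Y\<close> \<open>c w \<noteq> 0\<close> by (auto simp: Z_def)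
  then have "Min (r ` Z) \<in> r ` Z"
    by simp
  then obtain v where v: "v \<in> Z" "r v = Min (r ` Z)" by auto
  have vY: "v \<in> Y" "c v \<noteq> 0"
    using v(1) by (auto simp: Z_def)
  have off: "c u * N u v = 0" if "u \<in> Y - {v}" for u
  proof (rule ccontr)
    assume "c u * N u v \<noteq> 0"
    then have "u \<in> Z" "N u v \<noteq> 0"
      using that by (auto simp: Z_def)
    then have "r u < r v"
      using tri[of u v] that vY(1) by blast
    moreover have "r v \<le> r u"
      unfolding v(2) using Z(1) \<open>u \<in> Z\<close> by (intro Min_le) auto
    ultimately show False by simp
  qed
  have "(\<Sum>u\<in>Y. c u * N u v) = c v * N v v + (\<Sum>u\<in>Y - {v}. c u * N u v)"
    using \<open>finite Y\<close> vY(1) by (rule sum.remove)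
  also have "(\<Sum>u\<in>Y - {v}. c u * N u v) = 0"
    using off by (intro sum.neutral) blast
  finally show False
    using ker[OF vY(1)] diag[OF vY(1)] vY(2) by simp
qed

text \<open>The set \<open>K\<close> carries the invariance through back substitution: the diagonal
  entries are their own inverses, so the solution stays in a subring containing all data.\<close>

lemma triangular_solve:
  fixes N :: "'a \<Rightarrow> 'a \<Rightarrow> 'c :: idom" and r :: "'a \<Rightarrow> 'o :: linorder"
  assumes "finite Y" and diag: "\<And>w. w \<in> Y \<Longrightarrow> N w w * N w w = 1"
    and tri: "\<And>w v. w \<in> Y \<Longrightarrow> v \<in> Y \<Longrightarrow> N w v \<noteq> 0 \<Longrightarrow> v = w \<or> r w < r v"
    and K: "0 \<in> K" "\<And>x y. x \<in> K \<Longrightarrow> y \<in> K \<Longrightarrow> x + y \<in> K" "\<And>x y. x \<in> K \<Longrightarrow> y \<in> K \<Longrightarrow> x - y \<in> K"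
      "\<And>x y. x \<in> K \<Longrightarrow> y \<in> K \<Longrightarrow> x * y \<in> K"
    and NK: "\<And>w v. w \<in> Y \<Longrightarrow> v \<in> Y \<Longrightarrow> N w v \<in> K" and bK: "\<And>v. v \<in> Y \<Longrightarrow> b v \<in> K"
  shows "\<exists>c. (\<forall>w\<in>Y. c w \<in> K) \<and> (\<forall>v\<in>Y. (\<Sum>w\<in>Y. c w * N w v) = b v)"
  using assms(1) diag tri NK bK
proof (induction "card Y" arbitrary: Y)
  case (Suc n)
  have fin: "finite Y" by (rule Suc.prems(1))
  have "Y \<noteq> {}" using Suc.hyps(2) by auto
  then have "Max (r ` Y) \<in> r ` Y"
    using fin by simp
  then obtain z where z: "z \<in> Y" "r z = Max (r ` Y)" by auto
  have zN: "N z v = 0" if "v \<in> Y - {z}" for v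
  proof (rule ccontr)
    assume "N z v \<noteq> 0"
    then have "r z < r v"
      using Suc.prems(3)[OF z(1), of v] that by blast
    moreover have "r v \<le> r z"
      unfolding z(2) using fin that by (intro Max_ge) auto
    ultimately show False by simp
  qed
  have "\<exists>c. (\<forall>w\<in>Y - {z}. c w \<in> K) \<and> (\<forall>v\<in>Y - {z}. (\<Sum>w\<in>Y - {z}. c w * N w v) = b v)"
    using Suc.hyps(2) fin z(1) Suc.prems by (intro Suc.hyps(1)) auto
  then obtain c where c: "\<And>w. w \<in> Y - {z} \<Longrightarrow> c w \<in> K"
    "\<And>v. v \<in> Y - {z} \<Longrightarrow> (\<Sum>w\<in>Y - {z}. c w * N w v) = b v" by blast
  define d where "d = N z z * (b z - (\<Sum>w\<in>Y - {z}. c w * N w z))"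
  have "(\<Sum>w\<in>A. c w * N w z) \<in> K" if "A \<subseteq> Y - {z}" for A
    using that
  proof (induction A rule: infinite_finite_induct)
    case (insert w A)
    then have "c w * N w z \<in> K" "(\<Sum>w\<in>A. c w * N w z) \<in> K"
      using K(4)[OF c(1) Suc.prems(4), of w w z] z(1) by auto
    then show ?case
      using insert.hyps by (simp add: K(2))
  qed (simp_all add: K(1))
  then have "(\<Sum>w\<in>Y - {z}. c w * N w z) \<in> K"
    by blast
  then have dK: "d \<in> K"
    unfolding d_def by (intro K(4)[OF Suc.prems(4)[OF z(1) z(1)]] K(3)[OF Suc.prems(5)[OF z(1)]])
  have s: "(\<Sum>w\<in>Y. (c(z := d)) w * N w v) = d * N z v + (\<Sum>w\<in>Y - {z}. c w * N w v)" for v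
  proof -
    have "(\<Sum>w\<in>Y - {z}. (c(z := d)) w * N w v) = (\<Sum>w\<in>Y - {z}. c w * N w v)"
      by (intro sum.cong refl) auto
    then show ?thesis
      unfolding sum.remove[OF fin z(1)] by simp
  qed
  have "(\<Sum>w\<in>Y. (c(z := d)) w * N w v) = b v" if "v \<in> Y" for v
  proof (cases "v = z")
    case True
    have "d * N z z = (N z z * N z z) * (b z - (\<Sum>w\<in>Y - {z}. c w * N w z))"
      by (simp add: d_def ac_simps)
    then show ?thesis
      unfolding s using Suc.prems(2)[OF z(1)] True by simp
  next
    case False
    then show ?thesis
      unfolding s using c(2) zN that by simp
  qed
  moreover have "\<forall>w\<in>Y. (c(z := d)) w \<in> K"
    using c(1) dK by simp
  ultimately show ?case by blast
qed simp

text \<open>\<open>A\<close> and \<open>B\<close> are square and their product is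
  \<open>\<delta>\<close> times a matrix without kernel, hence has nonzero determinant. Both factors
  are then nonsingular, which gives the two kernel statements.\<close>

lemma product_kernel:
  fixes A :: "'a \<Rightarrow> 'x \<Rightarrow> 'c :: idom"
  assumes fin: "finite Y" "finite X" "card X = card Y" and "\<delta> \<noteq> 0"
    and prod: "\<And>w v. w \<in> Y \<Longrightarrow> v \<in> Y \<Longrightarrow> (\<Sum>x\<in>X. A w x * B x v) = \<delta> * N w v"
    and inj: "\<And>c. (\<And>v. v \<in> Y \<Longrightarrow> (\<Sum>w\<in>Y. c w * N w v) = 0) \<Longrightarrow> \<forall>w\<in>Y. c w = 0"
  shows "(\<And>v. v \<in> Y \<Longrightarrow> (\<Sum>x\<in>X. u x * B x v) = 0) \<Longrightarrow> \<forall>x\<in>X. u x = 0"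
    and "(\<And>w. w \<in> Y \<Longrightarrow> (\<Sum>x\<in>X. A w x * u x) = 0) \<Longrightarrow> \<forall>x\<in>X. u x = 0"
proof -
  define n where "n = card Y"
  obtain y where y: "bij_betw y {0..<n} Y"
    using ex_bij_betw_nat_finite[OF fin(1)] unfolding n_def by blast
  obtain x where x: "bij_betw x {0..<n} X"
    using ex_bij_betw_nat_finite[OF fin(2)] unfolding n_def fin(3) by blast
  have yY: "y i \<in> Y" if "i < n" for i
    using y that by (auto simp: bij_betw_def)
  have sX: "(\<Sum>k<n. g (x k)) = (\<Sum>k\<in>X. g k)" for g :: "'x \<Rightarrow> 'c"
    using sum.reindex_bij_betw[OF x, of g] by (simp add: atLeast0LessThan)
  have sY: "(\<Sum>k<n. g (y k)) = (\<Sum>k\<in>Y. g k)" for g :: "'a \<Rightarrow> 'c"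
    using sum.reindex_bij_betw[OF y, of g] by (simp add: atLeast0LessThan)
  have vec: "\<forall>k\<in>Z. u k = 0" if z: "bij_betw z {0..<n} Z" and M: "M \<in> carrier_mat n n" "det M \<noteq> 0"
    and e: "\<And>i. i < n \<Longrightarrow> (\<Sum>k<n. M $$ (i, k) * u (z k)) = 0" for z Z and u :: "'z \<Rightarrow> 'c" and M :: "'c mat"
  proof -
    have "M *\<^sub>v vec n (\<lambda>k. u (z k)) = 0\<^sub>v n"
      using M(1) e by (intro eq_vecI) (simp_all add: scalar_prod_def atLeast0LessThan)
    then have v: "vec n (\<lambda>k. u (z k)) = 0\<^sub>v n"
      using det_0_iff_vec_prod_zero[OF M(1)] M(2) vec_carrier by blast
    have "u (z k) = 0" if "k < n" for k
      using arg_cong[OF v, of "\<lambda>v. v $ k"] that by simp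
    then show ?thesis
      using z by (auto simp: bij_betw_def)
  qed
  define MA where "MA = mat n n (\<lambda>(i, k). A (y i) (x k))"
  define MB where "MB = mat n n (\<lambda>(j, k). B (x k) (y j))"
  have car: "MA \<in> carrier_mat n n" "MB \<in> carrier_mat n n"
    by (simp_all add: MA_def MB_def)
  \<comment> \<open>Both matrices have their rows indexed by \<open>Y\<close>, as the kernel
    statements require. Their product in this order is the transpose of \<open>\<delta> * N\<close>,
    whose kernel is the left kernel of \<open>N\<close> in the hypothesis.\<close>
  have BA: "(MB * transpose_mat MA) $$ (j, i) = \<delta> * N (y i) (y j)" if "i < n" "j < n" for i j
    using that prod[OF yY yY] sX[of "\<lambda>k. A (y i) k * B k (y j)"]
    by (simp add: MA_def MB_def scalar_prod_def atLeast0LessThan mult.commute)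
  have "det (MB * transpose_mat MA) \<noteq> 0"
  proof
    assume "det (MB * transpose_mat MA) = 0"
    moreover have carm: "MB * transpose_mat MA \<in> carrier_mat n n"
      using car by simp
    ultimately obtain c where c: "c \<in> carrier_vec n" "c \<noteq> 0\<^sub>v n" "(MB * transpose_mat MA) *\<^sub>v c = 0\<^sub>v n"
      using det_0_iff_vec_prod_zero by blast
    define c' where "c' = (\<lambda>w. c $ the_inv_into {0..<n} y w)"
    have c'y: "c' (y i) = c $ i" if "i < n" for i
      using that y by (simp add: c'_def the_inv_into_f_f bij_betw_def)
    have "(\<Sum>w\<in>Y. c' w * N w v) = 0" if v: "v \<in> Y" for v
    proof -
      obtain j where j: "j < n" "v = y j"
        using v y by (force simp: bij_betw_def)
      have "0 = ((MB * transpose_mat MA) *\<^sub>v c) $ j"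
        using j(1) c(3) by simp
      also have "\<dots> = (\<Sum>i<n. (MB * transpose_mat MA) $$ (j, i) * c $ i)"
        using j(1) c(1) carm by (simp add: scalar_prod_def atLeast0LessThan del: index_mult_mat)
      also have "\<dots> = (\<Sum>i<n. \<delta> * (c' (y i) * N (y i) (y j)))"
        using j(1) by (intro sum.cong refl) (simp add: BA c'y ac_simps del: index_mult_mat)
      also have "\<dots> = \<delta> * (\<Sum>w\<in>Y. c' w * N w v)"
        unfolding j(2) sum_distrib_left[symmetric] by (simp only: sY[of "\<lambda>w. c' w * N w (y j)"])
      finally show ?thesis
        using \<open>\<delta> \<noteq> 0\<close> by simp
    qed
    then have "\<forall>w\<in>Y. c' w = 0"
      by (rule inj)
    then have "c $ i = 0" if "i < n" for i
      using c'y[OF that] yY[OF that] by simp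
    then have "c = 0\<^sub>v n"
      using c(1) by (intro eq_vecI) auto
    then show False
      using c(2) by simp
  qed
  moreover have "det (MB * transpose_mat MA) = det MB * det MA"
    using car det_mult[of MB n "transpose_mat MA"] det_transpose[of MA n] by simp
  ultimately have d: "det MA \<noteq> 0" "det MB \<noteq> 0"
    by auto
  show "\<forall>x\<in>X. u x = 0" if h: "\<And>v. v \<in> Y \<Longrightarrow> (\<Sum>x\<in>X. u x * B x v) = 0"
  proof (rule vec[OF x car(2) d(2)])
    fix i
    assume "i < n"
    then show "(\<Sum>k<n. MB $$ (i, k) * u (x k)) = 0"
      using h[OF yY] sX[of "\<lambda>k. u k * B k (y i)"] by (simp add: MB_def mult.commute)
  qed
  show "\<forall>x\<in>X. u x = 0" if h: "\<And>w. w \<in> Y \<Longrightarrow> (\<Sum>x\<in>X. A w x * u x) = 0"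
  proof (rule vec[OF x car(1) d(1)])
    fix i
    assume "i < n"
    then show "(\<Sum>k<n. MA $$ (i, k) * u (x k)) = 0"
      using h[OF yY] sX[of "\<lambda>k. A (y i) k * u k"] by (simp add: MA_def)
  qed
qed

section \<open>Expansions of partially invariant elements\<close>

context perm_subgroup
begin

definition rep :: "perm set \<Rightarrow> perm" where "rep X = (SOME y. y \<in> W \<and> (\<circ>) y ` H = X)"

definition coset_Alt :: "ZT \<Rightarrow> perm set \<Rightarrow> ZT" where
  "coset_Alt g X = (\<Sum>y\<in>{y\<in>W. (\<circ>) y ` H = X}. of_int (sign y) * act y g)"

lemma rep: "X \<in> cosets \<Longrightarrow> rep X \<in> W \<and> (\<circ>) (rep X) ` H = X"
proof -
  assume "X \<in> cosets"
  then have "\<exists>y. y \<in> W \<and> (\<circ>) y ` H = X"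
    by (auto simp: cosets_def)
  then show ?thesis
    unfolding rep_def by (rule someI_ex)
qed

lemma act_rep:
  assumes h: "\<And>u. u \<in> H \<Longrightarrow> act u h = h" and y: "y \<in> W"
  shows "act (rep ((\<circ>) y ` H)) h = act y h"
proof -
  have "(\<circ>) y ` H \<in> cosets"
    using y by (simp add: cosets_def)
  then have r: "rep ((\<circ>) y ` H) \<in> {x \<in> W. (\<circ>) x ` H = (\<circ>) y ` H}"
    using rep by blast
  then obtain u where u: "u \<in> H" "rep ((\<circ>) y ` H) = y \<circ> u"
    unfolding coset_eq[OF y] by blast
  have "u \<in> W"
    using u(1) sub by blast
  then show ?thesis
    unfolding u(2) using act_comp[OF y] h[OF u(1)] by simp
qed

text \<open>For \<open>h\<close> invariant under \<open>H\<close> the pairing factors over cosets.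
  This exhibits the matrix of pairings, up to the Weyl denominator, as a product of two matrices as
  in \<open>product_kernel\<close>.\<close>

lemma pairing_cosets:
  assumes h: "\<And>u. u \<in> H \<Longrightarrow> act u h = h"
  shows "weyl_denom * pairing h g = (\<Sum>X\<in>cosets. act (rep X) h * coset_Alt g X)"
proof -
  have "weyl_denom * pairing h g = (\<Sum>y\<in>W. of_int (sign y) * act y (h * g))"
    unfolding pairing_Alt Alt_def ..
  also have "\<dots> = (\<Sum>X\<in>cosets. \<Sum>y\<in>{y\<in>W. (\<circ>) y ` H = X}. of_int (sign y) * act y (h * g))"
    unfolding cosets_def by (rule sum_cosets)
  also have "\<dots> = (\<Sum>X\<in>cosets. act (rep X) h * coset_Alt g X)"
    unfolding coset_Alt_def sum_distrib_left
  proof (intro sum.cong refl)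
    fix X y
    assume "y \<in> {y \<in> W. (\<circ>) y ` H = X}"
    then have "act (rep X) h = act y h"
      using act_rep[OF h, of y] by auto
    then show "of_int (sign y) * act y (h * g) = act (rep X) h * (of_int (sign y) * act y g)"
      by (simp add: ac_simps)
  qed
  finally show ?thesis .
qed

context
  fixes Y :: "perm set"
  assumes Y: "Y \<subseteq> W" and f_inv: "\<And>w u. w \<in> Y \<Longrightarrow> u \<in> H \<Longrightarrow> act u (f_basis w) = f_basis w"
    and cardY: "card Y * card H = card W"
begin

lemma card_cosets_Y: "card cosets = card Y"
proof -
  have "card H \<noteq> 0"
    using fin id_H by auto
  then show ?thesis
    using cardY card_W_cosets by simp
qed

lemma finite_Y: "finite Y"
  using Y finite_W by (rule finite_subset)

lemma N_kernel:
  assumes "\<And>v. v \<in> Y \<Longrightarrow> (\<Sum>w\<in>Y. c w * pairing (f_basis w) (e_desc v)) = 0"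
  shows "\<forall>w\<in>Y. c w = 0"
proof
  fix w
  assume "w \<in> Y"
  show "c w = 0"
  proof (rule triangular_kernel[OF finite_Y _ _ assms \<open>w \<in> Y\<close>])
    fix w
    assume "w \<in> Y"
    then have "w \<in> W"
      using Y by blast
    then show "pairing (f_basis w) (e_desc w) \<noteq> 0"
      by (simp add: N_diagonal sign_def)
  next
    fix w v
    assume "w \<in> Y" "v \<in> Y" "pairing (f_basis w) (e_desc v) \<noteq> 0"
    then show "v = w \<or> rk w < rk v"
      using Y by (intro N_triangular) auto
  qed
qed

lemma prod_N: "w \<in> Y \<Longrightarrow> v \<in> Y \<Longrightarrow>
  (\<Sum>X\<in>cosets. act (rep X) (f_basis w) * coset_Alt (e_desc v) X) = weyl_denom * pairing (f_basis w) (e_desc v)"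
  using pairing_cosets[OF f_inv, of w] by simp

text \<open>The translates of \<open>h\<close> along the cosets form a vector killed by a
  nonsingular matrix; the assumption on \<open>card Y\<close> makes this matrix square.\<close>

lemma pairing_separates_left:
  assumes h: "\<And>u. u \<in> H \<Longrightarrow> act u h = h" and 0: "\<And>v. v \<in> Y \<Longrightarrow> pairing h (e_desc v) = 0"
  shows "h = 0"
proof -
  have "\<forall>X\<in>cosets. act (rep X) h = 0"
  proof (rule product_kernel(1)[OF finite_Y finite_cosets card_cosets_Y weyl_denom_neq_0 prod_N N_kernel])
    fix v
    assume "v \<in> Y"
    then show "(\<Sum>X\<in>cosets. act (rep X) h * coset_Alt (e_desc v) X) = 0"
      using pairing_cosets[OF h, of "e_desc v"] 0 by simp
  qed
  then have "act (rep ((\<circ>) id ` H)) h = 0"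
    unfolding cosets_def using id_W by blast
  then show ?thesis
    using act_rep[OF h id_W] by simp
qed

text \<open>The triangular system is solved within the invariants so that the sum has the same
  pairings as \<open>h\<close>; separation then gives equality.\<close>

lemma expansion:
  assumes h: "\<And>u. u \<in> H \<Longrightarrow> act u h = h"
  shows "\<exists>m. (\<forall>w\<in>Y. invariant (m w)) \<and> h = (\<Sum>w\<in>Y. m w * f_basis w)"
proof -
  have "\<exists>m. (\<forall>w\<in>Y. m w \<in> Collect invariant) \<and>
      (\<forall>v\<in>Y. (\<Sum>w\<in>Y. m w * pairing (f_basis w) (e_desc v)) = pairing h (e_desc v))"
  proof (rule triangular_solve[OF finite_Y, where r = rk])
    show "pairing (f_basis w) (e_desc w) * pairing (f_basis w) (e_desc w) = 1" if "w \<in> Y" for w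
      using N_diagonal[of w] Y that by (auto simp: sign_def subset_iff)
    show "v = w \<or> rk w < rk v" if "w \<in> Y" "v \<in> Y" "pairing (f_basis w) (e_desc v) \<noteq> 0" for w v
      using Y that by (intro N_triangular) auto
  qed auto
  then obtain m where m0: "\<forall>w\<in>Y. m w \<in> Collect invariant"
    and m2: "\<forall>v\<in>Y. (\<Sum>w\<in>Y. m w * pairing (f_basis w) (e_desc v)) = pairing h (e_desc v)" by blast
  have m: "invariant (m w)" if "w \<in> Y" for w
    using m0 that by blast
  have "h - (\<Sum>w\<in>Y. m w * f_basis w) = 0"
  proof (rule pairing_separates_left)
    fix u
    assume u: "u \<in> H"
    have "act u (m w * f_basis w) = m w * f_basis w" if "w \<in> Y" for w
      using m[OF that] f_inv[OF that u] u sub by (auto simp: invariant_def)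
    then show "act u (h - (\<Sum>w\<in>Y. m w * f_basis w)) = h - (\<Sum>w\<in>Y. m w * f_basis w)"
      by (simp add: h[OF u] cong: sum.cong)
  next
    fix v
    assume "v \<in> Y"
    have "pairing (\<Sum>w\<in>Y. m w * f_basis w) (e_desc v) = (\<Sum>w\<in>Y. m w * pairing (f_basis w) (e_desc v))"
      unfolding pairing_sum_left by (intro sum.cong refl pairing_scale_left m)
    then show "pairing (h - (\<Sum>w\<in>Y. m w * f_basis w)) (e_desc v) = 0"
      using m2 \<open>v \<in> Y\<close> by (simp add: pairing_diff_left)
  qed
  then have "h = (\<Sum>w\<in>Y. m w * f_basis w)"
    by simp
  then show ?thesis
    using m by blast
qed

end

end

section \<open>The dual basis\<close>

lemma perm_subgroup_id: "perm_subgroup {id}"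
  by unfold_locales (auto simp: inv_id[unfolded id_def[symmetric]])

lemma pairing_separates_right:
  assumes 0: "\<And>w. w \<in> W \<Longrightarrow> pairing (f_basis w) g = 0"
  shows "g = 0"
proof -
  interpret perm_subgroup "{id}"
    by (rule perm_subgroup_id)
  have f: "act u (f_basis w) = f_basis w" if "u \<in> {id}" for u w
    using that by simp
  have c: "card W * card {id :: perm} = card W"
    by simp
  have cW: "card cosets = card W"
    using card_W_cosets by simp
  have "\<forall>X\<in>cosets. coset_Alt g X = 0"
  proof (rule product_kernel(2)[OF finite_W finite_cosets cW weyl_denom_neq_0 prod_N[OF subset_refl f c] N_kernel[OF subset_refl f c]])
    fix w
    assume "w \<in> W"
    then show "(\<Sum>X\<in>cosets. act (rep X) (f_basis w) * coset_Alt g X) = 0"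
      using pairing_cosets[OF f, of w g] 0 by simp
  qed
  moreover have "(\<circ>) id ` {id} \<in> cosets"
    unfolding cosets_def using id_W by blast
  ultimately have "coset_Alt g ((\<circ>) id ` {id}) = 0"
    by blast
  then show ?thesis
    unfolding coset_Alt_def coset_eq[OF id_W] by simp
qed

text \<open>The dual element is sought as an invariant combination of the Steinberg weights;
  uniqueness is \<open>pairing_separates_right\<close>.\<close>

lemma f_dual_exists:
  "\<exists>g. \<forall>w\<in>W. pairing (f_basis w) g = (if w = v then 1 else 0)"
proof -
  let ?b = "\<lambda>w. if w = v then 1 else (0 :: ZT)"
  have "\<exists>c. (\<forall>u\<in>W. c u \<in> Collect invariant) \<and>
      (\<forall>w\<in>W. (\<Sum>u\<in>W. c u * pairing (f_basis w) (e_desc u)) = ?b w)"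
  \<comment> \<open>The transposed matrix is triangular for the reversed order, encoded by negating
    both components of the rank.\<close>
  proof (rule triangular_solve[OF finite_W, where r = "\<lambda>w. (- fst (rk w), - snd (rk w))"])
    show "pairing (f_basis w) (e_desc w) * pairing (f_basis w) (e_desc w) = 1" if "w \<in> W" for w
      using N_diagonal[OF that] by (simp add: sign_def)
    show "w = u \<or> (- fst (rk u), - snd (rk u)) < (- fst (rk w), - snd (rk w))"
      if "u \<in> W" "w \<in> W" "pairing (f_basis w) (e_desc u) \<noteq> 0" for w u
    proof -
      have "u = w \<or> rk w < rk u"
        by (rule N_triangular[OF that(2,1,3)])
      then show ?thesis
        unfolding less_prod_def fst_conv snd_conv by (elim disjE) simp_all
    qed
    show "?b w \<in> Collect invariant" for w
      by (cases "w = v") simp_all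
  qed simp_all
  then obtain c where c: "(\<forall>u\<in>W. c u \<in> Collect invariant) \<and>
      (\<forall>w\<in>W. (\<Sum>u\<in>W. c u * pairing (f_basis w) (e_desc u)) = ?b w)" ..
  have inv: "invariant (c u)" if "u \<in> W" for u
    using conjunct1[OF c] that by simp
  have "pairing (f_basis w) (\<Sum>u\<in>W. c u * e_desc u) = ?b w" if "w \<in> W" for w
  proof -
    have "pairing (f_basis w) (\<Sum>u\<in>W. c u * e_desc u) = (\<Sum>u\<in>W. c u * pairing (f_basis w) (e_desc u))"
      unfolding pairing_sum_right by (intro sum.cong refl pairing_scale_right inv)
    also have "\<dots> = ?b w"
      using conjunct2[OF c] that by (rule bspec)
    finally show ?thesis .
  qed
  then show ?thesis
    by (intro exI[of _ "\<Sum>u\<in>W. c u * e_desc u"] ballI)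
qed

lemma pairing_f_dual:
  assumes "w \<in> W"
  shows "pairing (f_basis w) (f_dual v) = (if w = v then 1 else 0)"
proof -
  obtain g where g: "\<forall>w\<in>W. pairing (f_basis w) g = (if w = v then 1 else 0)"
    using f_dual_exists ..
  have "f_dual v = g"
    unfolding f_dual_def
  proof (rule the_equality)
    show "\<forall>w\<in>W. pairing (f_basis w) g = (if w = v then 1 else 0)"
      by (rule g)
  next
    fix g'
    assume g': "\<forall>w\<in>W. pairing (f_basis w) g' = (if w = v then 1 else 0)"
    have "g' - g = 0"
    proof (rule pairing_separates_right)
      fix w
      assume "w \<in> W"
      then show "pairing (f_basis w) (g' - g) = 0"
        unfolding pairing_diff_right using bspec[OF g] bspec[OF g'] by simp
    qed
    then show "g' = g" by simp
  qed
  then show ?thesis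
    using bspec[OF g assms] by simp
qed

lemma act_f_basis:
  assumes w: "w \<in> W" and k: "k \<in> {1..4}" "ld w k"
  shows "act (s k) (f_basis w) = f_basis w"
proof -
  have "act (s k) (gact (C' w) g) = gact (C' w) g" for g
  proof -
    have "act (s k) (gact (C' w) g) = (\<Sum>y\<in>W. of_int (C' w (s k \<circ> y)) * act (s k \<circ> y) g)"
      unfolding gact_def act_simps by (intro sum.cong refl) (simp add: C'_left_invariant[OF w k] act_comp[OF s_W[OF k(1)]])
    also have "\<dots> = gact (C' w) g"
      unfolding gact_def by (rule W_reindex[OF s_W[OF k(1)], of "\<lambda>y. of_int (C' w y) * act y g"])
    finally show ?thesis .
  qed
  then have "act (s k) (of_nat (stab_order w) * f_basis w) = of_nat (stab_order w) * f_basis w"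
    by (simp only: f_basis_eq[OF w])
  then show ?thesis
    using stab_order_pos[of w] by simp
qed

definition Y_set :: "nat set \<Rightarrow> perm set" where "Y_set L = {w \<in> W. \<forall>k\<in>L. ld w k}"

lemma parabolic_invariant:
  assumes L: "L \<subseteq> {1..4}" and h: "\<And>k. k \<in> L \<Longrightarrow> act (s k) h = h" and u: "u \<in> parabolic L"
  shows "act u h = h"
proof -
  obtain "is" where i: "set is \<subseteq> L" "u = sprod is"
    using u by (auto simp: parabolic_def)
  have "set is \<subseteq> L \<Longrightarrow> act (sprod is) h = h"
  proof (induction "is")
    case (Cons k ks)
    then have "act (s k \<circ> sprod ks) h = act (s k) (act (sprod ks) h)"
      using L by (intro act_comp sprod_W s_W) auto
    then have "act (sprod (k # ks)) h = h"
      unfolding sprod_Cons using Cons h by simp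
    then show ?case by (simp add: o_def)
  qed (simp add: act_id[unfolded id_def])
  then show ?thesis
    using i by simp
qed

text \<open>Pairing the expansion with the dual basis identifies its coefficients. For
  \<open>h = frob q (f_basis (w0 \<circ> duflo w))\<close> they are the elements from which
  \<open>M\<close> is formed.\<close>

lemma pairing_expansion:
  assumes L: "L \<subseteq> {1..4}" and c: "card (Y_set L) * card (parabolic L) = card W"
    and h: "\<And>k. k \<in> L \<Longrightarrow> act (s k) h = h"
  shows "pairing h g = (\<Sum>w\<in>Y_set L. pairing h (f_dual w) * pairing (f_basis w) g)"
proof -
  interpret perm_subgroup "parabolic L"
    unfolding parabolic_eq_stab[OF L] by (rule perm_subgroup_stab)
  have Y: "Y_set L \<subseteq> W"
    by (auto simp: Y_set_def)
  have f: "act u (f_basis w) = f_basis w" if "w \<in> Y_set L" "u \<in> parabolic L" for w u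
    using that L by (intro parabolic_invariant[OF L _ that(2)] act_f_basis) (auto simp: Y_set_def)
  obtain m where m: "\<forall>w\<in>Y_set L. invariant (m w)" "h = (\<Sum>w\<in>Y_set L. m w * f_basis w)"
    using expansion[OF Y f c parabolic_invariant[OF L h]] by blast
  have p: "pairing h g' = (\<Sum>w\<in>Y_set L. m w * pairing (f_basis w) g')" for g'
    unfolding m(2) pairing_sum_left using m(1) by (intro sum.cong refl pairing_scale_left) blast
  have "m v = pairing h (f_dual v)" if v: "v \<in> Y_set L" for v
  proof -
    have "pairing h (f_dual v) = (\<Sum>w\<in>Y_set L. if w = v then m w else 0)"
      unfolding p by (intro sum.cong refl) (auto simp: pairing_f_dual Y_set_def)
    also have "\<dots> = m v"
      using v finite_subset[OF Y finite_W] by simp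
    finally show ?thesis ..
  qed
  then show ?thesis
    unfolding p[of g] by (intro sum.cong refl) simp
qed

section \<open>Computations with tuples\<close>

lemma tuples_distinct: "distinct tuples"
  by code_simp

lemma card_perm5: "card (perm5 ` set (filter Q tuples)) = length (filter Q tuples)"
proof -
  have "card (set (filter Q tuples)) = length (filter Q tuples)"
    by (rule distinct_card) (rule distinct_filter[OF tuples_distinct])
  moreover have "inj_on perm5 A" for A
    by (auto simp: inj_on_def perm5_inj)
  ultimately show ?thesis
    by (simp only: card_image)
qed

lemma Collect_W_tuples:
  assumes "\<And>t. t \<in> set tuples \<Longrightarrow> R (perm5 t) \<longleftrightarrow> Q t"
  shows "{w \<in> W. R w} = perm5 ` set (filter Q tuples)"
proof (intro equalityI subsetI)
  fix w
  assume "w \<in> {w \<in> W. R w}"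
  then have w: "w \<in> W" "R w" by auto
  then have "Q (tup w)"
    using assms[OF tup_in_tuples[OF w(1)]] by simp
  then have "tup w \<in> set (filter Q tuples)"
    using tup_in_tuples[OF w(1)] by (simp del: in_tuples)
  then have "perm5 (tup w) \<in> perm5 ` set (filter Q tuples)"
    by (rule imageI)
  then show "w \<in> perm5 ` set (filter Q tuples)"
    using w(1) by simp
next
  fix w
  assume "w \<in> perm5 ` set (filter Q tuples)"
  then obtain t where "t \<in> set tuples" "Q t" "w = perm5 t"
    by (auto simp del: in_tuples)
  then show "w \<in> {w \<in> W. R w}"
    using assms[of t] perm5_W[of t] by simp
qed

definition act5 :: "tuple \<Rightarrow> weight \<Rightarrow> weight" where
  "act5 t \<mu> = (eps \<mu> (pos5 t 1) - eps \<mu> (pos5 t 2), eps \<mu> (pos5 t 2) - eps \<mu> (pos5 t 3),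
    eps \<mu> (pos5 t 3) - eps \<mu> (pos5 t 4), eps \<mu> (pos5 t 4) - eps \<mu> (pos5 t 5))"

lemma act_wt_perm5: "t \<in> set tuples \<Longrightarrow> act_wt (perm5 t) \<mu> = act5 t \<mu>"
  using pos_tup[OF perm5_W, of t] by (simp add: act_wt_def wt_def act5_def del: in_tuples)

definition dvec :: "tuple \<Rightarrow> weight" where
  "dvec t = (of_bool (rd5 t 1), of_bool (rd5 t 2), of_bool (rd5 t 3), of_bool (rd5 t 4))"

definition avec :: "tuple \<Rightarrow> weight" where
  "avec t = (of_bool (\<not> rd5 t 1), of_bool (\<not> rd5 t 2), of_bool (\<not> rd5 t 3), of_bool (\<not> rd5 t 4))"

lemma desc_perm5:
  assumes "t \<in> set tuples"
  shows "desc_wt (perm5 t) = dvec t" "asc_wt (perm5 t) = avec t"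
  using right_descents_eq[OF perm5_W[OF assms]]
  by (simp_all add: desc_wt_def asc_wt_def fund_sum_eq dvec_def avec_def del: rd5.simps)

lemma stab_tuples: "stab \<mu> = perm5 ` set (filter (\<lambda>t. act5 t \<mu> = \<mu>) tuples)"
  unfolding stab_def by (rule Collect_W_tuples) (simp add: act_wt_perm5 del: in_tuples)

lemma Y_set_tuples:
  assumes "set Ls \<subseteq> {1..4}"
  shows "Y_set (set Ls) = perm5 ` set (filter (\<lambda>t. list_all (ld5 t) Ls) tuples)"
  unfolding Y_set_def
proof (rule Collect_W_tuples)
  fix t
  assume "t \<in> set tuples"
  then show "(\<forall>k\<in>set Ls. ld (perm5 t) k) \<longleftrightarrow> list_all (ld5 t) Ls"
    using assms by (auto simp: list_all_iff subset_iff simp del: in_tuples ld5_def)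
qed

text \<open>An executable necessary condition for a nonzero pairing of \<open>f_basis\<close> at
  \<open>u\<close> with \<open>e_desc\<close> at \<open>t\<close>, combining \<open>N_height\<close>
  with \<open>N_same_descents\<close>.\<close>

definition N_cand :: "tuple \<Rightarrow> tuple \<Rightarrow> bool" where
  "N_cand u t \<longleftrightarrow> u = t \<or> ht (dvec u) + 4 \<le> ht (dvec t) \<or>
    ht (dvec u) \<le> ht (dvec t) \<and> wclass (dvec u) = wclass (dvec t) \<and> (dvec u \<noteq> dvec t \<or> len5 t < len5 u)"

lemma N_candI:
  assumes u: "u \<in> set tuples" and t: "t \<in> set tuples"
    and "pairing (f_basis (perm5 u)) (e_desc (perm5 t)) \<noteq> 0"
  shows "N_cand u t"
proof -
  note W = perm5_W[OF u] perm5_W[OF t]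
  have "right_descents (perm5 u) = right_descents (perm5 t)" if "dvec u = dvec t"
    using that desc_perm5[OF u] desc_perm5[OF t] by (intro descents_determined) simp_all
  then have "dvec u = dvec t \<longrightarrow> u = t \<or> len5 t < len5 u"
    using N_same_descents[OF W _ assms(3)] len_perm5[OF u] len_perm5[OF t] by (metis perm5_inj)
  then show ?thesis
    using N_height[OF W assms(3)] unfolding N_cand_def desc_perm5(1)[OF u] desc_perm5(1)[OF t] by blast
qed

text \<open>Both sides carry the factor 288 of \<open>vdim_pairing\<close>, so the relation between
  virtual dimensions becomes one between integer values of \<open>Dt\<close>.\<close>

lemma eval_expansion:
  assumes Ls: "set Ls \<subseteq> {1..4}"
    and card: "length (filter (\<lambda>t. list_all (ld5 t) Ls) tuples) *
      length (filter (\<lambda>t. act5 t (fund_sum ({1..4} - set Ls)) = fund_sum ({1..4} - set Ls)) tuples) = 120"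
    and h: "\<And>k. k \<in> set Ls \<Longrightarrow> act (s k) h = h" and t: "t \<in> set tuples"
    and Z: "filter (\<lambda>u. list_all (ld5 u) Ls \<and> N_cand u t) tuples = Z"
  shows "eval_fun Dt (h * e_desc (perm5 t)) =
    (\<Sum>u\<in>set Z. vdim (pairing h (f_dual (perm5 u))) * eval_fun Dt (f_basis (perm5 u) * e_desc (perm5 t)))"
proof -
  let ?F = "\<lambda>w. pairing h (f_dual w) * pairing (f_basis w) (e_desc (perm5 t))"
  let ?Y = "set (filter (\<lambda>t. list_all (ld5 t) Ls) tuples)"
  have c: "card (Y_set (set Ls)) * card (parabolic (set Ls)) = card W"
    unfolding parabolic_eq_stab[OF Ls] Y_set_tuples[OF Ls] stab_tuples card_perm5 card_W by (rule card)
  have inj: "inj_on perm5 A" for A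
    by (auto simp: inj_on_def perm5_inj)
  have "pairing h (e_desc (perm5 t)) = (\<Sum>w\<in>Y_set (set Ls). ?F w)"
    by (rule pairing_expansion[OF Ls c h])
  also have "\<dots> = (\<Sum>u\<in>?Y. ?F (perm5 u))"
    unfolding Y_set_tuples[OF Ls] sum.reindex[OF inj] by (simp add: o_def)
  also have "\<dots> = (\<Sum>u\<in>set Z. ?F (perm5 u))"
  proof (rule sum.mono_neutral_right)
    show "set Z \<subseteq> ?Y"
      unfolding Z[symmetric] by auto
    show "\<forall>u\<in>?Y - set Z. ?F (perm5 u) = 0"
    proof
      fix u
      assume "u \<in> ?Y - set Z"
      then have u: "u \<in> set tuples" "\<not> N_cand u t"
        unfolding Z[symmetric] by (simp_all del: in_tuples)
      then have "pairing (f_basis (perm5 u)) (e_desc (perm5 t)) = 0"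
        using N_candI[OF u(1) t] by blast
      then show "?F (perm5 u) = 0" by simp
    qed
  qed simp
  finally have "288 * vdim (pairing h (e_desc (perm5 t))) = (\<Sum>u\<in>set Z. 288 * vdim (?F (perm5 u)))"
    by (simp add: vdim_sum sum_distrib_left)
  also have "\<dots> = (\<Sum>u\<in>set Z. vdim (pairing h (f_dual (perm5 u))) * (288 * vdim (pairing (f_basis (perm5 u)) (e_desc (perm5 t)))))"
    by (intro sum.cong refl) simp
  finally show ?thesis
    by (simp only: vdim_pairing)
qed

section \<open>Computing the elements \<open>f\<close>\<close>

definition exs :: "(int \<times> weight) list \<Rightarrow> ZT" where "exs L = (\<Sum>(c, \<mu>)\<leftarrow>L. of_int c * ex \<mu>)"

fun refl_wt :: "nat \<Rightarrow> weight \<Rightarrow> weight" where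
  "refl_wt i (a, b, c, d) = (if i = 1 then (- a, a + b, c, d) else if i = 2 then (a + b, - b, b + c, d)
     else if i = 3 then (a, b + c, - c, c + d) else (a, b, c + d, - d))"

text \<open>The action of \<open>C' (s i)\<close>, that is of 1 plus the reflection, on a list of
  terms; repeated weights are not collected.\<close>

definition reflect :: "nat \<Rightarrow> (int \<times> weight) list \<Rightarrow> (int \<times> weight) list" where
  "reflect i L = L @ map (\<lambda>(c, \<mu>). (c, refl_wt i \<mu>)) L"

definition negate :: "(int \<times> weight) list \<Rightarrow> (int \<times> weight) list" where
  "negate L = map (\<lambda>(c, \<mu>). (- c, \<mu>)) L"

lemma act_wt_refl: "i \<in> {1..4} \<Longrightarrow> act_wt (s i) \<mu> = refl_wt i \<mu>"
  unfolding atLeastAtMost_1_4 by (cases \<mu>) (elim insertE emptyE; simp add: act_wt_s)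

lemma exs_simps [simp]: "exs [] = 0" "exs ((c, \<mu>) # L) = of_int c * ex \<mu> + exs L" "exs (L @ L') = exs L + exs L'"
  by (simp_all add: exs_def)

lemma exs_negate [simp]: "exs (negate L) = - exs L"
  by (induction L) (auto simp: negate_def)

lemma exs_reflect: "i \<in> {1..4} \<Longrightarrow> exs (reflect i L) = exs L + act (s i) (exs L)"
proof -
  assume i: "i \<in> {1..4}"
  have "exs (map (\<lambda>(c, \<mu>). (c, refl_wt i \<mu>)) L) = act (s i) (exs L)"
    by (induction L) (use i in \<open>auto simp: act_wt_refl\<close>)
  then show ?thesis
    by (simp add: reflect_def)
qed

lemma exs_constant: "list_all (\<lambda>(c, \<mu>). \<mu> = \<nu>) L \<Longrightarrow> exs L = of_int (\<Sum>p\<leftarrow>L. fst p) * exs [(1, \<nu>)]"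
  by (induction L) (auto simp: distrib_right)

lemma gact_id: "gact (C' id) g = g"
proof -
  have "gact (C' id) g = (\<Sum>y\<in>W. if y = id then g else 0)"
    unfolding gact_def C'_id by (intro sum.cong refl) simp
  then show ?thesis by simp
qed

text \<open>The recursion for \<open>C'\<close> carried over to its action, which avoids evaluating
  all the coefficients of \<open>C'\<close> on the 120 group elements.\<close>

lemma gact_rec:
  assumes v: "v \<in> set tuples" and i: "i \<in> {1..4}" and nd: "\<not> ld5 v i"
    and Z: "set (filter (\<lambda>z. ld5 z i \<and> mu_cand5 z v) tuples) = Z"
  shows "gact (C' (perm5 (sl5 i v))) g = gact (C' (perm5 v)) g + act (s i) (gact (C' (perm5 v)) g)
    - (\<Sum>z\<in>Z. of_int (mu (perm5 z) (perm5 v)) * gact (C' (perm5 z)) g)"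
proof -
  have "gact (C' (perm5 (sl5 i v))) g = (\<Sum>y\<in>W. of_int (C' (perm5 v) y) * act y g + of_int (C' (perm5 v) (s i \<circ> y)) * act y g
      - (\<Sum>z\<in>Z. of_int (mu (perm5 z) (perm5 v)) * (of_int (C' (perm5 z) y) * act y g)))"
    unfolding gact_def
    by (intro sum.cong refl, subst KL_rec5(2)[OF v i nd refl v])
      (simp add: Z distrib_right left_diff_distrib sum_distrib_right mult.assoc del: in_tuples ld5_def set_filter)
  also have "\<dots> = gact (C' (perm5 v)) g + (\<Sum>y\<in>W. of_int (C' (perm5 v) (s i \<circ> y)) * act y g)
      - (\<Sum>z\<in>Z. of_int (mu (perm5 z) (perm5 v)) * gact (C' (perm5 z)) g)"
    unfolding gact_def sum_subtractf sum.distrib sum_distrib_left by (subst sum.swap[of _ W Z]) (rule refl)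
  also have "(\<Sum>y\<in>W. of_int (C' (perm5 v) (s i \<circ> y)) * act y g) = act (s i) (gact (C' (perm5 v)) g)"
  proof -
    have "(\<Sum>y\<in>W. of_int (C' (perm5 v) (s i \<circ> y)) * act y g)
        = (\<Sum>y\<in>W. of_int (C' (perm5 v) (s i \<circ> (s i \<circ> y))) * act (s i \<circ> y) g)"
      by (rule W_reindex[OF s_W[OF i], of "\<lambda>y. of_int (C' (perm5 v) (s i \<circ> y)) * act y g", symmetric])
    also have "\<dots> = act (s i) (gact (C' (perm5 v)) g)"
      unfolding gact_def act_simps by (intro sum.cong refl) (simp add: act_comp[OF s_W[OF i]])
    finally show ?thesis .
  qed
  finally show ?thesis .
qed

lemma gact_step0:
  assumes "gact (C' (perm5 v)) g = of_nat k * exs L" "v \<in> set tuples" "i \<in> {1..4}" "\<not> ld5 v i"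
    and "filter (\<lambda>z. ld5 z i \<and> mu_cand5 z v) tuples = []"
  shows "gact (C' (perm5 (sl5 i v))) g = of_nat k * exs (reflect i L)"
  using gact_rec[OF assms(2-4) refl, of g] unfolding assms(5)
  by (simp add: assms(1) exs_reflect[OF assms(3)] distrib_left del: in_tuples ld5_def sl5.simps)

lemma gact_step1:
  assumes "gact (C' (perm5 v)) g = of_nat k * exs L" "v \<in> set tuples" "i \<in> {1..4}" "\<not> ld5 v i"
    and "filter (\<lambda>z. ld5 z i \<and> mu_cand5 z v) tuples = [z]"
    and "gact (C' (perm5 z)) g = of_nat k * exs L'" "mu (perm5 z) (perm5 v) = 1"
  shows "gact (C' (perm5 (sl5 i v))) g = of_nat k * exs (reflect i L @ negate L')"
  using gact_rec[OF assms(2-4) refl, of g] unfolding assms(5)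
  by (simp add: assms(1,6,7) exs_reflect[OF assms(3)] distrib_left right_diff_distrib del: in_tuples ld5_def sl5.simps)

definition wt_a :: weight where "wt_a = (1, 0, 0, 1)"
definition wt_b :: weight where "wt_b = (0, 1, 1, 0)"
text \<open>These lists expand the \<open>f\<close> elements along chains of left multiplications,
  with the mu terms negated: \<open>L_u\<close>, \<open>L_c\<close>, \<open>L_e\<close> end at
  \<open>pu\<close>, \<open>pc\<close>, \<open>pe\<close>, and \<open>L_a4\<close> belongs to the
  second correction term for \<open>pe\<close>.\<close>

definition L_a :: "(int \<times> weight) list" where "L_a = [(1, wt_a)]"
definition L_b :: "(int \<times> weight) list" where "L_b = [(1, wt_b)]"
definition L_b1 :: "(int \<times> weight) list" where "L_b1 = reflect 2 L_b"
definition L_u :: "(int \<times> weight) list" where "L_u = reflect 2 (reflect 3 L_b1) @ negate L_b1"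
definition L_c :: "(int \<times> weight) list" where "L_c = reflect 4 (reflect 1 L_u)"
definition L_a1 :: "(int \<times> weight) list" where "L_a1 = reflect 4 L_a"
definition L_a2 :: "(int \<times> weight) list" where "L_a2 = reflect 2 (reflect 1 L_a1) @ negate L_a1"
definition L_a3 :: "(int \<times> weight) list" where "L_a3 = reflect 1 L_a"
definition L_a4 :: "(int \<times> weight) list" where "L_a4 = reflect 3 (reflect 2 L_a3 @ negate L_a) @ negate L_a3"
definition L_e :: "(int \<times> weight) list" where "L_e = reflect 2 (reflect 3 L_a2) @ negate L_a2 @ negate L_a4"

text \<open>\<open>wt_b\<close> is fixed by \<open>s 1\<close> and \<open>s 4\<close>, so the four
  terms coincide. The factor 4 is the stabilizer order, by which \<open>f_basis\<close> divides, and
  it is carried along unchanged to \<open>pu\<close> and \<open>pc\<close>.\<close>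

lemma gact_b: "gact (C' pb) (ex wt_b) = of_nat 4 * exs L_b"
proof -
  have 0: "gact (C' (perm5 (1, 2, 3, 4, 5))) (ex wt_b) = of_nat 1 * exs L_b"
    using gact_id[of "ex wt_b"] by (simp add: L_b_def flip: id_perm5)
  have 1: "gact (C' (perm5 (1, 2, 3, 5, 4))) (ex wt_b) = of_nat 1 * exs (reflect 4 L_b)"
    using gact_step0[OF 0 _ _ _ rec_12345(2)] by simp
  have 2: "gact (C' pb) (ex wt_b) = of_nat 1 * exs (reflect 1 (reflect 4 L_b))"
    using gact_step0[OF 1 _ _ _ rec_12354] by simp
  have "exs (reflect 1 (reflect 4 L_b)) = of_nat 4 * exs L_b"
    using exs_constant[of wt_b "reflect 1 (reflect 4 L_b)"]
    by (simp add: reflect_def L_b_def wt_b_def del: exs_simps)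
  then show ?thesis
    using 2 by simp
qed

lemma gact_a: "gact (C' pa) (ex wt_a) = of_nat 6 * exs L_a"
proof -
  have 0: "gact (C' (perm5 (1, 2, 3, 4, 5))) (ex wt_a) = of_nat 1 * exs L_a"
    using gact_id[of "ex wt_a"] by (simp add: L_a_def flip: id_perm5)
  have 1: "gact (C' (perm5 (1, 3, 2, 4, 5))) (ex wt_a) = of_nat 1 * exs (reflect 2 L_a)"
    using gact_step0[OF 0 _ _ _ rec_12345(1)] by simp
  have 2: "gact (C' (perm5 (1, 4, 2, 3, 5))) (ex wt_a) = of_nat 1 * exs (reflect 3 (reflect 2 L_a))"
    using gact_step0[OF 1 _ _ _ rec_13245] by simp
  have m: "mu (perm5 (1, 3, 2, 4, 5)) (perm5 (1, 4, 2, 3, 5)) = 1"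
    using mu_sl5[of "(1, 3, 2, 4, 5)" 3] by simp
  have 3: "gact (C' pa) (ex wt_a) = of_nat 1 * exs (reflect 2 (reflect 3 (reflect 2 L_a)) @ negate (reflect 2 L_a))"
    using gact_step1[OF 2 _ _ _ rec_14235 1 m] by (simp del: exs_simps)
  have "exs (reflect 2 (reflect 3 (reflect 2 L_a)) @ negate (reflect 2 L_a)) = of_nat 6 * exs L_a"
    using exs_constant[of wt_a "reflect 2 (reflect 3 (reflect 2 L_a)) @ negate (reflect 2 L_a)"]
    by (simp add: reflect_def negate_def L_a_def wt_a_def del: exs_simps)
  then show ?thesis
    using 3 by simp
qed

lemma gact_u_c:
  shows gact_u: "gact (C' pu) (ex wt_b) = of_nat 4 * exs L_u"
    and gact_c: "gact (C' pc) (ex wt_b) = of_nat 4 * exs L_c"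
proof -
  have 1: "gact (C' (perm5 (3, 1, 2, 5, 4))) (ex wt_b) = of_nat 4 * exs L_b1"
    using gact_step0[OF gact_b _ _ _ rec_21354] by (simp add: L_b1_def del: exs_simps)
  have 2: "gact (C' (perm5 (4, 1, 2, 5, 3))) (ex wt_b) = of_nat 4 * exs (reflect 3 L_b1)"
    using gact_step0[OF 1 _ _ _ rec_31254] by (simp del: exs_simps)
  have m: "mu (perm5 (3, 1, 2, 5, 4)) (perm5 (4, 1, 2, 5, 3)) = 1"
    using mu_sl5[of "(3, 1, 2, 5, 4)" 3] by simp
  show 3: "gact (C' pu) (ex wt_b) = of_nat 4 * exs L_u"
    using gact_step1[OF 2 _ _ _ rec_41253 1 m] by (simp add: L_u_def del: exs_simps)
  have 4: "gact (C' (perm5 (4, 2, 3, 5, 1))) (ex wt_b) = of_nat 4 * exs (reflect 1 L_u)"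
    using gact_step0[OF 3 _ _ _ rec_41352] by (simp del: exs_simps)
  show "gact (C' pc) (ex wt_b) = of_nat 4 * exs L_c"
    using gact_step0[OF 4 _ _ _ rec_42351] by (simp add: L_c_def del: exs_simps)
qed

lemma gact_e: "gact (C' pe) (ex wt_a) = of_nat 6 * exs L_e"
proof -
  have 1: "gact (C' (perm5 (1, 5, 3, 2, 4))) (ex wt_a) = of_nat 6 * exs L_a1"
    using gact_step0[OF gact_a _ _ _ rec_14325(1)] by (simp add: L_a1_def del: exs_simps)
  have 2: "gact (C' (perm5 (2, 5, 3, 1, 4))) (ex wt_a) = of_nat 6 * exs (reflect 1 L_a1)"
    using gact_step0[OF 1 _ _ _ rec_15324] by (simp del: exs_simps)
  have m: "mu (perm5 (1, 5, 3, 2, 4)) (perm5 (2, 5, 3, 1, 4)) = 1"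
    using mu_sl5[of "(1, 5, 3, 2, 4)" 1] by simp
  have 3: "gact (C' (perm5 (3, 5, 2, 1, 4))) (ex wt_a) = of_nat 6 * exs L_a2"
    using gact_step1[OF 2 _ _ _ rec_25314 1 m] by (simp add: L_a2_def del: exs_simps)
  have 4: "gact (C' (perm5 (4, 5, 2, 1, 3))) (ex wt_a) = of_nat 6 * exs (reflect 3 L_a2)"
    using gact_step0[OF 3 _ _ _ rec_35214] by (simp del: exs_simps)
  have 5: "gact (C' (perm5 (2, 4, 3, 1, 5))) (ex wt_a) = of_nat 6 * exs L_a3"
    using gact_step0[OF gact_a _ _ _ rec_14325(2)] by (simp add: L_a3_def del: exs_simps)
  have m': "mu pa (perm5 (2, 4, 3, 1, 5)) = 1" "mu (perm5 (2, 4, 3, 1, 5)) (perm5 (3, 4, 2, 1, 5)) = 1"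
    "mu (perm5 (3, 5, 2, 1, 4)) (perm5 (4, 5, 2, 1, 3)) = 1"
    using mu_sl5[of "(1, 4, 3, 2, 5)" 1] mu_sl5[of "(2, 4, 3, 1, 5)" 2] mu_sl5[of "(3, 5, 2, 1, 4)" 3] by simp_all
  have 6: "gact (C' (perm5 (3, 4, 2, 1, 5))) (ex wt_a) = of_nat 6 * exs (reflect 2 L_a3 @ negate L_a)"
    using gact_step1[OF 5 _ _ _ rec_24315 gact_a m'(1)] by (simp del: exs_simps)
  have 7: "gact (C' (perm5 (4, 3, 2, 1, 5))) (ex wt_a) = of_nat 6 * exs L_a4"
    using gact_step1[OF 6 _ _ _ rec_34215 5 m'(2)] by (simp add: L_a4_def del: exs_simps)
  \<comment> \<open>This step has two correction terms, beyond the scope of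
    \<open>gact_step1\<close>.\<close>
  have "gact (C' (perm5 (sl5 2 (4, 5, 2, 1, 3)))) (ex wt_a) = of_nat 6 * exs (reflect 3 L_a2)
      + act (s 2) (of_nat 6 * exs (reflect 3 L_a2))
      - (of_nat 6 * exs L_a2 + of_nat 6 * exs L_a4)"
    using gact_rec[OF _ _ _ rec_45213, of "ex wt_a"] by (simp add: 3 4 7 m'(3) mu_43215 del: exs_simps act_simps)
  moreover have "act (s 2) 6 = 6"
    using act_of_nat[of "s 2" 6] by simp
  ultimately show ?thesis
    by (simp add: L_e_def exs_reflect[of 2] algebra_simps)
qed

lemma f_basis_exs:
  assumes t: "t \<in> set tuples" and "gact (C' (perm5 t)) (ex (avec t)) = of_nat k * exs L"
    and "length (filter (\<lambda>u. act5 u (avec t) = avec t) tuples) = k"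
  shows "f_basis (perm5 t) = exs L"
  using assms(2,3) card_perm5[of "\<lambda>u. act5 u (avec t) = avec t"]
  by (intro f_basis_eqI[OF perm5_W[OF t]]) (simp add: stab_order_def desc_perm5[OF t] stab_tuples del: in_tuples set_filter)

lemma f_basis_values:
  "f_basis pa = exs L_a" "f_basis pb = exs L_b" "f_basis pc = exs L_c" "f_basis pe = exs L_e" "f_basis pu = exs L_u"
proof -
  have a: "avec (1, 4, 3, 2, 5) = wt_a" "avec (4, 5, 3, 1, 2) = wt_a" "avec (2, 1, 3, 5, 4) = wt_b"
    "avec (5, 2, 3, 4, 1) = wt_b" "avec (4, 1, 3, 5, 2) = wt_b"
    by (simp_all add: avec_def wt_a_def wt_b_def)
  have c: "length (filter (\<lambda>u. act5 u wt_a = wt_a) tuples) = 6" "length (filter (\<lambda>u. act5 u wt_b = wt_b) tuples) = 4"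
    by code_simp+
  show "f_basis pa = exs L_a"
    by (rule f_basis_exs[where k = 6]) (simp_all add: a c gact_a del: of_nat_numeral exs_simps)
  show "f_basis pb = exs L_b"
    by (rule f_basis_exs[where k = 4]) (simp_all add: a c gact_b del: of_nat_numeral exs_simps)
  show "f_basis pc = exs L_c"
    by (rule f_basis_exs[where k = 4]) (simp_all add: a c gact_c del: of_nat_numeral exs_simps)
  show "f_basis pe = exs L_e"
    by (rule f_basis_exs[where k = 6]) (simp_all add: a c gact_e del: of_nat_numeral exs_simps)
  show "f_basis pu = exs L_u"
    by (rule f_basis_exs[where k = 4]) (simp_all add: a c gact_u del: of_nat_numeral exs_simps)
qed

section \<open>The polynomials \<open>P\<close>\<close>

lemma frob_simps [simp]: "frob q 0 = 0" "frob q (f + g) = frob q f + frob q g" "frob q (ex \<mu>) = ex (scale_wt (int q) \<mu>)"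
    "frob q (of_int c * f) = of_int c * frob q f"
proof -
  have a: "scale_wt m (\<mu> + \<nu>) = scale_wt m \<mu> + scale_wt m \<nu>" for m \<mu> \<nu>
    by (rule scale_wt_distrib)
  show "frob q (of_int c * f) = of_int c * frob q f"
    unfolding frob_def by (simp add: push_mult a flip: single_of_int)
qed (simp_all add: frob_def push_add ex_def)

lemma act_wt_scale: "i \<in> {1..4} \<Longrightarrow> act_wt (s i) (scale_wt m \<mu>) = scale_wt m (act_wt (s i) \<mu>)"
  unfolding atLeastAtMost_1_4 by (cases \<mu>) (elim insertE emptyE; simp add: act_wt_s distrib_left)

lemma act_frob: "i \<in> {1..4} \<Longrightarrow> act (s i) (frob q f) = frob q (act (s i) f)"
  by (induction f rule: ZT_induct) (simp_all add: act_wt_scale)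

fun padd :: "int list \<Rightarrow> int list \<Rightarrow> int list" where
  "padd [] ys = ys"
| "padd xs [] = xs"
| "padd (x # xs) (y # ys) = (x + y) # padd xs ys"

text \<open>Multiplication by the linear polynomial \<open>fst p * q + snd p\<close>; coefficient
  lists begin with the constant term.\<close>

definition plin :: "int \<times> int \<Rightarrow> int list \<Rightarrow> int list" where
  "plin p ys = padd (map ((*) (snd p)) ys) (0 # map ((*) (fst p)) ys)"

definition ev :: "int \<Rightarrow> int list \<Rightarrow> int" where "ev q xs = foldr (\<lambda>x r. x + q * r) xs 0"

fun Dfactors :: "weight \<Rightarrow> weight \<Rightarrow> (int \<times> int) list" where
  "Dfactors (a, b, c, d) (a', b', c', d') = [(a, a'), (a + b, a' + b'), (a + b + c, a' + b' + c'),
    (a + b + c + d, a' + b' + c' + d'), (b, b'), (b + c, b' + c'), (b + c + d, b' + c' + d'), (c, c'), (c + d, c' + d'), (d, d')]"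

text \<open>The coefficients in \<open>q\<close> of the sum of
  \<open>c * Dt (q * \<nu> + \<mu>)\<close> over the terms of \<open>L\<close>, multiplied out from
  the ten linear factors of each term.\<close>

definition Dsum :: "(int \<times> weight) list \<Rightarrow> weight \<Rightarrow> int list" where
  "Dsum L \<mu> = foldr (\<lambda>(c, \<nu>) r. padd (map ((*) c) (foldr plin (Dfactors \<nu> \<mu>) [1])) r) L []"

lemma ev_simps [simp]: "ev q [] = 0" "ev q (x # xs) = x + q * ev q xs"
  by (simp_all add: ev_def)

lemma ev_padd [simp]: "ev q (padd xs ys) = ev q xs + ev q ys"
  by (induction xs ys rule: padd.induct) (simp_all add: algebra_simps)

lemma ev_map [simp]: "ev q (map ((*) c) xs) = c * ev q xs"
  by (induction xs) (simp_all add: algebra_simps)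

lemma ev_plin: "ev q (plin p ys) = (snd p + fst p * q) * ev q ys"
  by (simp add: plin_def algebra_simps)

lemma Dt_factors:
  assumes "f1 = a" "f2 = a + b" "f3 = a + b + c" "f4 = a + b + c + d" "f5 = b" "f6 = b + c" "f7 = b + c + d"
    "f8 = c" "f9 = c + d" "f10 = d"
  shows "Dt (a, b, c, d) = f1 * (f2 * (f3 * (f4 * (f5 * (f6 * (f7 * (f8 * (f9 * (f10 * 1)))))))))"
  unfolding assms Dt_eq by (simp only: mult.assoc mult_1_right)

lemma ev_Dfactors: "ev q (foldr plin (Dfactors \<nu> \<mu>) [1]) = Dt (scale_wt q \<nu> + \<mu>)"
proof -
  obtain a b c d where \<nu>: "\<nu> = (a, b, c, d)" by (cases \<nu>)
  obtain a' b' c' d' where \<mu>: "\<mu> = (a', b', c', d')" by (cases \<mu>)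
  have 1: "ev q [1] = 1" by simp
  show ?thesis
    unfolding \<nu> \<mu> Dfactors.simps scale_wt.simps add_Pair foldr.simps o_apply id_apply ev_plin fst_conv snd_conv 1
    by (rule Dt_factors[symmetric]) (simp_all add: algebra_simps)
qed

lemma ev_Dsum: "eval_fun Dt (frob q (exs L) * ex \<mu>) = ev (int q) (Dsum L \<mu>)"
proof (induction L)
  case (Cons p L)
  obtain c \<nu> where p: "p = (c, \<nu>)" by (cases p)
  have "eval_fun Dt (frob q (exs (p # L)) * ex \<mu>) = c * Dt (scale_wt (int q) \<nu> + \<mu>) + eval_fun Dt (frob q (exs L) * ex \<mu>)"
    by (simp add: p distrib_right eval_fun_add mult.assoc eval_fun_scale ex_mult)
  then show ?case
    unfolding Cons.IH by (simp add: Dsum_def p ev_Dfactors)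
qed (simp add: Dsum_def)

lemma frob_1: "frob 1 f = f"
  by (induction f rule: ZT_induct) simp_all

lemma eval_exs: "eval_fun Dt (exs L * ex \<mu>) = ev 1 (Dsum L \<mu>)"
  using ev_Dsum[of 1 L \<mu>] by (simp add: frob_1)

lemma e_desc_values: "e_desc pa = ex (2, -1, -1, 2)" "e_desc pb = ex (-1, 1, 1, -1)" "e_desc pc = ex (-1, 0, 0, -1)"
    "e_desc pe = ex (0, -1, -1, 0)" "e_desc pu = ex (1, -1, -1, 1)"
  by (simp_all add: e_desc_def desc_perm5 act_wt_perm5 act5_def dvec_def)

lemma polynomial_values:
  "Dsum L_c (-1, 0, 0, -1) = [0, 0, 0, -8, 0, -152, 0, -128, 0, 0, 0]"
  "Dsum L_e (0, -1, -1, 0) = [0, 0, 32, 0, 200, 0, 56, 0, 0, 0, 0]"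
  "Dsum L_b (-1, 0, 0, -1) = [0, 0, 0, -4, 28, -76, 100, -64, 16, 0, 0]"
  "Dsum L_b (-1, 1, 1, -1) = [0, 0, 0, 4, 28, 76, 100, 64, 16, 0, 0]"
  "Dsum L_a (1, -1, -1, 1) = [0, 0, 0, -4, 0, 8, 0, -4, 0, 0, 0]"
  "Dsum L_a (0, -1, -1, 0) = [0, 0, 16, -64, 100, -76, 28, -4, 0, 0, 0]"
  "Dsum L_a (2, -1, -1, 2) = [0, 0, -16, -64, -100, -76, -28, -4, 0, 0, 0]"
  by code_simp+

lemma N_values:
  "ev 1 (Dsum L_c (-1, 0, 0, -1)) = -288" "ev 1 (Dsum L_e (0, -1, -1, 0)) = 288"
  "ev 1 (Dsum L_b (-1, 1, 1, -1)) = 288" "ev 1 (Dsum L_c (-1, 1, 1, -1)) = 288"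
  "ev 1 (Dsum L_u (1, -1, -1, 1)) = -288" "ev 1 (Dsum L_u (0, -1, -1, 0)) = 0"
  "ev 1 (Dsum L_a (2, -1, -1, 2)) = -288" "ev 1 (Dsum L_u (2, -1, -1, 2)) = 576" "ev 1 (Dsum L_e (2, -1, -1, 2)) = -288"
  by code_simp+

text \<open>The unknowns that can enter each equation, at most three; the Steinberg weights are
  chosen so that the systems can be solved successively.\<close>

lemma candidates:
  "filter (\<lambda>u. list_all (ld5 u) [1, 4] \<and> N_cand u (5, 2, 3, 4, 1)) tuples = [(5, 2, 3, 4, 1)]"
  "filter (\<lambda>u. list_all (ld5 u) [1, 4] \<and> N_cand u (2, 1, 3, 5, 4)) tuples = [(2, 1, 3, 5, 4), (5, 2, 3, 4, 1)]"
  "filter (\<lambda>u. list_all (ld5 u) [2, 3] \<and> N_cand u (4, 5, 3, 1, 2)) tuples = [(4, 1, 3, 5, 2), (4, 5, 3, 1, 2)]"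
  "filter (\<lambda>u. list_all (ld5 u) [2, 3] \<and> N_cand u (4, 1, 3, 5, 2)) tuples = [(4, 1, 3, 5, 2)]"
  "filter (\<lambda>u. list_all (ld5 u) [2, 3] \<and> N_cand u (1, 4, 3, 2, 5)) tuples = [(1, 4, 3, 2, 5), (4, 1, 3, 5, 2), (4, 5, 3, 1, 2)]"
  by code_simp+

text \<open>The products are 30 * 4 and 20 * 6: elements whose left descents contain
  \<open>L\<close> are the longest representatives of the cosets of the parabolic subgroup, one for
  each coset.\<close>

lemma coset_counts:
  "length (filter (\<lambda>t. list_all (ld5 t) [1, 4]) tuples) *
    length (filter (\<lambda>t. act5 t (fund_sum ({1..4} - set [1, 4])) = fund_sum ({1..4} - set [1, 4])) tuples) = 120"
  "length (filter (\<lambda>t. list_all (ld5 t) [2, 3]) tuples) *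
    length (filter (\<lambda>t. act5 t (fund_sum ({1..4} - set [2, 3])) = fund_sum ({1..4} - set [2, 3])) tuples) = 120"
proof -
  have e: "fund_sum ({1..4} - set [1, 4]) = (0, 1, 1, 0)" "fund_sum ({1..4} - set [2, 3]) = (1, 0, 0, 1)"
    by (simp_all add: fund_sum_eq)
  show "length (filter (\<lambda>t. list_all (ld5 t) [1, 4]) tuples) *
    length (filter (\<lambda>t. act5 t (fund_sum ({1..4} - set [1, 4])) = fund_sum ({1..4} - set [1, 4])) tuples) = 120"
    unfolding e by code_simp
  show "length (filter (\<lambda>t. list_all (ld5 t) [2, 3]) tuples) *
    length (filter (\<lambda>t. act5 t (fund_sum ({1..4} - set [2, 3])) = fund_sum ({1..4} - set [2, 3])) tuples) = 120"
    unfolding e by code_simp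
qed

lemma frob_f_invariant:
  assumes "t \<in> set tuples" "k \<in> {1..4}" "ld5 t k"
  shows "act (s k) (frob q (f_basis (perm5 t))) = frob q (f_basis (perm5 t))"
  using act_frob[OF assms(2)] act_f_basis[OF perm5_W[OF assms(1)] assms(2)] assms by (simp del: in_tuples ld5_def)

lemma w0_eq: "w0 = rev5"
proof -
  have T: "list_all (\<lambda>t. len5 t \<le> 10 \<and> (len5 t = 10 \<longrightarrow> t = (5, 4, 3, 2, 1))) tuples"
    by code_simp
  have m: "len w \<le> 10 \<and> (len w = 10 \<longrightarrow> w = rev5)" if "w \<in> W" for w
  proof -
    have "len5 (tup w) \<le> 10 \<and> (len5 (tup w) = 10 \<longrightarrow> tup w = (5, 4, 3, 2, 1))"
      using T tup_in_tuples[OF that] unfolding list_all_iff by blast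
    then show ?thesis
      using len_tup[OF that] perm5_tup[OF that] unfolding rev5_def by metis
  qed
  have r: "len rev5 = 10"
    unfolding rev5_def by simp
  show ?thesis
    unfolding w0_def
  proof (rule the_equality)
    show "rev5 \<in> W \<and> (\<forall>x\<in>W. len x \<le> len rev5)"
      using m r by simp
    fix w
    assume w: "w \<in> W \<and> (\<forall>x\<in>W. len x \<le> len w)"
    then have "10 \<le> len w"
      using r rev5_W by metis
    then show "w = rev5"
      using m[of w] w by simp
  qed
qed

lemma perm5_comp:
  assumes "t \<in> set tuples" "u \<in> set tuples"
  shows "perm5 t \<circ> perm5 u = perm5 (tup (perm5 t \<circ> perm5 u))"
  using perm5_tup[OF comp_W[OF perm5_W[OF assms(1)] perm5_W[OF assms(2)]]] by (rule sym)

lemma w0_comp: "w0 \<circ> pa = pc" "w0 \<circ> pb = pe" "w0 \<circ> pc = pa" "w0 \<circ> pe = pb"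
  unfolding w0_eq rev5_def by (subst perm5_comp, simp, simp, simp add: tup_def perm5.simps)+

lemma poly_eval:
  "eval_fun Dt (frob q (exs L_c) * ex (-1, 0, 0, -1)) = ev (int q) [0, 0, 0, -8, 0, -152, 0, -128, 0, 0, 0]"
  "eval_fun Dt (frob q (exs L_e) * ex (0, -1, -1, 0)) = ev (int q) [0, 0, 32, 0, 200, 0, 56, 0, 0, 0, 0]"
  "eval_fun Dt (frob q (exs L_b) * ex (-1, 0, 0, -1)) = ev (int q) [0, 0, 0, -4, 28, -76, 100, -64, 16, 0, 0]"
  "eval_fun Dt (frob q (exs L_b) * ex (-1, 1, 1, -1)) = ev (int q) [0, 0, 0, 4, 28, 76, 100, 64, 16, 0, 0]"
  "eval_fun Dt (frob q (exs L_a) * ex (1, -1, -1, 1)) = ev (int q) [0, 0, 0, -4, 0, 8, 0, -4, 0, 0, 0]"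
  "eval_fun Dt (frob q (exs L_a) * ex (0, -1, -1, 0)) = ev (int q) [0, 0, 16, -64, 100, -76, 28, -4, 0, 0, 0]"
  "eval_fun Dt (frob q (exs L_a) * ex (2, -1, -1, 2)) = ev (int q) [0, 0, -16, -64, -100, -76, -28, -4, 0, 0, 0]"
  by (simp_all only: ev_Dsum polynomial_values)

lemma N_eval:
  "eval_fun Dt (exs L_c * ex (-1, 0, 0, -1)) = -288"
  "eval_fun Dt (exs L_e * ex (0, -1, -1, 0)) = 288"
  "eval_fun Dt (exs L_b * ex (-1, 1, 1, -1)) = 288"
  "eval_fun Dt (exs L_c * ex (-1, 1, 1, -1)) = 288"
  "eval_fun Dt (exs L_u * ex (1, -1, -1, 1)) = -288"
  "eval_fun Dt (exs L_u * ex (0, -1, -1, 0)) = 0"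
  "eval_fun Dt (exs L_a * ex (2, -1, -1, 2)) = -288"
  "eval_fun Dt (exs L_u * ex (2, -1, -1, 2)) = 576"
  "eval_fun Dt (exs L_e * ex (2, -1, -1, 2)) = -288"
  by (simp_all only: eval_exs N_values)

lemmas computed_values = f_basis_values e_desc_values poly_eval N_eval

text \<open>A single candidate survives at \<open>e_desc pc\<close>, so one equation suffices. Its
  coefficient is 288 times the sign of \<open>pc\<close>, an element of odd length 7.\<close>

lemma vdim_M_pa: "288 * vdim (M q pa) = ev (int q) [0, 0, 0, 8, 0, 152, 0, 128, 0, 0, 0]"
proof -
  have h: "act (s k) (frob q (f_basis pc)) = frob q (f_basis pc)" if "k \<in> set [1, 4]" for k
    using that by (intro frob_f_invariant) auto
  define m where "m u = vdim (pairing (frob q (f_basis pc)) (f_dual u))" for u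
  have "eval_fun Dt (frob q (f_basis pc) * e_desc pc) =
    (\<Sum>u\<in>set [(5, 2, 3, 4, 1)]. m (perm5 u) * eval_fun Dt (f_basis (perm5 u) * e_desc pc))"
    unfolding m_def by (rule eval_expansion[OF _ coset_counts(1) h _ candidates(1)]) simp_all
  then have e1: "ev (int q) [0, 0, 0, -8, 0, -152, 0, -128, 0, 0, 0] = - 288 * m pc"
    by (simp add: computed_values del: exs_simps ev_simps)
  have "M q pa = pairing (frob q (f_basis pc)) (f_dual (w0 \<circ> pa))"
    by (simp add: M_def duflo_pa w0_comp)
  then have "vdim (M q pa) = m pc"
    by (simp add: m_def w0_comp)
  \<comment> \<open>The values of \<open>ev\<close> are atoms for the final linear arithmetic; this
    addition of coefficient lists supplies the relation between them.\<close>
  moreover have "ev (int q) [0, 0, 0, 8, 0, 152, 0, 128, 0, 0, 0] + ev (int q) [0, 0, 0, -8, 0, -152, 0, -128, 0, 0, 0] = 0"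
    unfolding ev_padd[symmetric] by simp
  ultimately show ?thesis
    using e1 by linarith
qed

text \<open>Two candidates remain at \<open>e_desc pe\<close>, but the one for \<open>pu\<close> has
  coefficient 0.\<close>

lemma vdim_M_pb: "288 * vdim (M q pb) = ev (int q) [0, 0, 32, 0, 200, 0, 56, 0, 0, 0, 0]"
proof -
  have h: "act (s k) (frob q (f_basis pe)) = frob q (f_basis pe)" if "k \<in> set [2, 3]" for k
    using that by (intro frob_f_invariant) auto
  define m where "m u = vdim (pairing (frob q (f_basis pe)) (f_dual u))" for u
  have "eval_fun Dt (frob q (f_basis pe) * e_desc pe) =
    (\<Sum>u\<in>set [(4, 1, 3, 5, 2), (4, 5, 3, 1, 2)]. m (perm5 u) * eval_fun Dt (f_basis (perm5 u) * e_desc pe))"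
    unfolding m_def by (rule eval_expansion[OF _ coset_counts(2) h _ candidates(3)]) simp_all
  then have e1: "ev (int q) [0, 0, 32, 0, 200, 0, 56, 0, 0, 0, 0] = 288 * m pe"
    by (simp add: computed_values del: exs_simps ev_simps)
  have "M q pb = pairing (frob q (f_basis pe)) (f_dual (w0 \<circ> pb))"
    by (simp add: M_def duflo_pb w0_comp)
  then have "vdim (M q pb) = m pe"
    by (simp add: m_def w0_comp)
  then show ?thesis
    using e1 by linarith
qed

lemma vdim_M_pe: "288 * vdim (M q pe) = ev (int q) [0, 0, 0, 0, 56, 0, 200, 0, 32, 0, 0]"
proof -
  have h: "act (s k) (frob q (f_basis pb)) = frob q (f_basis pb)" if "k \<in> set [1, 4]" for k
    using that by (intro frob_f_invariant) auto
  define m where "m u = vdim (pairing (frob q (f_basis pb)) (f_dual u))" for u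
  have "eval_fun Dt (frob q (f_basis pb) * e_desc pc) =
    (\<Sum>u\<in>set [(5, 2, 3, 4, 1)]. m (perm5 u) * eval_fun Dt (f_basis (perm5 u) * e_desc pc))"
    unfolding m_def by (rule eval_expansion[OF _ coset_counts(1) h _ candidates(1)]) simp_all
  then have e1: "ev (int q) [0, 0, 0, -4, 28, -76, 100, -64, 16, 0, 0] = - 288 * m pc"
    by (simp add: computed_values del: exs_simps ev_simps)
  have "eval_fun Dt (frob q (f_basis pb) * e_desc pb) =
    (\<Sum>u\<in>set [(2, 1, 3, 5, 4), (5, 2, 3, 4, 1)]. m (perm5 u) * eval_fun Dt (f_basis (perm5 u) * e_desc pb))"
    unfolding m_def by (rule eval_expansion[OF _ coset_counts(1) h _ candidates(2)]) simp_all
  then have e2: "ev (int q) [0, 0, 0, 4, 28, 76, 100, 64, 16, 0, 0] = 288 * m pb + 288 * m pc"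
    by (simp add: computed_values del: exs_simps ev_simps)
  have "M q pe = pairing (frob q (f_basis pb)) (f_dual (w0 \<circ> pe))"
    by (simp add: M_def duflo_pe w0_comp)
  then have "vdim (M q pe) = m pb"
    by (simp add: m_def w0_comp)
  moreover have "ev (int q) [0, 0, 0, 4, 28, 76, 100, 64, 16, 0, 0] + ev (int q) [0, 0, 0, -4, 28, -76, 100, -64, 16, 0, 0] = ev (int q) [0, 0, 0, 0, 56, 0, 200, 0, 32, 0, 0]"
    unfolding ev_padd[symmetric] by simp
  ultimately show ?thesis
    using e1 e2 by linarith
qed

text \<open>Three unknowns, found from three weights in turn: \<open>pu\<close>, then
  \<open>pe\<close>, then \<open>pa\<close>.\<close>

lemma vdim_M_pc: "288 * vdim (M q pc) = ev (int q) [0, 0, 0, 136, 0, 136, 0, 16, 0, 0, 0]"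
proof -
  have h: "act (s k) (frob q (f_basis pa)) = frob q (f_basis pa)" if "k \<in> set [2, 3]" for k
    using that by (intro frob_f_invariant) auto
  define m where "m u = vdim (pairing (frob q (f_basis pa)) (f_dual u))" for u
  have "eval_fun Dt (frob q (f_basis pa) * e_desc pu) =
    (\<Sum>u\<in>set [(4, 1, 3, 5, 2)]. m (perm5 u) * eval_fun Dt (f_basis (perm5 u) * e_desc pu))"
    unfolding m_def by (rule eval_expansion[OF _ coset_counts(2) h _ candidates(4)]) simp_all
  then have e1: "ev (int q) [0, 0, 0, -4, 0, 8, 0, -4, 0, 0, 0] = - 288 * m pu"
    by (simp add: computed_values del: exs_simps ev_simps)
  have "eval_fun Dt (frob q (f_basis pa) * e_desc pe) =
    (\<Sum>u\<in>set [(4, 1, 3, 5, 2), (4, 5, 3, 1, 2)]. m (perm5 u) * eval_fun Dt (f_basis (perm5 u) * e_desc pe))"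
    unfolding m_def by (rule eval_expansion[OF _ coset_counts(2) h _ candidates(3)]) simp_all
  then have e2: "ev (int q) [0, 0, 16, -64, 100, -76, 28, -4, 0, 0, 0] = 288 * m pe"
    by (simp add: computed_values del: exs_simps ev_simps)
  have "eval_fun Dt (frob q (f_basis pa) * e_desc pa) =
    (\<Sum>u\<in>set [(1, 4, 3, 2, 5), (4, 1, 3, 5, 2), (4, 5, 3, 1, 2)]. m (perm5 u) * eval_fun Dt (f_basis (perm5 u) * e_desc pa))"
    unfolding m_def by (rule eval_expansion[OF _ coset_counts(2) h _ candidates(5)]) simp_all
  then have e3: "ev (int q) [0, 0, -16, -64, -100, -76, -28, -4, 0, 0, 0] = - 288 * m pa + 576 * m pu - 288 * m pe"
    by (simp add: computed_values del: exs_simps ev_simps)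
  have "M q pc = pairing (frob q (f_basis pa)) (f_dual (w0 \<circ> pc))"
    by (simp add: M_def duflo_pc w0_comp)
  then have "vdim (M q pc) = m pa"
    by (simp add: m_def w0_comp)
  \<comment> \<open>The elimination in terms of coefficient lists; the list of the first equation
    occurs twice because \<open>pu\<close> enters the third with 576 = 2 * 288.\<close>
  moreover have "ev (int q) [0, 0, 0, 136, 0, 136, 0, 16, 0, 0, 0] + ev (int q) [0, 0, -16, -64, -100, -76, -28, -4, 0, 0, 0] + ev (int q) [0, 0, 16, -64, 100, -76, 28, -4, 0, 0, 0] + ev (int q) [0, 0, 0, -4, 0, 8, 0, -4, 0, 0, 0] + ev (int q) [0, 0, 0, -4, 0, 8, 0, -4, 0, 0, 0] = 0"
    unfolding ev_padd[symmetric] by simp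
  ultimately show ?thesis
    using e1 e2 e3 by linarith
qed

text \<open>The description of \<open>P w\<close> is unique because a polynomial is determined by
  its values at the infinitely many primes.\<close>

lemma P_eqI:
  assumes "\<And>q. 288 * vdim (M q w) = ev (int q) cs"
  shows "poly (P w) t = foldr (\<lambda>c r. of_int c + t * r) cs 0 / 288"
proof -
  define p :: "rat poly" where "p = Polynomial.smult (1 / 288) (Poly (map of_int cs))"
  have e: "poly (Poly (map of_int cs)) t = foldr (\<lambda>c r. of_int c + t * r) cs 0" for t :: rat
    by (induction cs) simp_all
  have i: "foldr (\<lambda>c r. of_int c + of_nat q * r) cs 0 = (of_int (ev (int q) cs) :: rat)" for q
    by (induction cs) simp_all
  have p: "poly p (of_nat q) = of_int (vdim (M q w))" for q
    unfolding p_def poly_smult e i assms[of q, symmetric] by simp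
  have "P w = p"
    unfolding P_def
  proof (rule the_equality)
    fix p' :: "rat poly"
    assume p': "\<forall>q::nat. primepow q \<longrightarrow> poly p' (of_nat q) = of_int (vdim (M q w))"
    have "infinite {q::nat. prime q}"
      by (rule primes_infinite)
    then have "infinite ((of_nat :: nat \<Rightarrow> rat) ` {q. prime q})"
      by (subst finite_image_iff) (auto simp: inj_on_def)
    moreover have "(of_nat :: nat \<Rightarrow> rat) ` {q. prime q} \<subseteq> {x. poly (p' - p) x = 0}"
      using p p' by (auto simp: primepow_prime)
    ultimately have "infinite {x. poly (p' - p) x = 0}"
      using finite_subset by blast
    then have "p' - p = 0"
      using poly_roots_finite by blast
    then show "p' = p" by simp
  qed (use p in blast)
  then show ?thesis
    by (simp add: p_def e)
qed

lemmas P_values = P_eqI[OF vdim_M_pa] P_eqI[OF vdim_M_pb] P_eqI[OF vdim_M_pc] P_eqI[OF vdim_M_pe]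

text \<open>At \<open>t = 1\<close> all four polynomials have the value 1, so the sign would have to be \<open>+\<close>; parity
  (at \<open>t = -1\<close>) excludes two pairs, and the values at \<open>t = 2\<close> the other two.\<close>

lemma reversed_pair_at:
  assumes "reversed_pair w w'"
  shows "(\<forall>t::rat\<in>{1, -1, 2}. t ^ 10 * poly (P w) (1 / t) = poly (P w') t) \<or>
    (\<forall>t::rat\<in>{1, -1, 2}. t ^ 10 * poly (P w) (1 / t) = - poly (P w') t)"
  using assms unfolding reversed_pair_def nu_eq
proof (elim disjE)
  assume *: "\<forall>t::rat. t \<noteq> 0 \<longrightarrow> t ^ 10 * poly (P w) (1 / t) = poly (P w') t"
  show ?thesis
    by (intro disjI1 ballI *[rule_format]) auto
next
  assume *: "\<forall>t::rat. t \<noteq> 0 \<longrightarrow> t ^ 10 * poly (P w) (1 / t) = - poly (P w') t"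
  show ?thesis
    by (intro disjI2 ballI *[rule_format]) auto
qed

lemma not_reversed: "\<not> reversed_pair pa pb" "\<not> reversed_pair pa pc" "\<not> reversed_pair pc pa" "\<not> reversed_pair pc pe"
  by (rule notI, drule reversed_pair_at, simp add: P_values)+

section \<open>The main theorem\<close>

lemma left_descents_complement:
  assumes w: "w \<in> W" "w' \<in> W" and e: "left_descents w' = S - left_descents w" and k: "k \<in> {1..4}"
  shows "ld w' k \<longleftrightarrow> \<not> ld w k"
proof -
  have "s k \<in> S"
    using k by (simp add: S_def)
  then have "s k \<in> left_descents v \<longleftrightarrow> ld v k" if "v \<in> W" for v
    using ld_iff[OF that k] by (simp add: left_descents_def)
  then show ?thesis
    using e w \<open>s k \<in> S\<close> by blast
qed

lemma no_partner:
  assumes "w = pa \<or> w = pc" "w' \<in> J" "left_descents w' = S - left_descents w"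
  shows "\<not> reversed_pair w w'"
proof -
  have W: "w \<in> W" "w' \<in> W"
    using assms(1) perm5_W[of "(1, 4, 3, 2, 5)"] perm5_W[of "(5, 2, 3, 4, 1)"] J_descents(1)[OF assms(2), of 1] by auto
  have d: "ld w' k \<longleftrightarrow> \<not> ld w k" if "k \<in> {1..4}" for k
    by (rule left_descents_complement[OF W assms(3) that])
  from assms(1) show ?thesis
  proof
    assume w: "w = pa"
    have "ld w' k \<longleftrightarrow> k = 1 \<or> k = 4" if "k \<in> {1..4}" for k
      using that d[OF that] unfolding w atLeastAtMost_1_4 by (elim insertE emptyE) simp_all
    then show ?thesis
      using J_rd_14[OF assms(2)] not_reversed w by blast
  next
    assume w: "w = pc"
    have "ld w' k \<longleftrightarrow> k = 2 \<or> k = 3" if "k \<in> {1..4}" for k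
      using that d[OF that] unfolding w atLeastAtMost_1_4 by (elim insertE emptyE) simp_all
    then show ?thesis
      using J_rd_23[OF assms(2)] not_reversed w by blast
  qed
qed

lemma sprod_values: "sprod [2, 3, 2] = pa" "sprod [1, 2, 3, 4, 3, 2, 1] = pc"
proof -
  have "perm5 (tup (sprod [2, 3, 2])) = sprod [2, 3, 2]" "perm5 (tup (sprod [1, 2, 3, 4, 3, 2, 1])) = sprod [1, 2, 3, 4, 3, 2, 1]"
    by (rule perm5_tup, rule sprod_W, simp)+
  then show "sprod [2, 3, 2] = pa" "sprod [1, 2, 3, 4, 3, 2, 1] = pc"
    by (simp_all add: tup_def s_apply)
qed

text \<open>The involution property speaks of members of \<open>J\<close> only, so the obstruction
  at \<open>pa\<close> refutes it once \<open>pa\<close> is known to be one.\<close>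

lemma pa_J: "pa \<in> J"
proof -
  have "inv pa = pa"
    by (rule inv_unique_comp) (rule ext, simp add: perm5.simps)+
  then show ?thesis
    using perm5_W[of "(1, 4, 3, 2, 5)"] by (simp add: J_def left_cell_refl)
qed

theorem proposition5p5:
  shows "\<not> (\<exists>\<tau> :: perm \<Rightarrow> perm.
             (\<forall>w\<in>J. \<tau> w \<in> J \<and> \<tau> (\<tau> w) = w) \<and>
             (\<forall>w\<in>J. reversed_pair w (\<tau> w) \<and> left_descents (\<tau> w) = S - left_descents w))
         \<and>
         (\<forall>w \<in> {sprod [2, 3, 2], sprod [1, 2, 3, 4, 3, 2, 1]}.
            \<not> (\<exists>w'\<in>J. reversed_pair w w' \<and> left_descents w' = S - left_descents w))"
proof -
  have "\<not> (\<exists>w'\<in>J. reversed_pair w w' \<and> left_descents w' = S - left_descents w)" if "w = pa \<or> w = pc" for w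
    using no_partner[OF that] by blast
  then show ?thesis
    unfolding sprod_values using pa_J by blast
qed

end
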